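(* In the setting of the context (in particular conditions (A)–(F) hold), suppose that the functional $F$ has the form $F(x)=Ef(\omega,x(\omega))$, $x\in X$, where $f$ satisfies conditions (C1)–(C3) of the context. Then there exist stochastic Lagrange multipliers $p_t,q_t$ ($t\in T$) relaxing the constraints $g_t(\omega,x^t(\omega))\ge0$ a.s. and $x_t-E_tx_t=0$ almost surely. That is, there exist stochastic Lagrange multipliers $p_t,q_t$ ($t\in T$) relaxing these constraints in problem ($\mathcal{P}$) such that, with $\tilde q_t:=E_tq_t$ and $$l(\omega,a):=f(\omega,a)+\sum_{t\in T}\bigl[p_t(\omega)g_t(\omega,a^t)+(q_t(\omega)-\tilde q_t(\omega))a_t\bigr],\qquad a\in A(\omega),$$ for each solution $\bar x$ to problem ($\mathcal{P}$), $$\max_{a\in A(\omega)}l(\omega,a)=l(\omega,\bar x(\omega))\ \text{ a.s.}\qquad\text{and}\qquad p_tg_t(\bar x^t)=0\ \text{ a.s. for all } t\in T.$$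
   Context: **Model.** $(\Omega,\mathcal{F},P)$ is a probability space, $E$ is expectation with respect to $P$, "a.s." is with respect to $P$. $T$ is a finite set of decision makers acting at times $0,1,\dots,N$; $n(t)\in\{0,\dots,N\}$ is the time at which $t\in T$ acts, and $T_n:=\{t: n(t)=n\}\ne\emptyset$ for each $n$. $T$ carries a partial order $\preccurlyeq$ (write $t\prec s$ if $t\preccurlyeq s$, $t\ne s$) such that $t\prec s$ implies $n(t)<n(s)$. To each $t\in T$ corresponds a $\sigma$-algebra $\mathcal{F}_t\subseteq\mathcal{F}$, with $\mathcal{F}_t\subseteq\mathcal{F}_s$ whenever $t\prec s$. $E_t\xi:=E(\xi\mid\mathcal{F}_t)$. For each $t$: $V_t$ is a vector space of finite dimension $m_t$ (identified with $\mathbb{R}^{m_t}$), $W_t$ is a vector space of finite dimension $l_t$ (identified with $\mathbb{R}^{l_t}$), and $A_t(\omega)\subseteq V_t$ is given for each $\omega\in\Omega$. Inequalities between vectors (strict and non-strict) are coordinate-wise; products such as $p_tg_t$ and $q_tx_t$ are scalar products. Put $V^t=\prod_{i\preccurlyeq t}V_i$, $\mathcal{B}^t$ = Borel $\sigma$-algebra of $V^t$, $A^t(\omega)=\prod_{i\preccurlyeq t}A_i(\omega)$, $A(\omega)=\prod_{t\in T}A_t(\omega)$, and for $a=(a_i)_{i\in T}$ put $a^t=(a_i)_{i\preccurlyeq t}$ (likewise $x^t=(x_i)_{i\preccurlyeq t}$). For each $t$ a function $g_t(\omega,a^t)$, $\omega\in\Omega$, $a^t\in V^t$, with values in $W_t$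 is given. The argument $\omega$ is often omitted: $g_t(x^t)$ means $g_t(\omega,x^t(\omega))$. A *program* is a collection $x=(x_t)_{t\in T}$ of $\mathcal{F}$-measurable functions $x_t:\Omega\to V_t$ with $x_t(\omega)\in A_t(\omega)$ a.s. for each $t$; $X$ is the set of all programs. $H\subseteq X$ is the set of *adapted* programs: those with $x_t$ being $\mathcal{F}_t$-measurable for every $t$. A real-valued functional $F$ on $X$ is given. **Problem ($\mathcal{P}$):** maximize $F(x)$ over all *feasible* programs, i.e. over all adapted programs $x\in H$ with $g_t(\omega,x^t(\omega))\ge0$ a.s. for all $t\in T$. A solution is a feasible program attaining the maximum. (The adaptedness requirement is represented as $x_t-E_tx_t=0$.) For $s\in T$, an adapted program $x$ is called *$s$-feasible* if $g_t(\omega,x^t(\omega))\ge 0$ a.s. for all $t\prec s$. **Stochastic Lagrange multipliers.** Functions $p_t,q_t$ ($t\in T$) are *stochastic Lagrange multipliers relaxing the constraints* $g_t(\omega,x^t(\omega))\ge0$ a.s. and $x_t-E_tx_t=0$ if: (a) $p_t$ is a non-negative $\mathcal{F}_t$-measurable integrable function with values in $W_t$; (b) $q_t$ is an $\mathcal{F}$-measurable integrable function with values in $V_t$; (c) for all programs $x\in X$ and each solution $\bar x$ to ($\mathcal{P}$), $L(x)\le L(\bar x)$ and $E\,p_tg_t(\bar x^t)=0$ for each $t\in T$, where $L(x):=F(x)+\sum_{t\in T}E\,p_tg_t(x^t)+\sum_{t\in T}E\,q_t(x_t-E_tx_t)$. **Standing conditions.** (A) For each $t$, the set $A_t(\omega)$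 is convex, closed, uniformly bounded (in $\omega$), and depends $\mathcal{F}_t$-measurably on $\omega$: for each point $a\in V_t$ the distance between $a$ and $A_t(\omega)$ is an $\mathcal{F}_t$-measurable function of $\omega$. (B) Each $g_t(\omega,a^t)$ is measurable with respect to $\mathcal{F}_t\times\mathcal{B}^t$. For every $t$ and $\omega$, $g_t(\omega,a^t)$ is continuous and (coordinate-wise) concave in $a^t\in A^t(\omega)$. There is a number $c$ such that $|g_t(\omega,a^t)|\le c$ for all $\omega,t,a^t$. (C) $F$ is concave on $X$ and continuous on $X$ with respect to a.s. convergence. (D) There exist an adapted program $(\mathring{x}_t)\in H$ and a real number $\theta>0$ such that for any $t$ and $\omega$ the set $A_t(\omega)$ contains a ball of radius $\theta$ centred at $\mathring{x}_t(\omega)$. (E) There exist an adapted program $\hat x=(\hat x_t)\in H$ and constant vectors $\kappa_t>0$ in $W_t$ such that $g_t(\hat x^t)\ge\kappa_t$ a.s. for all $t\in T$. (F) For every $s\in T$ and each $s$-feasible adapted program $(x_t)\in H$ there exists $(\tilde x_t)\in H$ such that $x_t=\tilde x_t$ for $t\ne s$ and $g_s(\tilde x^s)\ge0$ a.s. **Conditions on $f$.** $f(\omega,a)$ is a real-valued function defined for $\omega\in\Omega$ and $a=(a_t)_{t\in T}\in A(\omega)$. (C1) The function $f^\infty(\omega,a)$ equal to $f(\omega,a)$ for $a\in A(\omega)$ and to $\infty$ for $a\notin A(\omega)$ is measurable with respect to $(\omega,a)$. (C2) $f(\omega,a)$ is concave and upper semi-continuous in $a\in A(\omega)$. (C3)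 There is an integrable function $d(\omega)$ such that $|f(\omega,a)|\le d(\omega)$ for $a\in A(\omega)$ and $\omega\in\Omega$. *)

theory Defs
  imports "HOL-Probability.Probability"
begin

(* real_cond_exp is only available for real-valued functions; here it is applied coordinate by
   coordinate. *)
definition vec_cond_exp :: "'a measure \<Rightarrow> 'a measure \<Rightarrow> ('a \<Rightarrow> 'v::euclidean_space) \<Rightarrow> 'a \<Rightarrow> 'v" where
  "vec_cond_exp M G \<xi> = (\<lambda>\<omega>. \<Sum>b\<in>Basis. real_cond_exp M G (\<lambda>\<omega>'. \<xi> \<omega>' \<bullet> b) \<omega> *\<^sub>R b)"

definition upper_semicontinuous_on :: "'a::topological_space set \<Rightarrow> ('a \<Rightarrow> real) \<Rightarrow> bool" where
  "upper_semicontinuous_on S h \<longleftrightarrow>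
     (\<forall>a\<in>S. \<forall>y. h a < y \<longrightarrow> (\<forall>\<^sub>F b in at a within S. h b < y))"

(* The decision makers are the elements of the finite partially ordered type 't.
   The spaces V t, of dimensions varying with t, are linear subspaces of one Euclidean space 'v.
   The spaces W t, in which coordinates matter, are the coordinate subspaces span (J t) of 'w,
   for sets J t of basis vectors: span (J t) is R^(card (J t)), with coordinates w \<bullet> b for b in J t.
   A family a = (a_t) is an element of ('v, 't) vec. The partial family of its components with index
   at most t is represented by the element of ('v, 't) vec that is zero at all other indices (past t a);
   Vupto t is the product of the V i over i \<le> t in this representation. *)
locale decision_model = prob_space M for M :: "'a measure" +
  fixes N :: nat
    and time :: "'t::{finite,order} \<Rightarrow> nat"
    and G :: "'t \<Rightarrow> 'a measure"
    and V :: "'t \<Rightarrow> 'v::euclidean_space set"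
    and J :: "'t \<Rightarrow> 'w::euclidean_space set"
    and A :: "'t \<Rightarrow> 'a \<Rightarrow> 'v set"
    and g :: "'t \<Rightarrow> 'a \<Rightarrow> ('v, 't) vec \<Rightarrow> 'w"
    and F :: "('a \<Rightarrow> ('v, 't) vec) \<Rightarrow> real"
  assumes range_time: "range time = {0..N}"
    and time_less: "t < s \<Longrightarrow> time t < time s"
    and subalgebra_G: "subalgebra M (G t)"
    and sets_G_mono: "t < s \<Longrightarrow> sets (G t) \<subseteq> sets (G s)"
    and subspace_V: "subspace (V t)"
    and J_subset: "J t \<subseteq> Basis"
    and A_subset: "\<omega> \<in> space M \<Longrightarrow> A t \<omega> \<subseteq> V t"
begin

definition W :: "'t \<Rightarrow> 'w set" where
  "W t = span (J t)"

definition le_W :: "'t \<Rightarrow> 'w \<Rightarrow> 'w \<Rightarrow> bool" where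
  "le_W t u v \<longleftrightarrow> (\<forall>b\<in>J t. u \<bullet> b \<le> v \<bullet> b)"

definition less_W :: "'t \<Rightarrow> 'w \<Rightarrow> 'w \<Rightarrow> bool" where
  "less_W t u v \<longleftrightarrow> (\<forall>b\<in>J t. u \<bullet> b < v \<bullet> b)"

definition past :: "'t \<Rightarrow> ('v, 't) vec \<Rightarrow> ('v, 't) vec" where
  "past t a = (\<chi> i. if i \<le> t then a $ i else 0)"

definition Vprod :: "('v, 't) vec set" where
  "Vprod = {a. \<forall>t. a $ t \<in> V t}"

definition Aprod :: "'a \<Rightarrow> ('v, 't) vec set" where
  "Aprod \<omega> = {a. \<forall>t. a $ t \<in> A t \<omega>}"

definition Vupto :: "'t \<Rightarrow> ('v, 't) vec set" where
  "Vupto t = {a. \<forall>i. a $ i \<in> (if i \<le> t then V i else {0})}"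

definition Aupto :: "'t \<Rightarrow> 'a \<Rightarrow> ('v, 't) vec set" where
  "Aupto t \<omega> = {a. \<forall>i. a $ i \<in> (if i \<le> t then A i \<omega> else {0})}"

definition programs :: "('a \<Rightarrow> ('v, 't) vec) set" where
  "programs = {x. \<forall>t. (\<lambda>\<omega>. x \<omega> $ t) \<in> borel_measurable M \<and>
                      (\<forall>\<omega>\<in>space M. x \<omega> $ t \<in> V t) \<and>
                      (AE \<omega> in M. x \<omega> $ t \<in> A t \<omega>)}"

definition adapted_programs :: "('a \<Rightarrow> ('v, 't) vec) set" where
  "adapted_programs = {x \<in> programs. \<forall>t. (\<lambda>\<omega>. x \<omega> $ t) \<in> borel_measurable (G t)}"

definition satisfies_constraint :: "'t \<Rightarrow> ('a \<Rightarrow> ('v, 't) vec) \<Rightarrow> bool" where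
  "satisfies_constraint t x \<longleftrightarrow> (AE \<omega> in M. le_W t 0 (g t \<omega> (past t (x \<omega>))))"

definition feasible :: "('a \<Rightarrow> ('v, 't) vec) \<Rightarrow> bool" where
  "feasible x \<longleftrightarrow> x \<in> adapted_programs \<and> (\<forall>t. satisfies_constraint t x)"

definition feasible_before :: "'t \<Rightarrow> ('a \<Rightarrow> ('v, 't) vec) \<Rightarrow> bool" where
  "feasible_before s x \<longleftrightarrow> x \<in> adapted_programs \<and> (\<forall>t<s. satisfies_constraint t x)"

definition solution :: "('a \<Rightarrow> ('v, 't) vec) \<Rightarrow> bool" where
  "solution x \<longleftrightarrow> feasible x \<and> (\<forall>y. feasible y \<longrightarrow> F y \<le> F x)"

definition Lagrangian :: "('t \<Rightarrow> 'a \<Rightarrow> 'w) \<Rightarrow> ('t \<Rightarrow> 'a \<Rightarrow> 'v) \<Rightarrow> ('a \<Rightarrow> ('v, 't) vec) \<Rightarrow> real" where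
  "Lagrangian p q x =
     F x + (\<Sum>t\<in>UNIV. expectation (\<lambda>\<omega>. p t \<omega> \<bullet> g t \<omega> (past t (x \<omega>))))
         + (\<Sum>t\<in>UNIV. expectation
              (\<lambda>\<omega>. q t \<omega> \<bullet> (x \<omega> $ t - vec_cond_exp M (G t) (\<lambda>\<omega>'. x \<omega>' $ t) \<omega>)))"

definition Lagrange_multipliers :: "('t \<Rightarrow> 'a \<Rightarrow> 'w) \<Rightarrow> ('t \<Rightarrow> 'a \<Rightarrow> 'v) \<Rightarrow> bool" where
  "Lagrange_multipliers p q \<longleftrightarrow>
     (\<forall>t. p t \<in> borel_measurable (G t) \<and> integrable M (p t) \<and>
          (\<forall>\<omega>\<in>space M. p t \<omega> \<in> W t \<and> le_W t 0 (p t \<omega>))) \<and>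
     (\<forall>t. q t \<in> borel_measurable M \<and> integrable M (q t) \<and> (\<forall>\<omega>\<in>space M. q t \<omega> \<in> V t)) \<and>
     (\<forall>x\<in>programs. \<forall>xbar. solution xbar \<longrightarrow>
        Lagrangian p q x \<le> Lagrangian p q xbar \<and>
        (\<forall>t. expectation (\<lambda>\<omega>. p t \<omega> \<bullet> g t \<omega> (past t (xbar \<omega>))) = 0))"

end

locale regular_decision_model = decision_model +
  assumes A_convex: "\<omega> \<in> space M \<Longrightarrow> convex (A t \<omega>)"
    and A_closed: "\<omega> \<in> space M \<Longrightarrow> closed (A t \<omega>)"
    and A_bounded: "\<exists>K. \<forall>\<omega>\<in>space M. \<forall>a\<in>A t \<omega>. norm a \<le> K"
    and A_measurable: "v \<in> V t \<Longrightarrow> (\<lambda>\<omega>. infdist v (A t \<omega>)) \<in> borel_measurable (G t)"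
    and g_range: "\<omega> \<in> space M \<Longrightarrow> a \<in> Vupto t \<Longrightarrow> g t \<omega> a \<in> W t"
    and g_measurable:
      "(\<lambda>(\<omega>, a). g t \<omega> a) \<in> borel_measurable (G t \<Otimes>\<^sub>M restrict_space borel (Vupto t))"
    and g_continuous: "\<omega> \<in> space M \<Longrightarrow> continuous_on (Aupto t \<omega>) (g t \<omega>)"
    and g_concave: "\<omega> \<in> space M \<Longrightarrow> b \<in> J t \<Longrightarrow> concave_on (Aupto t \<omega>) (\<lambda>a. g t \<omega> a \<bullet> b)"
    and g_bounded: "\<exists>c. \<forall>t. \<forall>\<omega>\<in>space M. \<forall>a\<in>Vupto t. norm (g t \<omega> a) \<le> c"
    and F_concave: "x \<in> programs \<Longrightarrow> y \<in> programs \<Longrightarrow> 0 \<le> u \<Longrightarrow> u \<le> 1 \<Longrightarrow>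
      u * F x + (1 - u) * F y \<le> F (\<lambda>\<omega>. u *\<^sub>R x \<omega> + (1 - u) *\<^sub>R y \<omega>)"
    and F_continuous: "x \<in> programs \<Longrightarrow> (\<And>k::nat. z k \<in> programs) \<Longrightarrow>
      (AE \<omega> in M. (\<lambda>k. z k \<omega>) \<longlonglongrightarrow> x \<omega>) \<Longrightarrow> (\<lambda>k. F (z k)) \<longlonglongrightarrow> F x"
    and interior_program: "\<exists>x\<in>adapted_programs. \<exists>\<theta>>0.
      \<forall>t. \<forall>\<omega>\<in>space M. cball (x \<omega> $ t) \<theta> \<inter> V t \<subseteq> A t \<omega>"
    and strictly_feasible_program: "\<exists>x\<in>adapted_programs. \<exists>\<kappa>. \<forall>t. \<kappa> t \<in> W t \<and> less_W t 0 (\<kappa> t) \<and>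
      (AE \<omega> in M. le_W t (\<kappa> t) (g t \<omega> (past t (x \<omega>))))"
    and feasible_correction: "feasible_before s x \<Longrightarrow>
      \<exists>y\<in>adapted_programs. (\<forall>t. t \<noteq> s \<longrightarrow> (\<forall>\<omega>\<in>space M. y \<omega> $ t = x \<omega> $ t)) \<and>
        satisfies_constraint s y"

(* An integrand f is given on pairs (\<omega>, a) with a in A(\<omega>) only, and programs lie in A(\<omega>) only
   almost surely; hence the integrand of the objective is set to 0 on the null set where
   x \<omega> is outside A(\<omega>), so that the values of f off A(\<omega>) are irrelevant. *)
locale integral_objective = regular_decision_model M N time G V J A g F
  for M :: "'a measure"
    and N :: nat
    and time :: "'t::{finite,order} \<Rightarrow> nat"
    and G :: "'t \<Rightarrow> 'a measure"
    and V :: "'t \<Rightarrow> 'v::euclidean_space set"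
    and J :: "'t \<Rightarrow> 'w::euclidean_space set"
    and A :: "'t \<Rightarrow> 'a \<Rightarrow> 'v set"
    and g :: "'t \<Rightarrow> 'a \<Rightarrow> ('v, 't) vec \<Rightarrow> 'w"
    and F :: "('a \<Rightarrow> ('v, 't) vec) \<Rightarrow> real" +
  fixes f :: "'a \<Rightarrow> ('v, 't) vec \<Rightarrow> real"
  assumes F_eq: "x \<in> programs \<Longrightarrow>
      F x = expectation (\<lambda>\<omega>. if x \<omega> \<in> Aprod \<omega> then f \<omega> (x \<omega>) else 0)"
    and f_measurable: "(\<lambda>(\<omega>, a). if a \<in> Aprod \<omega> then ereal (f \<omega> a) else \<infinity>)
      \<in> borel_measurable (M \<Otimes>\<^sub>M restrict_space borel Vprod)"
    and f_concave: "\<omega> \<in> space M \<Longrightarrow> concave_on (Aprod \<omega>) (f \<omega>)"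
    and f_usc: "\<omega> \<in> space M \<Longrightarrow> upper_semicontinuous_on (Aprod \<omega>) (f \<omega>)"
    and f_bounded: "\<exists>d. integrable M d \<and> (\<forall>\<omega>\<in>space M. \<forall>a\<in>Aprod \<omega>. \<bar>f \<omega> a\<bar> \<le> d \<omega>)"
begin

definition reduced_Lagrangian ::
    "('t \<Rightarrow> 'a \<Rightarrow> 'w) \<Rightarrow> ('t \<Rightarrow> 'a \<Rightarrow> 'v) \<Rightarrow> 'a \<Rightarrow> ('v, 't) vec \<Rightarrow> real" where
  "reduced_Lagrangian p q \<omega> a = f \<omega> a +
     (\<Sum>t\<in>UNIV. p t \<omega> \<bullet> g t \<omega> (past t a) + (q t \<omega> - vec_cond_exp M (G t) (q t) \<omega>) \<bullet> a $ t)"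

end

end

theory Submission
  imports Defs
begin

text \<open>Maximising the objective minus \<open>k/2\<close> times the squared \<open>L\<^sup>2\<close> size of the violations
  \<open>x\<^sub>t - E\<^sub>t x\<^sub>t\<close> and \<open>(E\<^sub>t g\<^sub>t(x\<^sup>t))\<^sup>-\<close>, over all programs, gives bounded multipliers, namely \<open>k\<close> times
  the violations, for which the Lagrangian exceeds the value of the problem by an arbitrarily small amount.
  The strictly feasible program and the interior program bound them in \<open>L\<^sup>1\<close>, so that suitable convex
  combinations converge almost surely to integrable \<open>p\<close>, \<open>q\<close>. As programs can be switched on arbitrary
  events, the limit Lagrangian is still maximised pointwise at the solution.

  The relation \<open>E\<^sub>t q\<^sub>t = 0\<close> may be lost in the limit, by mass escaping to events of small probability.
  The defect \<open>r\<^sub>t = E\<^sub>t q\<^sub>t\<close> is the cost vector of a linear problem that the same program solves,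
  even with the constraint of a maximal \<open>t\<close> dropped: that constraint is only needed on a small event
  carrying the mass that \<open>p\<^sub>t\<close> loses, and there the strategy at \<open>t\<close> can be corrected. So induction on the set
  of constraints gives multipliers for the linear problem, and adding them cancels the defect.\<close>

text \<open>A separating functional for this problem would live in the dual of L^infinity, and its
  singular part is represented by no integrable function. Bounded sets of L^1 are not weakly
  compact, so the penalty replaces separation and almost sure convergence replaces compactness;
  inequalities pass to the limit only on events where the approximations stay bounded.

  The relation E_t q_t = 0 is worth saving because E q_t (x_t - E_t x_t) equals E (q_t - E_t q_t)
  x_t: with it, the adaptedness term is the integral of the pointwise term q_t x_t, and adapted
  programs are not charged for it.

  A maximal t is dropped because a change of decision at t enters no other constraint still imposed;
  condition (F) supplies the change, and it applies since the imposed set contains all predecessors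
  of t. The event on which p_t loses mass belongs to the information at t, hence the corrected
  program stays adapted. Once no constraint is left, the solution minimises the cost r over all
  adapted programs; r_t being known at t, it does so pointwise, and r can simply be subtracted from
  q.\<close>

subsection \<open>Almost sure convergence of midpoints\<close>

text \<open>A quantitative form of strict convexity: the norm is affine only along rays, so a small
  defect in the triangle inequality forces the directions to agree. Both sides measure
  \<open>a * b - s\<close>, the defect in Cauchy-Schwarz; the lower bound 1 on the norms makes the
  constant uniform.\<close>

lemma normalized_diff_le_norm_add_deficit:
  fixes u v :: "'b::real_inner"
  assumes "1 \<le> norm u" and "1 \<le> norm v"
  shows "(norm (u /\<^sub>R norm u - v /\<^sub>R norm v))\<^sup>2 \<le> 4 * (norm u + norm v - norm (u + v))"
proof -
  define a b s n where "a = norm u" and "b = norm v" and "s = u \<bullet> v" and "n = norm (u + v)"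
  have a: "1 \<le> a" "a\<^sup>2 = u \<bullet> u" and b: "1 \<le> b" "b\<^sup>2 = v \<bullet> v"
    using assms by (auto simp: a_def b_def power2_norm_eq_inner)
  have n2: "n\<^sup>2 = a\<^sup>2 + b\<^sup>2 + 2 * s" and n0: "0 \<le> n" and nle: "n \<le> a + b"
    by (auto simp: n_def a b s_def power2_norm_eq_inner inner_add inner_commute)
      (auto simp: a_def b_def norm_triangle_ineq)
  have sle: "s \<le> a * b"
    unfolding s_def a_def b_def by (rule norm_cauchy_schwarz)
  have "(norm (u /\<^sub>R a - v /\<^sub>R b))\<^sup>2 = a\<^sup>2 / a\<^sup>2 + b\<^sup>2 / b\<^sup>2 - 2 * s / (a * b)"
    unfolding power2_norm_eq_inner inner_diff inner_scaleR_left inner_scaleR_right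
    using a b by (simp add: a(2)[symmetric] b(2)[symmetric] s_def[symmetric] inner_commute[of v u]
      power2_eq_square field_simps)
  also have "\<dots> = 2 * (a * b - s) / (a * b)"
    using a(1) b(1) by (simp add: field_simps)
  also have "\<dots> \<le> 4 * (a * b - s) / (a + b)"
  proof -
    have "a + b \<le> 2 * (a * b)"
      using mult_left_mono[OF b(1), of a] mult_right_mono[OF a(1), of b] a(1) b(1) by linarith
    then have "4 * (a * b - s) / (2 * (a * b)) \<le> 4 * (a * b - s) / (a + b)"
      using sle a(1) b(1) by (intro divide_left_mono) auto
    moreover have "4 * (a * b - s) / (2 * (a * b)) = 2 * (a * b - s) / (a * b)"
      by (simp add: divide_simps)
    ultimately show ?thesis
      by linarith
  qed
  also have "\<dots> \<le> 4 * (a + b - n)"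
  proof -
    have "2 * (a * b - s) = (a + b - n) * (a + b + n)"
      using n2 by (simp add: algebra_simps power2_eq_square)
    also have "\<dots> \<le> (a + b - n) * (2 * (a + b))"
      using nle by (intro mult_left_mono) auto
    also have "\<dots> = 2 * ((a + b - n) * (a + b))"
      by simp
    finally have "a * b - s \<le> (a + b - n) * (a + b)"
      by (simp only: mult_le_cancel_left_pos zero_less_numeral)
    then have "4 * (a * b - s) \<le> 4 * (a + b - n) * (a + b)"
      by (simp only: mult.assoc mult_le_cancel_left_pos zero_less_numeral)
    then show ?thesis
      using a(1) b(1) by (subst pos_divide_le_eq) auto
  qed
  finally show ?thesis
    by (simp add: a_def b_def n_def)
qed

context prob_space
begin

text \<open>Integrating the pointwise inequality 2 e |x| \<le> x^2 + e^2 gives this case of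
  Cauchy-Schwarz.\<close>

lemma integral_abs_le_sqrt:
  fixes X :: "'a \<Rightarrow> real"
  assumes "integrable M X" and "integrable M (\<lambda>\<omega>. (X \<omega>)\<^sup>2)" and "expectation (\<lambda>\<omega>. (X \<omega>)\<^sup>2) \<le> e\<^sup>2" and "0 < e"
  shows "expectation (\<lambda>\<omega>. \<bar>X \<omega>\<bar>) \<le> e"
proof -
  have "\<bar>x\<bar> \<le> (x\<^sup>2 / e + e) / 2" for x :: real
  proof -
    have "0 \<le> (\<bar>x\<bar> - e)\<^sup>2"
      by simp
    then have "2 * e * \<bar>x\<bar> \<le> x\<^sup>2 + e\<^sup>2"
      unfolding power2_diff by (simp add: mult_ac)
    then show ?thesis
      using \<open>0 < e\<close> by (simp add: field_simps power2_eq_square)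
  qed
  then have "expectation (\<lambda>\<omega>. \<bar>X \<omega>\<bar>) \<le> expectation (\<lambda>\<omega>. ((X \<omega>)\<^sup>2 / e + e) / 2)"
    using assms by (intro integral_mono) auto
  also have "\<dots> = (expectation (\<lambda>\<omega>. (X \<omega>)\<^sup>2) / e + e) / 2"
    using assms by (simp add: prob_space)
  also have "\<dots> \<le> e"
    using assms by (simp add: field_simps power2_eq_square)
  finally show ?thesis .
qed

text \<open>Nearly minimise the strictly convex functional \<open>h \<mapsto> E \<bar>(1, h)\<bar>\<close> on each \<open>C n\<close>: since midpoints stay
  in \<open>C n\<close>, the unit vectors \<open>(1, h) / \<bar>(1, h)\<bar>\<close> form a Cauchy sequence in \<open>L\<^sup>1\<close>. Their first coordinate
  does not tend to \<open>0\<close>, by Fatou's lemma.\<close>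

lemma midpoint_closed_AE_convergent:
  fixes C :: "nat \<Rightarrow> ('a \<Rightarrow> 'e::euclidean_space) set"
  assumes nonempty: "\<And>n. C n \<noteq> {}"
    and decreasing: "\<And>n. C (Suc n) \<subseteq> C n"
    and midpoint: "\<And>n h k. h \<in> C n \<Longrightarrow> k \<in> C n \<Longrightarrow> (\<lambda>\<omega>. (1/2) *\<^sub>R (h \<omega> + k \<omega>)) \<in> C n"
    and int: "\<And>h. h \<in> C 0 \<Longrightarrow> integrable M h"
    and bound: "\<And>h. h \<in> C 0 \<Longrightarrow> expectation (\<lambda>\<omega>. norm (h \<omega>)) \<le> K"
  obtains h where "\<And>n. h n \<in> C n" and "AE \<omega> in M. convergent (\<lambda>n. h n \<omega>)"
proof -
  have anti: "C m \<subseteq> C n" if "n \<le> m" for m n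
    using lift_Suc_antimono_le[of C n m] decreasing that by blast
  \<comment> \<open>The added coordinate 1 keeps the norm at least 1, and it allows \<open>h\<close>
    to be recovered from the direction of \<open>P h\<close> as the quotient of the two
    coordinates.\<close>
  define P :: "('a \<Rightarrow> 'e) \<Rightarrow> 'a \<Rightarrow> real \<times> 'e" where "P h \<omega> = (1, h \<omega>)" for h \<omega>
  have P1: "1 \<le> norm (P h \<omega>)" for h \<omega>
    using norm_fst_le[of "1::real" "h \<omega>"] by (simp add: P_def)
  have P2: "norm (P h \<omega>) \<le> 1 + norm (h \<omega>)" for h \<omega>
    using norm_Pair_le[of "1::real" "h \<omega>"] by (simp add: P_def)
  have intC: "integrable M h" if "h \<in> C n" for h n
    using int anti[of 0 n] that by auto
  have Pmeas: "P h \<in> borel_measurable M" if "h \<in> C n" for h n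
    unfolding P_def using intC[OF that] by (auto intro!: borel_measurable_Pair)
  have Pint: "integrable M (\<lambda>\<omega>. norm (P h \<omega>))" if "h \<in> C n" for h n
    by (rule Bochner_Integration.integrable_bound[of _ "\<lambda>\<omega>. 1 + norm (h \<omega>)"])
      (use intC[OF that] Pmeas[OF that] P2 in \<open>auto simp: abs_le_iff\<close>)
  define \<Psi> where "\<Psi> h = expectation (\<lambda>\<omega>. norm (P h \<omega>))" for h
  have J_ge: "1 \<le> \<Psi> h" if "h \<in> C n" for h n
    unfolding \<Psi>_def using integral_mono[OF _ Pint[OF that], of "\<lambda>_. 1"] P1 by (simp add: prob_space)
  have J_le: "\<Psi> h \<le> 1 + K" if "h \<in> C n" for h n
  proof -
    have "\<Psi> h \<le> expectation (\<lambda>\<omega>. 1 + norm (h \<omega>))"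
      unfolding \<Psi>_def using intC[OF that] P2 by (intro integral_mono Pint[OF that]) auto
    also have "\<dots> = 1 + expectation (\<lambda>\<omega>. norm (h \<omega>))"
      using intC[OF that] by (simp add: prob_space)
    also have "\<dots> \<le> 1 + K"
      using bound anti[of 0 n] that by auto
    finally show ?thesis .
  qed
  \<comment> \<open>As the sets shrink, these infima increase, and the L^1 bound keeps them below
    \<open>1 + K\<close>. A midpoint of near minimisers in \<open>C n\<close> has value at least
    \<open>I n\<close>, so once the infima have nearly converged there is little room left for
    strict convexity.\<close>
  define I where "I n = Inf (\<Psi> ` C n)" for n
  have bdd: "bdd_below (\<Psi> ` C n)" for n
    using J_ge by (intro bdd_belowI[of _ 1]) auto
  have I_le: "I n \<le> \<Psi> h" if "h \<in> C n" for h n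
    unfolding I_def using that bdd by (auto intro: cInf_lower)
  have "incseq I"
    unfolding I_def using decreasing nonempty bdd by (intro incseq_SucI cInf_superset_mono) auto
  moreover have "I n \<le> 1 + K" for n
    using I_le[of _ n] J_le[of _ n] nonempty[of n] by (meson all_not_in_conv order_trans)
  ultimately obtain L where L: "I \<longlonglongrightarrow> L" "\<And>n. I n \<le> L"
    using incseq_convergent[of I "1 + K"] by metis
  have "\<exists>h\<in>C n. \<Psi> h < I n + 1 / (Suc n)" for n
    using cInf_lessD[of "\<Psi> ` C n" "I n + 1 / (Suc n)"] nonempty[of n] by (auto simp: I_def)
  then obtain k where k: "\<And>n. k n \<in> C n" "\<And>n. \<Psi> (k n) < I n + 1 / (Suc n)"
    by metis
  define S where "S n \<omega> = P (k n) \<omega> /\<^sub>R norm (P (k n) \<omega>)" for n \<omega>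
  have normS: "norm (S n \<omega>) = 1" for n \<omega>
    using P1[of "k n" \<omega>] by (cases "P (k n) \<omega> = 0") (simp_all add: S_def)
  have Smeas: "S n \<in> borel_measurable M" for n
    unfolding S_def using Pmeas[OF k(1)] by simp
  have Sint: "integrable M (S n)" for n
    by (rule integrable_const_bound[of _ 1]) (use Smeas normS in auto)
  \<comment> \<open>Each of the two near minimisers has value at most \<open>L + 1 / (Suc n)\<close>
    and their midpoint at least \<open>I n\<close>; the factor 8 is the 4 of the norm inequality
    times 2 for the two functions.\<close>
  define \<delta> where "\<delta> n = 8 * (L - I n + 1 / (Suc n))" for n
  have "\<delta> \<longlonglongrightarrow> 8 * (L - L + 0)"
    unfolding \<delta>_def by (intro tendsto_intros L(1) LIMSEQ_Suc[OF lim_1_over_n])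
  then have \<delta>0: "\<delta> \<longlonglongrightarrow> 0"
    by simp
  have dist2: "expectation (\<lambda>\<omega>. (norm (S i \<omega> - S j \<omega>))\<^sup>2) \<le> \<delta> n" if "n \<le> i" "n \<le> j" for n i j
  proof -
    have ki: "k i \<in> C n" "k j \<in> C n"
      using k(1) anti that by blast+
    define m where "m = (\<lambda>\<omega>. (1/2) *\<^sub>R (k i \<omega> + k j \<omega>))"
    have m: "m \<in> C n"
      unfolding m_def by (rule midpoint[OF ki])
    have "P (k i) \<omega> + P (k j) \<omega> = 2 *\<^sub>R P m \<omega>" for \<omega>
      by (simp add: P_def m_def)
    then have pw: "(norm (S i \<omega> - S j \<omega>))\<^sup>2
        \<le> 4 * (norm (P (k i) \<omega>) + norm (P (k j) \<omega>) - 2 * norm (P m \<omega>))" for \<omega>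
      unfolding S_def using normalized_diff_le_norm_add_deficit[OF P1 P1, of "k i" \<omega> "k j" \<omega>] by simp
    have "expectation (\<lambda>\<omega>. (norm (S i \<omega> - S j \<omega>))\<^sup>2)
        \<le> expectation (\<lambda>\<omega>. 4 * (norm (P (k i) \<omega>) + norm (P (k j) \<omega>) - 2 * norm (P m \<omega>)))"
      using order_trans[OF zero_le_power2 pw] Pint[OF ki(1)] Pint[OF ki(2)] Pint[OF m]
      by (intro integral_mono_AE' AE_I2 pw) auto
    also have "\<dots> = 4 * (\<Psi> (k i) + \<Psi> (k j) - 2 * \<Psi> m)"
      using Pint[OF ki(1)] Pint[OF ki(2)] Pint[OF m] by (simp add: \<Psi>_def)
    also have "\<dots> \<le> \<delta> n"
    proof -
      have "1 / real (Suc i) \<le> 1 / real (Suc n)" "1 / real (Suc j) \<le> 1 / real (Suc n)"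
        using that by (auto intro!: divide_left_mono)
      then have "\<Psi> (k i) \<le> L + 1 / (Suc n)" "\<Psi> (k j) \<le> L + 1 / (Suc n)"
        using k(2)[of i] k(2)[of j] L(2)[of i] L(2)[of j] by linarith+
      then show ?thesis
        unfolding \<delta>_def using I_le[OF m] by argo
    qed
    finally show ?thesis .
  qed
  have cauchy: "\<exists>N. \<forall>i\<ge>N. \<forall>j\<ge>N. (LINT x|M. norm (S i x - S j x)) < e" if "e > 0" for e
  proof -
    have "\<forall>\<^sub>F n in sequentially. \<delta> n < (e/2)\<^sup>2"
      using order_tendstoD(2)[OF \<delta>0] that by simp
    then obtain n where n: "\<delta> n < (e/2)\<^sup>2"
      by (auto simp: eventually_sequentially)
    have bnd: "norm (S i \<omega> - S j \<omega>) \<le> 2" for i j \<omega>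
      using norm_triangle_ineq4[of "S i \<omega>" "S j \<omega>"] normS by simp
    have "expectation (\<lambda>\<omega>. \<bar>norm (S i \<omega> - S j \<omega>)\<bar>) \<le> e / 2" if "n \<le> i" "n \<le> j" for i j
    proof (rule integral_abs_le_sqrt)
      show "integrable M (\<lambda>\<omega>. (norm (S i \<omega> - S j \<omega>))\<^sup>2)"
        by (rule integrable_const_bound[of _ "2\<^sup>2"])
          (use power_mono[OF bnd norm_ge_zero, of _ _ _ 2] Smeas in auto)
    qed (use dist2[OF that] n \<open>e > 0\<close> Sint in auto)
    then have "(LINT x|M. norm (S i x - S j x)) < e" if "n \<le> i" "n \<le> j" for i j
      using \<open>e > 0\<close> that by (fastforce dest: le_less_trans[of _ "e / 2" e])
    then show ?thesis
      by blast
  qed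
  obtain r where r: "strict_mono r" "AE \<omega> in M. Cauchy (\<lambda>i. S (r i) \<omega>)"
    by (rule cauchy_L1_AE_cauchy_subseq[of M S, OF Sint cauchy])
  have "(\<integral>\<^sup>+\<omega>. liminf (\<lambda>n. ennreal (norm (P (k (r n)) \<omega>))) \<partial>M)
      \<le> liminf (\<lambda>n. \<integral>\<^sup>+\<omega>. ennreal (norm (P (k (r n)) \<omega>)) \<partial>M)"
    using Pmeas[OF k(1)] by (intro nn_integral_liminf) auto
  also have "\<dots> \<le> ennreal (1 + K)"
  proof -
    have "(\<integral>\<^sup>+\<omega>. ennreal (norm (P (k (r n)) \<omega>)) \<partial>M) \<le> ennreal (1 + K)" for n
      using J_le[OF k(1), of "r n"] Pint[OF k(1), of "r n"]
      by (subst nn_integral_eq_integral) (auto simp: \<Psi>_def intro!: ennreal_leI)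
    then show ?thesis
      by (intro Liminf_le always_eventually) auto
  qed
  finally have "AE \<omega> in M. liminf (\<lambda>n. ennreal (norm (P (k (r n)) \<omega>))) \<noteq> \<infinity>"
    using Pmeas[OF k(1)] by (intro nn_integral_PInf_AE) (auto simp: top_unique)
  with r(2) have "AE \<omega> in M. convergent (\<lambda>n. k (r n) \<omega>)"
  proof eventually_elim
    case (elim \<omega>)
    then obtain s where s: "(\<lambda>i. S (r i) \<omega>) \<longlonglongrightarrow> s"
      using Cauchy_convergent_iff convergent_def by blast
    have fstS: "fst (S n \<omega>) = inverse (norm (P (k n) \<omega>))" and
      sndS: "snd (S n \<omega>) = k n \<omega> /\<^sub>R norm (P (k n) \<omega>)" for n
      by (simp_all add: S_def P_def)
    have f: "(\<lambda>i. inverse (norm (P (k (r i)) \<omega>))) \<longlonglongrightarrow> fst s"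
      using tendsto_fst[OF s] by (simp add: fstS)
    have "fst s \<noteq> 0"
    proof
      assume "fst s = 0"
      then have "filterlim (\<lambda>i. inverse (inverse (norm (P (k (r i)) \<omega>)))) at_top sequentially"
        using f P1 by (intro filterlim_inverse_at_top) (auto simp: P_def zero_prod_def)
      then have "filterlim (\<lambda>i. norm (P (k (r i)) \<omega>)) at_top sequentially"
        by simp
      then have "((\<lambda>i. ennreal (norm (P (k (r i)) \<omega>))) \<longlongrightarrow> \<infinity>) sequentially"
        by (simp add: ennreal_tendsto_top_eq_at_top infinity_ennreal_def)
      then have "liminf (\<lambda>n. ennreal (norm (P (k (r n)) \<omega>))) = \<infinity>"
        by (rule lim_imp_Liminf[rotated]) simp
      then show False
        using elim by simp
    qed
    then have "(\<lambda>i. snd (S (r i) \<omega>) /\<^sub>R fst (S (r i) \<omega>)) \<longlonglongrightarrow> snd s /\<^sub>R fst s"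
      by (intro tendsto_intros s) auto
    moreover have "snd (S n \<omega>) /\<^sub>R fst (S n \<omega>) = k n \<omega>" for n
    proof -
      have "norm (P (k n) \<omega>) \<noteq> 0"
        using P1[of "k n" \<omega>] by linarith
      then show ?thesis
        unfolding fstS sndS by (simp add: field_simps)
    qed
    ultimately show ?case
      by (auto simp: convergent_def)
  qed
  \<comment> \<open>Passing to a subsequence is harmless since \<open>r n \<ge> n\<close> and the
    sets decrease.\<close>
  moreover have "k (r n) \<in> C n" for n
    using k(1)[of "r n"] anti[of n "r n"] seq_suble[OF r(1)] by auto
  ultimately show ?thesis
    by (intro that[of "\<lambda>n. k (r n)"]) auto
qed

text \<open>The bounds may vary with \<open>n\<close>: a constant bound gives integrability of the
  limit multipliers, and bounds tending to 0 show that a limit vanishes.\<close>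

lemma Fatou_norm:
  fixes f :: "nat \<Rightarrow> 'a \<Rightarrow> 'v::euclidean_space"
  assumes f: "\<And>n. integrable M (f n)" and le: "\<And>n. expectation (\<lambda>\<omega>. norm (f n \<omega>)) \<le> K n" and K: "K \<longlonglongrightarrow> L"
    and lim: "AE \<omega> in M. (\<lambda>n. f n \<omega>) \<longlonglongrightarrow> h \<omega>" and h: "h \<in> borel_measurable M"
  shows "integrable M h" and "expectation (\<lambda>\<omega>. norm (h \<omega>)) \<le> L"
proof -
  have "0 \<le> K n" for n
    by (rule order_trans[OF _ le]) simp
  then have L: "0 \<le> L"
    by (intro LIMSEQ_le_const[OF K]) auto
  have "(\<integral>\<^sup>+\<omega>. ennreal (norm (h \<omega>)) \<partial>M) = (\<integral>\<^sup>+\<omega>. liminf (\<lambda>n. ennreal (norm (f n \<omega>))) \<partial>M)"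
  proof (rule nn_integral_cong_AE)
    show "AE \<omega> in M. ennreal (norm (h \<omega>)) = liminf (\<lambda>n. ennreal (norm (f n \<omega>)))"
      using lim by eventually_elim (intro lim_imp_Liminf[symmetric] tendsto_intros, auto)
  qed
  also have "\<dots> \<le> liminf (\<lambda>n. \<integral>\<^sup>+\<omega>. ennreal (norm (f n \<omega>)) \<partial>M)"
    using f by (intro nn_integral_liminf) auto
  also have "\<dots> \<le> liminf (\<lambda>n. ennreal (K n))"
  proof (rule Liminf_mono[OF always_eventually], rule allI)
    fix n show "(\<integral>\<^sup>+\<omega>. ennreal (norm (f n \<omega>)) \<partial>M) \<le> ennreal (K n)"
      using f[of n] le[of n] by (subst nn_integral_eq_integral) (auto intro: ennreal_leI)
  qed
  also have "\<dots> = ennreal L"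
    by (intro lim_imp_Liminf tendsto_ennrealI K) simp
  finally have le: "(\<integral>\<^sup>+\<omega>. ennreal (norm (h \<omega>)) \<partial>M) \<le> ennreal L" .
  then show hi: "integrable M h"
    by (intro integrableI_bounded h) (auto intro: le_less_trans)
  show "expectation (\<lambda>\<omega>. norm (h \<omega>)) \<le> L"
    using le L nn_integral_eq_integral[OF integrable_norm[OF hi]] by simp
qed

end

subsection \<open>Vector-valued conditional expectation\<close>

context prob_space
begin

lemma sigma_finite_subalgebraI: "subalgebra M H \<Longrightarrow> sigma_finite_subalgebra M H"
  by (intro finite_measure_subalgebra_is_sigma_finite finite_measure_subalgebra.intro
      finite_measure_axioms finite_measure_subalgebra_axioms.intro)

lemma integrable_inner_AE_bounded:
  fixes h \<xi> :: "'a \<Rightarrow> 'v::euclidean_space"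
  assumes "integrable M \<xi>" and "h \<in> borel_measurable M" and "AE \<omega> in M. norm (h \<omega>) \<le> K"
  shows "integrable M (\<lambda>\<omega>. h \<omega> \<bullet> \<xi> \<omega>)" and "integrable M (\<lambda>\<omega>. \<xi> \<omega> \<bullet> h \<omega>)"
proof -
  show "integrable M (\<lambda>\<omega>. h \<omega> \<bullet> \<xi> \<omega>)"
  proof (rule Bochner_Integration.integrable_bound[of _ "\<lambda>\<omega>. K *\<^sub>R norm (\<xi> \<omega>)"])
    show "AE \<omega> in M. norm (h \<omega> \<bullet> \<xi> \<omega>) \<le> norm (K *\<^sub>R norm (\<xi> \<omega>))"
      using assms(3)
    proof eventually_elim
      case (elim \<omega>)
      have "norm (h \<omega> \<bullet> \<xi> \<omega>) \<le> norm (h \<omega>) * norm (\<xi> \<omega>)"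
        using Cauchy_Schwarz_ineq2 by simp
      also have "\<dots> \<le> K * norm (\<xi> \<omega>)"
        using elim by (intro mult_right_mono) auto
      finally show ?case
        by simp
    qed
  qed (use assms in auto)
  then show "integrable M (\<lambda>\<omega>. \<xi> \<omega> \<bullet> h \<omega>)"
    by (simp add: inner_commute)
qed

context
  fixes H :: "'a measure"
  assumes subalg: "subalgebra M H"
begin

interpretation H: sigma_finite_subalgebra M H
  by (rule sigma_finite_subalgebraI[OF subalg])

lemma measurable_subalgebra: "h \<in> borel_measurable H \<Longrightarrow> h \<in> borel_measurable M"
  by (rule measurable_from_subalg[OF subalg])

lemma vec_cond_exp_measurable: "vec_cond_exp M H \<xi> \<in> borel_measurable H"
  unfolding vec_cond_exp_def by simp

lemma vec_cond_exp_inner_Basis: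
  "b \<in> Basis \<Longrightarrow> vec_cond_exp M H \<xi> \<omega> \<bullet> b = real_cond_exp M H (\<lambda>\<omega>. \<xi> \<omega> \<bullet> b) \<omega>"
  by (simp add: vec_cond_exp_def)

lemma integrable_vec_cond_exp: "integrable M \<xi> \<Longrightarrow> integrable M (vec_cond_exp M H \<xi>)"
  unfolding vec_cond_exp_def
  by (intro Bochner_Integration.integrable_sum integrable_scaleR_left H.real_cond_exp_int) auto

text \<open>Each coordinate is dominated by the conditional expectation of the norm; summing the
  coordinates costs the factor \<open>DIM('v)\<close>.\<close>

lemma norm_vec_cond_exp_le:
  fixes \<xi> :: "'a \<Rightarrow> 'v::euclidean_space"
  assumes \<xi>: "integrable M \<xi>"
  shows "AE \<omega> in M. norm (vec_cond_exp M H \<xi> \<omega>)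
    \<le> real DIM('v) * real_cond_exp M H (\<lambda>\<omega>. norm (\<xi> \<omega>)) \<omega>"
proof -
  have "AE \<omega> in M. \<bar>vec_cond_exp M H \<xi> \<omega> \<bullet> b\<bar> \<le> real_cond_exp M H (\<lambda>\<omega>. norm (\<xi> \<omega>)) \<omega>"
    if b: "b \<in> Basis" for b
  proof -
    have i: "integrable M (\<lambda>\<omega>. \<xi> \<omega> \<bullet> b)" "integrable M (\<lambda>\<omega>. norm (\<xi> \<omega>))"
      using \<xi> by auto
    have nb: "\<bar>v \<bullet> b\<bar> \<le> norm v" for v :: 'v
      using Basis_le_norm[OF b] .
    have "AE \<omega> in M. real_cond_exp M H (\<lambda>\<omega>. \<xi> \<omega> \<bullet> b) \<omega> \<le> real_cond_exp M H (\<lambda>\<omega>. norm (\<xi> \<omega>)) \<omega>"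
      using nb by (intro H.real_cond_exp_mono i AE_I2) (simp add: abs_le_iff)
    moreover have "AE \<omega> in M. real_cond_exp M H (\<lambda>\<omega>. -1 * (\<xi> \<omega> \<bullet> b)) \<omega>
        \<le> real_cond_exp M H (\<lambda>\<omega>. norm (\<xi> \<omega>)) \<omega>"
      using nb i by (intro H.real_cond_exp_mono AE_I2) (auto simp: abs_le_iff)
    moreover have "AE \<omega> in M. real_cond_exp M H (\<lambda>\<omega>. -1 * (\<xi> \<omega> \<bullet> b)) \<omega>
        = -1 * real_cond_exp M H (\<lambda>\<omega>. \<xi> \<omega> \<bullet> b) \<omega>"
      using i by (intro H.real_cond_exp_cmult)
    ultimately show ?thesis
      by eventually_elim (auto simp: vec_cond_exp_inner_Basis b abs_le_iff)
  qed
  then have "AE \<omega> in M. \<forall>b\<in>Basis. \<bar>vec_cond_exp M H \<xi> \<omega> \<bullet> b\<bar> \<le> real_cond_exp M H (\<lambda>\<omega>. norm (\<xi> \<omega>)) \<omega>"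
    by (intro AE_ball_countable[THEN iffD2]) (auto intro: countable_finite)
  then show ?thesis
  proof eventually_elim
    case (elim \<omega>)
    have "norm (vec_cond_exp M H \<xi> \<omega>) \<le> (\<Sum>b\<in>Basis. \<bar>vec_cond_exp M H \<xi> \<omega> \<bullet> b\<bar>)"
      by (rule norm_le_l1)
    also have "\<dots> \<le> (\<Sum>b\<in>(Basis :: 'v set). real_cond_exp M H (\<lambda>\<omega>. norm (\<xi> \<omega>)) \<omega>)"
      using elim by (intro sum_mono) auto
    finally show ?case
      by simp
  qed
qed

lemma norm_vec_cond_exp_bounded:
  fixes \<xi> :: "'a \<Rightarrow> 'v::euclidean_space"
  assumes "\<xi> \<in> borel_measurable M" and "AE \<omega> in M. norm (\<xi> \<omega>) \<le> K"
  shows "AE \<omega> in M. norm (vec_cond_exp M H \<xi> \<omega>) \<le> real DIM('v) * K"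
proof -
  have i: "integrable M \<xi>"
    by (rule integrable_const_bound[OF assms(2,1)])
  have "AE \<omega> in M. real_cond_exp M H (\<lambda>\<omega>. norm (\<xi> \<omega>)) \<omega> \<le> K"
    using i assms by (intro H.real_cond_exp_le_c) auto
  with norm_vec_cond_exp_le[OF i] show ?thesis
    by eventually_elim (meson mult_left_mono of_nat_0_le_iff order_trans)
qed

lemma expectation_norm_vec_cond_exp_le:
  fixes \<xi> :: "'a \<Rightarrow> 'v::euclidean_space"
  assumes "integrable M \<xi>"
  shows "expectation (\<lambda>\<omega>. norm (vec_cond_exp M H \<xi> \<omega>)) \<le> real DIM('v) * expectation (\<lambda>\<omega>. norm (\<xi> \<omega>))"
proof -
  have i: "integrable M (\<lambda>\<omega>. norm (\<xi> \<omega>))"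
    using assms by auto
  have "expectation (\<lambda>\<omega>. norm (vec_cond_exp M H \<xi> \<omega>))
      \<le> expectation (\<lambda>\<omega>. real DIM('v) * real_cond_exp M H (\<lambda>\<omega>. norm (\<xi> \<omega>)) \<omega>)"
    using integrable_vec_cond_exp[OF assms] H.real_cond_exp_int(1)[OF i]
    by (intro integral_mono_AE norm_vec_cond_exp_le assms) auto
  then show ?thesis
    using H.real_cond_exp_int(2)[OF i] by simp
qed

lemma vec_cond_exp_lin:
  fixes \<xi> \<eta> :: "'a \<Rightarrow> 'v::euclidean_space"
  assumes "integrable M \<xi>" and "integrable M \<eta>"
  shows "AE \<omega> in M. vec_cond_exp M H (\<lambda>\<omega>. a *\<^sub>R \<xi> \<omega> + b *\<^sub>R \<eta> \<omega>) \<omega>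
    = a *\<^sub>R vec_cond_exp M H \<xi> \<omega> + b *\<^sub>R vec_cond_exp M H \<eta> \<omega>"
proof -
  have "AE \<omega> in M. real_cond_exp M H (\<lambda>\<omega>. a * (\<xi> \<omega> \<bullet> e) + b * (\<eta> \<omega> \<bullet> e)) \<omega>
     = a * real_cond_exp M H (\<lambda>\<omega>. \<xi> \<omega> \<bullet> e) \<omega> + b * real_cond_exp M H (\<lambda>\<omega>. \<eta> \<omega> \<bullet> e) \<omega>" for e
  proof -
    have i: "integrable M (\<lambda>\<omega>. \<xi> \<omega> \<bullet> e)" "integrable M (\<lambda>\<omega>. \<eta> \<omega> \<bullet> e)"
      using assms by auto
    show ?thesis
      using H.real_cond_exp_cmult[OF i(1), of a] H.real_cond_exp_cmult[OF i(2), of b]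
        H.real_cond_exp_add[OF integrable_mult_right[OF i(1)] integrable_mult_right[OF i(2)], of a b]
      by eventually_elim simp
  qed
  then have "AE \<omega> in M. \<forall>e\<in>(Basis :: 'v set). real_cond_exp M H (\<lambda>\<omega>. a * (\<xi> \<omega> \<bullet> e) + b * (\<eta> \<omega> \<bullet> e)) \<omega>
     = a * real_cond_exp M H (\<lambda>\<omega>. \<xi> \<omega> \<bullet> e) \<omega> + b * real_cond_exp M H (\<lambda>\<omega>. \<eta> \<omega> \<bullet> e) \<omega>"
    by (intro AE_ball_countable[THEN iffD2]) (auto intro: countable_finite)
  then show ?thesis
    by eventually_elim (rule euclidean_eqI, simp add: vec_cond_exp_inner_Basis inner_add_left)
qed

lemma vec_cond_exp_measurable_eq:
  fixes \<xi> :: "'a \<Rightarrow> 'v::euclidean_space"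
  assumes "integrable M \<xi>" and "\<xi> \<in> borel_measurable H"
  shows "AE \<omega> in M. vec_cond_exp M H \<xi> \<omega> = \<xi> \<omega>"
proof -
  have "AE \<omega> in M. \<forall>e\<in>(Basis :: 'v set). real_cond_exp M H (\<lambda>\<omega>. \<xi> \<omega> \<bullet> e) \<omega> = \<xi> \<omega> \<bullet> e"
    using assms by (intro AE_ball_countable[THEN iffD2] ballI H.real_cond_exp_F_meas)
      (auto intro: countable_finite)
  then show ?thesis
    by eventually_elim (rule euclidean_eqI, simp add: vec_cond_exp_inner_Basis)
qed

text \<open>A factor known under \<open>H\<close> may be taken out of the conditional expectation.
  The inner product splits over \<open>Basis\<close>, which reduces this to the scalar case.\<close>

lemma vec_cond_exp_inner:
  fixes h \<xi> :: "'a \<Rightarrow> 'v::euclidean_space"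
  assumes \<xi>: "integrable M \<xi>" and h: "h \<in> borel_measurable H" and K: "AE \<omega> in M. norm (h \<omega>) \<le> K"
  shows "expectation (\<lambda>\<omega>. h \<omega> \<bullet> vec_cond_exp M H \<xi> \<omega>) = expectation (\<lambda>\<omega>. h \<omega> \<bullet> \<xi> \<omega>)"
proof -
  have hM: "h \<in> borel_measurable M"
    by (rule measurable_subalgebra[OF h])
  have i: "integrable M (\<lambda>\<omega>. (h \<omega> \<bullet> b) * (\<xi> \<omega> \<bullet> b))" if "b \<in> Basis" for b
  proof -
    have "AE \<omega> in M. norm ((h \<omega> \<bullet> b) *\<^sub>R b) \<le> K"
      using K by eventually_elim (use Basis_le_norm[OF that] that in \<open>auto intro: order_trans\<close>)
    then show ?thesis
      using integrable_inner_AE_bounded(1)[OF \<xi>, of "\<lambda>\<omega>. (h \<omega> \<bullet> b) *\<^sub>R b" K] hM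
      by (simp add: inner_commute)
  qed
  have hb: "(\<lambda>\<omega>. h \<omega> \<bullet> b) \<in> borel_measurable H" for b
    using h by simp
  have xb: "(\<lambda>\<omega>. \<xi> \<omega> \<bullet> b) \<in> borel_measurable M" for b
    using \<xi> by simp
  have "expectation (\<lambda>\<omega>. h \<omega> \<bullet> vec_cond_exp M H \<xi> \<omega>)
      = expectation (\<lambda>\<omega>. \<Sum>b\<in>Basis. (h \<omega> \<bullet> b) * real_cond_exp M H (\<lambda>\<omega>. \<xi> \<omega> \<bullet> b) \<omega>)"
    by (intro Bochner_Integration.integral_cong refl, subst euclidean_inner)
      (simp add: vec_cond_exp_inner_Basis)
  also have "\<dots> = (\<Sum>b\<in>Basis. expectation (\<lambda>\<omega>. (h \<omega> \<bullet> b) * (\<xi> \<omega> \<bullet> b)))"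
    using H.real_cond_exp_intg[OF i hb xb] by (subst Bochner_Integration.integral_sum) auto
  also have "\<dots> = expectation (\<lambda>\<omega>. \<Sum>b\<in>Basis. (h \<omega> \<bullet> b) * (\<xi> \<omega> \<bullet> b))"
    using i by simp
  also have "\<dots> = expectation (\<lambda>\<omega>. h \<omega> \<bullet> \<xi> \<omega>)"
    by (intro Bochner_Integration.integral_cong refl euclidean_inner[symmetric])
  finally show ?thesis .
qed

end

text \<open>The weak form of a vanishing conditional expectation;
  \<open>orthogonal_to_vec_cond_exp\<close> leads back to the usual one. Tests with bounded
  functions make sense for integrable \<open>\<xi>\<close>, are stable under linear combinations,
  and apply directly to the components of adapted programs, which are bounded.\<close>

definition orthogonal_to :: "'a measure \<Rightarrow> ('a \<Rightarrow> 'v::euclidean_space) \<Rightarrow> bool" where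
  "orthogonal_to H \<xi> \<longleftrightarrow> (\<forall>h\<in>borel_measurable H. \<forall>K. (AE \<omega> in M. norm (h \<omega>) \<le> K) \<longrightarrow>
     expectation (\<lambda>\<omega>. \<xi> \<omega> \<bullet> h \<omega>) = 0)"

lemma orthogonal_toD:
  "orthogonal_to H \<xi> \<Longrightarrow> h \<in> borel_measurable H \<Longrightarrow> AE \<omega> in M. norm (h \<omega>) \<le> K \<Longrightarrow>
    expectation (\<lambda>\<omega>. \<xi> \<omega> \<bullet> h \<omega>) = 0"
  unfolding orthogonal_to_def by blast

lemma orthogonal_to_lin:
  fixes \<xi> \<eta> :: "'a \<Rightarrow> 'v::euclidean_space"
  assumes H: "subalgebra M H" and "integrable M \<xi>" "integrable M \<eta>"
    and "orthogonal_to H \<xi>" "orthogonal_to H \<eta>"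
  shows "orthogonal_to H (\<lambda>\<omega>. a *\<^sub>R \<xi> \<omega> + b *\<^sub>R \<eta> \<omega>)"
  unfolding orthogonal_to_def
proof (intro ballI allI impI)
  fix h :: "'a \<Rightarrow> 'v" and K assume h: "h \<in> borel_measurable H" "AE \<omega> in M. norm (h \<omega>) \<le> K"
  have hM: "h \<in> borel_measurable M"
    by (rule measurable_from_subalg[OF H h(1)])
  have "expectation (\<lambda>\<omega>. (a *\<^sub>R \<xi> \<omega> + b *\<^sub>R \<eta> \<omega>) \<bullet> h \<omega>)
      = a * expectation (\<lambda>\<omega>. \<xi> \<omega> \<bullet> h \<omega>) + b * expectation (\<lambda>\<omega>. \<eta> \<omega> \<bullet> h \<omega>)"
    using integrable_inner_AE_bounded(2)[OF assms(2) hM h(2)]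
      integrable_inner_AE_bounded(2)[OF assms(3) hM h(2)]
    by (simp add: inner_add_left)
  then show "expectation (\<lambda>\<omega>. (a *\<^sub>R \<xi> \<omega> + b *\<^sub>R \<eta> \<omega>) \<bullet> h \<omega>) = 0"
    using orthogonal_toD[OF assms(4) h] orthogonal_toD[OF assms(5) h] by simp
qed

lemma orthogonal_to_diff_vec_cond_exp:
  fixes \<xi> :: "'a \<Rightarrow> 'v::euclidean_space"
  assumes H: "subalgebra M H" and \<xi>: "integrable M \<xi>"
  shows "orthogonal_to H (\<lambda>\<omega>. \<xi> \<omega> - vec_cond_exp M H \<xi> \<omega>)"
  unfolding orthogonal_to_def
proof (intro ballI allI impI)
  fix h :: "'a \<Rightarrow> 'v" and K assume h: "h \<in> borel_measurable H" "AE \<omega> in M. norm (h \<omega>) \<le> K"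
  have hM: "h \<in> borel_measurable M"
    by (rule measurable_from_subalg[OF H h(1)])
  show "expectation (\<lambda>\<omega>. (\<xi> \<omega> - vec_cond_exp M H \<xi> \<omega>) \<bullet> h \<omega>) = 0"
    using integrable_inner_AE_bounded(1)[OF \<xi> hM h(2)]
      integrable_inner_AE_bounded(1)[OF integrable_vec_cond_exp[OF H \<xi>] hM h(2)]
      vec_cond_exp_inner[OF H \<xi> h]
    by (simp add: inner_commute[of _ "h _"] inner_diff_right)
qed

lemma orthogonal_to_vec_cond_exp:
  fixes \<xi> :: "'a \<Rightarrow> 'v::euclidean_space"
  assumes H: "subalgebra M H" and \<xi>: "integrable M \<xi>" and orth: "orthogonal_to H \<xi>"
  shows "AE \<omega> in M. vec_cond_exp M H \<xi> \<omega> = 0"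
proof -
  interpret H: sigma_finite_subalgebra M H
    by (rule sigma_finite_subalgebraI[OF H])
  have "AE \<omega> in M. real_cond_exp M H (\<lambda>\<omega>. \<xi> \<omega> \<bullet> b) \<omega> = 0" if b: "b \<in> Basis" for b
  proof (rule H.real_cond_exp_charact)
    fix A assume A: "A \<in> sets H"
    have "expectation (\<lambda>\<omega>. \<xi> \<omega> \<bullet> (indicat_real A \<omega> *\<^sub>R b)) = 0"
      using A b by (intro orthogonal_toD[OF orth, of _ 1]) (auto simp: indicator_def)
    then show "(\<integral>x\<in>A. (\<xi> x \<bullet> b) \<partial>M) = (\<integral>x\<in>A. 0 \<partial>M)"
      by (simp add: set_lebesgue_integral_def)
  qed (use \<xi> in auto)
  then have "AE \<omega> in M. \<forall>b\<in>(Basis::'v set). real_cond_exp M H (\<lambda>\<omega>. \<xi> \<omega> \<bullet> b) \<omega> = 0"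
    by (intro AE_ball_countable[THEN iffD2]) (auto intro: countable_finite)
  then show ?thesis
    by eventually_elim (simp add: vec_cond_exp_def)
qed

end

section \<open>Projections, dense subsets and squares of negative parts\<close>

lemma (in prob_space) orthogonal_to_retraction:
  fixes \<xi> :: "'a \<Rightarrow> 'v::euclidean_space"
  assumes P: "bounded_linear P" "\<And>v w. P v \<bullet> w = v \<bullet> P w" and orth: "orthogonal_to H \<xi>"
  shows "orthogonal_to H (\<lambda>\<omega>. P (\<xi> \<omega>))"
  unfolding orthogonal_to_def
proof (intro ballI allI impI)
  fix h :: "'a \<Rightarrow> 'v" and K assume h: "h \<in> borel_measurable H" "AE \<omega> in M. norm (h \<omega>) \<le> K"
  obtain L where L: "L > 0" "\<And>v. norm (P v) \<le> norm v * L"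
    using bounded_linear.pos_bounded[OF P(1)] by metis
  have "AE \<omega> in M. norm (P (h \<omega>)) \<le> K * L"
    using h(2) by eventually_elim (use L in \<open>meson mult_right_mono less_imp_le order_trans\<close>)
  moreover have "(\<lambda>\<omega>. P (h \<omega>)) \<in> borel_measurable H"
    using borel_measurable_continuous_onI[OF linear_continuous_on[OF P(1)]] h(1)
    by (rule measurable_compose[rotated])
  ultimately have "expectation (\<lambda>\<omega>. \<xi> \<omega> \<bullet> P (h \<omega>)) = 0"
    by (intro orthogonal_toD[OF orth]) auto
  then show "expectation (\<lambda>\<omega>. P (\<xi> \<omega>) \<bullet> h \<omega>) = 0"
    by (simp add: P(2))
qed

text \<open>\<open>P\<close> is the orthogonal projection, built from an orthonormal basis. Its
  symmetry matters: projecting a multiplier onto \<open>V\<close> changes neither its inner products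
  with points of \<open>V\<close> nor its orthogonality to a subalgebra.\<close>

lemma linear_retraction_exists:
  fixes V :: "'v::euclidean_space set"
  assumes "subspace V"
  obtains P where "bounded_linear P" and "\<And>v. P v \<in> V" and "\<And>v. v \<in> V \<Longrightarrow> P v = v"
    and "\<And>v w. P v \<bullet> w = v \<bullet> P w"
proof -
  obtain B where B: "B \<subseteq> V" "pairwise orthogonal B" "\<And>x. x \<in> B \<Longrightarrow> norm x = 1"
      "independent B" "span B = V"
    using orthonormal_basis_subspace[OF assms] by metis
  have fin: "finite B"
    by (rule independent_imp_finite[OF B(4)])
  define P where "P v = (\<Sum>b\<in>B. (v \<bullet> b) *\<^sub>R b)" for v
  have PV: "P v \<in> V" for v
    unfolding P_def B(5)[symmetric] by (intro span_sum span_scale span_base)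
  have sym: "P v \<bullet> w = v \<bullet> P w" for v w
    by (simp add: P_def inner_sum_left inner_sum_right inner_commute mult.commute)
  have "P v = v" if "v \<in> V" for v
  proof -
    have "P v - v \<in> span B"
      using PV that assms by (simp add: B(5) subspace_diff)
    moreover have "(P v - v) \<bullet> b = 0" if "b \<in> B" for b
    proof -
      have "c \<bullet> b = (if c = b then 1 else 0)" if "c \<in> B" for c
        using B(2,3) that \<open>b \<in> B\<close> by (auto simp: pairwise_def orthogonal_def norm_eq_1)
      then have "(\<Sum>c\<in>B. (v \<bullet> c) * (c \<bullet> b)) = (\<Sum>c\<in>B. if c = b then v \<bullet> c else 0)"
        by (intro sum.cong) auto
      then show ?thesis
        using fin that by (simp add: P_def inner_diff_left inner_sum_left sum.delta)
    qed
    ultimately have "orthogonal (P v - v) (P v - v)"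
      by (metis orthogonal_def orthogonal_to_span)
    then show ?thesis
      by (simp add: orthogonal_def)
  qed
  moreover have "bounded_linear P"
    unfolding P_def by (intro bounded_linear_sum bounded_linear_scaleR_const bounded_linear_inner_left)
  ultimately show ?thesis
    using that PV sym by blast
qed

text \<open>Since \<open>l\<close> is bounded below near \<open>c\<close>, every value of \<open>l\<close> is approached along the segment towards
  \<open>c\<close>, where there is room for points of \<open>D\<close>.\<close>

lemma concave_bounded_by_dense:
  fixes l :: "'e::real_normed_vector \<Rightarrow> real"
  assumes conc: "concave_on S l" and V: "subspace V" "S \<subseteq> V" and D: "V \<subseteq> closure D" "D \<subseteq> V"
    and ball: "0 < \<theta>" "cball c \<theta> \<inter> V \<subseteq> S" "c \<in> V" and low: "\<And>a. a \<in> S \<Longrightarrow> - K \<le> l a"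
    and up: "\<And>d. d \<in> D \<Longrightarrow> d \<in> S \<Longrightarrow> l d \<le> m" and a: "a \<in> S"
  shows "l a \<le> m"
proof -
  have step: "(1 - u) * l a - u * K \<le> m" if u: "0 < u" "u < 1" for u :: real
  proof -
    define e where "e = (1 - u) *\<^sub>R a + u *\<^sub>R c"
    have "e \<in> V"
      unfolding e_def using V a ball(3) by (intro subspace_add subspace_scale) auto
    then obtain d where d: "d \<in> D" "dist d e < u * \<theta>"
      using D(1) ball(1) u by (meson closure_approachable mult_pos_pos subsetD)
    \<comment> \<open>\<open>z\<close> is forced by
      \<open>d = (1 - u) *\<^sub>R a + u *\<^sub>R z\<close>: the error \<open>d - e\<close> is
      magnified by \<open>1 / u\<close>, which is why the tolerance was
      \<open>u * \<theta>\<close>.\<close>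
    define z where "z = c + (d - e) /\<^sub>R u"
    have "z \<in> V"
      unfolding z_def using V(1) ball(3) d(1) D(2) \<open>e \<in> V\<close>
      by (intro subspace_add subspace_scale subspace_diff) auto
    moreover have "dist c z \<le> \<theta>"
    proof -
      have "dist c z = norm (d - e) / u"
        using u by (simp add: z_def dist_norm divide_inverse mult.commute)
      then show ?thesis
        using d(2) u by (simp add: dist_norm divide_le_eq mult.commute)
    qed
    ultimately have z: "z \<in> S"
      using ball(2) by auto
    have deq: "d = (1 - u) *\<^sub>R a + u *\<^sub>R z"
      using u by (simp add: z_def e_def scaleR_add_right)
    have "d \<in> S"
      unfolding deq using concave_on_imp_convex[OF conc] a z u by (intro convexD) auto
    have "(1 - u) * l a + u * l z \<le> l d"
      unfolding deq using concave_onD[OF conc, of u a z] a z u by simp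
    moreover have "u * - K \<le> u * l z"
      using u low[OF z] by (intro mult_left_mono) auto
    ultimately show ?thesis
      using up[OF d(1) \<open>d \<in> S\<close>] by simp
  qed
  have "((\<lambda>u. (1 - u) * l a - u * K) \<longlongrightarrow> (1 - 0) * l a - 0 * K) (at_right 0)"
    by (intro tendsto_intros)
  moreover have "\<forall>\<^sub>F u in at_right (0::real). (1 - u) * l a - u * K \<le> m"
    unfolding eventually_at_right_field using step by (intro exI[of _ 1]) auto
  ultimately show ?thesis
    using tendsto_upperbound by fastforce
qed

lemma countable_dense_subset:
  fixes V :: "'v::euclidean_space set"
  obtains D where "countable D" "D \<subseteq> V" "V \<subseteq> closure D"
  using separable[of V] by metis

text \<open>The square of the negative part is convex and decreasing, so it suffices that
  \<open>s\<close> dominates the convex combination, as happens for concave constraints. The second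
  bound is an expansion at \<open>u = 0\<close>: with \<open>m\<close> the negative part of
  \<open>a\<close>, the slope towards \<open>b\<close> is -2 m (b - a), rewritten by means of m a =
  - m^2.\<close>

lemma neg_part_square_mix:
  fixes a b s u :: real
  assumes "(1 - u) * a + u * b \<le> s" and "0 \<le> u" "u \<le> 1"
  shows "(max 0 (- s))\<^sup>2 \<le> (1 - u) * (max 0 (- a))\<^sup>2 + u * (max 0 (- b))\<^sup>2" (is ?convex)
    and "(max 0 (- s))\<^sup>2 \<le> (max 0 (- a))\<^sup>2 + 2 * u * (- (max 0 (- a) * b) - (max 0 (- a))\<^sup>2) + u\<^sup>2 * (b - a)\<^sup>2"
      (is ?quadratic)
proof -
  define m n where "m = max 0 (- a)" and "n = max 0 (- b)"
  have mn: "0 \<le> m" "0 \<le> n" "- a \<le> m" "- b \<le> n" "m * a = - m\<^sup>2"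
    by (auto simp: m_def n_def max_def power2_eq_square)
  have "max 0 (- s) \<le> (1 - u) * m + u * n"
  proof (rule max.boundedI)
    show "0 \<le> (1 - u) * m + u * n"
      using mn assms by simp
    have "- s \<le> (1 - u) * (- a) + u * (- b)"
      using assms(1) by simp
    also have "\<dots> \<le> (1 - u) * m + u * n"
      using mn assms by (intro add_mono mult_left_mono) auto
    finally show "- s \<le> (1 - u) * m + u * n" .
  qed
  then have "(max 0 (- s))\<^sup>2 \<le> ((1 - u) * m + u * n)\<^sup>2"
    by (intro power_mono) auto
  also have "\<dots> = (1 - u) * m\<^sup>2 + u * n\<^sup>2 - u * (1 - u) * (m - n)\<^sup>2"
    by (simp add: power2_eq_square algebra_simps)
  also have "\<dots> \<le> (1 - u) * m\<^sup>2 + u * n\<^sup>2"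
    using assms by simp
  finally show ?convex
    by (simp add: m_def n_def)
  \<comment> \<open>The absolute value covers the case in which \<open>m - u * (b - a)\<close> is
    negative, where the left side is 0.\<close>
  have "max 0 (- s) \<le> \<bar>m - u * (b - a)\<bar>"
  proof -
    have "- s \<le> - a - u * (b - a)"
      using assms(1) by (simp add: algebra_simps)
    then show ?thesis
      using mn(3) by linarith
  qed
  then have "(max 0 (- s))\<^sup>2 \<le> \<bar>m - u * (b - a)\<bar>\<^sup>2"
    by (intro power_mono) auto
  also have "\<dots> = (m - u * (b - a))\<^sup>2"
    by simp
  also have "\<dots> = m\<^sup>2 + 2 * u * (m * a - m * b) + u\<^sup>2 * (b - a)\<^sup>2"
    by (simp add: power2_eq_square algebra_simps)
  also have "m * a - m * b = - (m * b) - m\<^sup>2"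
    using mn(5) by simp
  finally show ?quadratic
    by (simp add: m_def)
qed

subsection \<open>Programs and integrands\<close>

lemma borel_measurable_vecI:
  fixes f :: "'a \<Rightarrow> ('v::euclidean_space, 'n::finite) vec"
  assumes "\<And>i. (\<lambda>\<omega>. f \<omega> $ i) \<in> borel_measurable H"
  shows "f \<in> borel_measurable H"
proof (rule borel_measurable_euclidean_space[THEN iffD2], intro ballI)
  fix b :: "('v, 'n) vec" assume "b \<in> Basis"
  then obtain i u where "b = axis i u"
    by (auto simp: Basis_vec_def)
  then show "(\<lambda>\<omega>. f \<omega> \<bullet> b) \<in> borel_measurable H"
    using assms[of i] by (simp add: inner_axis)
qed

lemma borel_measurable_vec_nth:
  fixes f :: "'a \<Rightarrow> ('v::euclidean_space, 'n::finite) vec"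
  assumes "f \<in> borel_measurable H"
  shows "(\<lambda>\<omega>. f \<omega> $ i) \<in> borel_measurable H"
  by (rule measurable_compose[OF assms borel_measurable_continuous_onI])
    (intro continuous_intros)

lemma norm_vec_le_sum: "norm a \<le> (\<Sum>i\<in>UNIV. norm (a $ i))"
  unfolding norm_vec_def by (rule L2_set_le_sum) simp

text \<open>Serves to turn a limit that lies in \<open>S\<close> almost surely into a version that
  lies there everywhere; in each application \<open>S\<close> is a closed subspace or cone, so that
  the default 0 belongs to it.\<close>

lemma measurable_If_closed:
  fixes y :: "'a \<Rightarrow> 'v::real_normed_vector"
  assumes "closed S" and "y \<in> borel_measurable H"
  shows "(\<lambda>\<omega>. if y \<omega> \<in> S then y \<omega> else 0) \<in> borel_measurable H"
proof -
  have "(\<lambda>v. if v \<in> S then v else 0) \<in> borel_measurable (borel :: 'v measure)"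
    using assms(1) by (intro measurable_If_set) auto
  from measurable_compose[OF assms(2) this] show ?thesis .
qed

context regular_decision_model
begin

lemma bounds_exist:
  "\<exists>K>0. (\<forall>t. \<forall>\<omega>\<in>space M. \<forall>a\<in>A t \<omega>. norm a \<le> K) \<and>
     (\<forall>t. \<forall>\<omega>\<in>space M. \<forall>a\<in>Vupto t. norm (g t \<omega> a) \<le> K)"
proof -
  obtain k where k: "\<And>t. \<forall>\<omega>\<in>space M. \<forall>a\<in>A t \<omega>. norm a \<le> k t"
    using A_bounded by metis
  obtain c where c: "\<forall>t. \<forall>\<omega>\<in>space M. \<forall>a\<in>Vupto t. norm (g t \<omega> a) \<le> c"
    using g_bounded by metis
  have "k t \<le> (\<Sum>t\<in>UNIV. \<bar>k t\<bar>)" for t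
    using member_le_sum[of t UNIV "\<lambda>t. \<bar>k t\<bar>"] by simp
  moreover define K where "K = (\<Sum>t\<in>UNIV. \<bar>k t\<bar>) + \<bar>c\<bar> + 1"
  moreover have "0 \<le> (\<Sum>t\<in>UNIV. \<bar>k t\<bar>)"
    by (simp add: sum_nonneg)
  ultimately have "0 < K" "c \<le> K" "k t \<le> K" for t
    by (smt (verit))+
  then show ?thesis
    using k c by (intro exI[of _ K]) (meson order_trans)
qed

definition "bound = (SOME K. K > 0 \<and> (\<forall>t. \<forall>\<omega>\<in>space M. \<forall>a\<in>A t \<omega>. norm a \<le> K) \<and>
     (\<forall>t. \<forall>\<omega>\<in>space M. \<forall>a\<in>Vupto t. norm (g t \<omega> a) \<le> K))"

lemma bound_pos: "0 < bound"
  and A_bound: "\<omega> \<in> space M \<Longrightarrow> a \<in> A t \<omega> \<Longrightarrow> norm a \<le> bound"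
  and g_bound: "\<omega> \<in> space M \<Longrightarrow> v \<in> Vupto t \<Longrightarrow> norm (g t \<omega> v) \<le> bound"
  using someI_ex[OF bounds_exist] unfolding bound_def[symmetric] by blast+

lemma W_iff: "w \<in> W t \<longleftrightarrow> (\<forall>b\<in>Basis. b \<notin> J t \<longrightarrow> w \<bullet> b = 0)"
  unfolding W_def span_substd_basis[OF J_subset] by simp

lemma inner_W:
  assumes "w \<in> W t"
  shows "w \<bullet> v = (\<Sum>b\<in>J t. (w \<bullet> b) * (v \<bullet> b))"
proof -
  have "w \<bullet> v = (\<Sum>b\<in>Basis. (w \<bullet> b) * (v \<bullet> b))"
    by (rule euclidean_inner)
  also have "\<dots> = (\<Sum>b\<in>J t. (w \<bullet> b) * (v \<bullet> b))"
    using assms J_subset by (intro sum.mono_neutral_right) (auto simp: W_iff)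
  finally show ?thesis .
qed

lemma inner_W_nonneg:
  "w \<in> W t \<Longrightarrow> le_W t 0 w \<Longrightarrow> le_W t 0 v \<Longrightarrow> 0 \<le> w \<bullet> v"
  by (subst inner_W, assumption) (auto simp: le_W_def intro!: sum_nonneg mult_nonneg_nonneg)

lemma inner_W_mono:
  "w \<in> W t \<Longrightarrow> le_W t 0 w \<Longrightarrow> le_W t u v \<Longrightarrow> w \<bullet> u \<le> w \<bullet> v"
  by (subst (1 2) inner_W, assumption) (auto simp: le_W_def intro!: sum_mono mult_left_mono)

lemma subspace_W: "subspace (W t)"
  unfolding W_def by simp

lemma closed_W_nonneg: "closed {w \<in> W t. le_W t 0 w}"
proof -
  have "{w \<in> W t. le_W t 0 w} = W t \<inter> (\<Inter>b\<in>J t. {w. 0 \<le> w \<bullet> b})"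
    by (auto simp: le_W_def)
  then show ?thesis
    by (simp add: closed_Int closed_subspace subspace_W closed_INT closed_Collect_le continuous_intros)
qed

lemma subspace_Vprod: "subspace Vprod"
  unfolding Vprod_def subspace_def
  using subspace_0[OF subspace_V] subspace_add[OF subspace_V] subspace_scale[OF subspace_V] by simp

lemma Aprod_subset: "\<omega> \<in> space M \<Longrightarrow> Aprod \<omega> \<subseteq> Vprod"
  using A_subset by (fastforce simp: Aprod_def Vprod_def)

lemma convex_Aprod: "\<omega> \<in> space M \<Longrightarrow> convex (Aprod \<omega>)"
  using A_convex by (fastforce simp: Aprod_def convex_def)

lemma past_Vupto: "a \<in> Vprod \<Longrightarrow> past t a \<in> Vupto t"
  by (auto simp: past_def Vprod_def Vupto_def)

lemma past_Aupto: "a \<in> Aprod \<omega> \<Longrightarrow> past t a \<in> Aupto t \<omega>"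
  by (auto simp: past_def Aprod_def Aupto_def)

lemma past_lin: "past t (u *\<^sub>R a + v *\<^sub>R b) = u *\<^sub>R past t a + v *\<^sub>R past t b"
  by (simp add: past_def vec_eq_iff)

lemma past_cong: "(\<And>i. i \<le> t \<Longrightarrow> a $ i = b $ i) \<Longrightarrow> past t a = past t b"
  by (simp add: past_def vec_eq_iff)

lemma programsD:
  assumes "x \<in> programs"
  shows "(\<lambda>\<omega>. x \<omega> $ t) \<in> borel_measurable M" and "\<omega> \<in> space M \<Longrightarrow> x \<omega> \<in> Vprod"
    and "\<omega> \<in> space M \<Longrightarrow> x \<omega> $ t \<in> V t"
    and "AE \<omega> in M. x \<omega> \<in> Aprod \<omega>" and "x \<in> borel_measurable M"
proof -
  have "AE \<omega> in M. \<forall>t\<in>UNIV. x \<omega> $ t \<in> A t \<omega>"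
    using assms by (intro AE_ball_countable[THEN iffD2]) (auto simp: programs_def intro: countable_finite)
  then show "AE \<omega> in M. x \<omega> \<in> Aprod \<omega>"
    by eventually_elim (simp add: Aprod_def)
  show "x \<in> borel_measurable M"
    using assms by (intro borel_measurable_vecI) (auto simp: programs_def)
qed (use assms in \<open>auto simp: programs_def Vprod_def\<close>)

lemma programsI:
  assumes "\<And>t. (\<lambda>\<omega>. x \<omega> $ t) \<in> borel_measurable M" and "\<And>\<omega> t. \<omega> \<in> space M \<Longrightarrow> x \<omega> $ t \<in> V t"
    and "AE \<omega> in M. x \<omega> \<in> Aprod \<omega>"
  shows "x \<in> programs"
  unfolding programs_def
proof (intro CollectI allI conjI ballI)
  fix t show "AE \<omega> in M. x \<omega> $ t \<in> A t \<omega>"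
    using assms(3) by eventually_elim (simp add: Aprod_def)
qed (use assms in auto)

lemma adapted_programsD:
  assumes "x \<in> adapted_programs"
  shows "x \<in> programs" and "(\<lambda>\<omega>. x \<omega> $ t) \<in> borel_measurable (G t)"
  using assms by (auto simp: adapted_programs_def)

lemma sets_G: "B \<in> sets (G t) \<Longrightarrow> B \<in> sets M"
  using subalgebra_G[of t] by (auto simp: subalgebra_def)

lemma measurable_G: "h \<in> borel_measurable (G t) \<Longrightarrow> h \<in> borel_measurable M"
  by (rule measurable_from_subalg[OF subalgebra_G])

lemma space_G: "space (G t) = space M"
  using subalgebra_G[of t] by (simp add: subalgebra_def)

lemma measurable_G_mono:
  assumes "i \<le> t" and "h \<in> borel_measurable (G i)"
  shows "h \<in> borel_measurable (G t)"
proof (cases "i = t")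
  case False
  then have "subalgebra (G t) (G i)"
    using sets_G_mono[of i t] assms(1) by (simp add: subalgebra_def space_G)
  from measurable_from_subalg[OF this assms(2)] show ?thesis .
qed (use assms in simp)

lemma program_bound:
  assumes "x \<in> programs"
  shows "AE \<omega> in M. norm (x \<omega> $ t) \<le> bound"
  using programsD(4)[OF assms] AE_space by eventually_elim (auto simp: Aprod_def intro: A_bound)

lemma integrable_program: "x \<in> programs \<Longrightarrow> integrable M (\<lambda>\<omega>. x \<omega> $ t)"
  by (rule integrable_const_bound[OF program_bound programsD(1)])

text \<open>A general \<open>H\<close> gives two facts at once: \<open>H = M\<close> for arbitrary
  programs, and \<open>H = G t\<close> for adapted ones, whose components up to \<open>t\<close> are
  all known at \<open>t\<close>.\<close>

lemma constraint_measurable_sub: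
  assumes H: "subalgebra H (G t)" "space H = space M"
    and x: "\<And>i. i \<le> t \<Longrightarrow> (\<lambda>\<omega>. x \<omega> $ i) \<in> borel_measurable H"
    and V: "\<And>\<omega>. \<omega> \<in> space M \<Longrightarrow> x \<omega> \<in> Vprod"
  shows "(\<lambda>\<omega>. g t \<omega> (past t (x \<omega>))) \<in> borel_measurable H"
proof -
  have "(\<lambda>\<omega>. past t (x \<omega>)) \<in> borel_measurable H"
  proof (rule borel_measurable_vecI)
    fix i show "(\<lambda>\<omega>. past t (x \<omega>) $ i) \<in> borel_measurable H"
      using x[of i] by (cases "i \<le> t") (simp_all add: past_def)
  qed
  then have "(\<lambda>\<omega>. past t (x \<omega>)) \<in> measurable H (restrict_space borel (Vupto t))"
    using V past_Vupto H(2) by (intro measurable_restrict_space2) auto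
  moreover have "(\<lambda>\<omega>. \<omega>) \<in> measurable H (G t)"
    using H by (intro measurable_from_subalg[OF H(1)]) auto
  ultimately have "(\<lambda>\<omega>. (\<omega>, past t (x \<omega>))) \<in> measurable H (G t \<Otimes>\<^sub>M restrict_space borel (Vupto t))"
    by simp
  from measurable_compose[OF this g_measurable] show ?thesis
    by simp
qed

definition constr :: "'b \<Rightarrow> ('a \<Rightarrow> ('c, 'b) vec) \<Rightarrow> 'a \<Rightarrow> 'd" where
  "constr t x \<omega> = g t \<omega> (past t (x \<omega>))"

lemma satisfies_constraint_iff: "satisfies_constraint t x \<longleftrightarrow> (AE \<omega> in M. le_W t 0 (constr t x \<omega>))"
  by (simp add: satisfies_constraint_def constr_def)

lemma constr_measurable: "x \<in> programs \<Longrightarrow> constr t x \<in> borel_measurable M"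
  unfolding constr_def[abs_def]
  by (rule constraint_measurable_sub[OF subalgebra_G]) (auto intro: programsD)

lemma constr_measurable_G: "x \<in> adapted_programs \<Longrightarrow> constr t x \<in> borel_measurable (G t)"
  unfolding constr_def[abs_def]
  by (rule constraint_measurable_sub)
    (auto simp: subalgebra_def space_G intro: programsD adapted_programsD measurable_G_mono)

lemma constr_bound: "x \<in> programs \<Longrightarrow> \<omega> \<in> space M \<Longrightarrow> norm (constr t x \<omega>) \<le> bound"
  unfolding constr_def by (intro g_bound past_Vupto programsD)

lemma integrable_constr: "x \<in> programs \<Longrightarrow> integrable M (constr t x)"
  by (rule integrable_const_bound[of _ bound]) (auto intro: constr_bound constr_measurable)

text \<open>This decomposability of the set of programs is what later turns inequalities between
  integrals into pointwise ones. The event may depend on the decision maker, so that a single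
  strategy can be changed.\<close>

lemma switch_program:
  assumes "x \<in> programs" "y \<in> programs" "\<And>t. B t \<in> sets M"
  shows "(\<lambda>\<omega>. \<chi> t. if \<omega> \<in> B t then x \<omega> $ t else y \<omega> $ t) \<in> programs"
proof (rule programsI)
  fix t show "(\<lambda>\<omega>. (\<chi> t. if \<omega> \<in> B t then x \<omega> $ t else y \<omega> $ t) $ t) \<in> borel_measurable M"
    using assms(3)[of t] programsD(1)[OF assms(1)] programsD(1)[OF assms(2)]
    by (auto intro!: measurable_If_set)
next
  show "AE \<omega> in M. (\<chi> t. if \<omega> \<in> B t then x \<omega> $ t else y \<omega> $ t) \<in> Aprod \<omega>"
    using programsD(4)[OF assms(1)] programsD(4)[OF assms(2)]
    by eventually_elim (auto simp: Aprod_def)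
qed (use programsD(3)[OF assms(1)] programsD(3)[OF assms(2)] in auto)

lemma switch_program_whole:
  assumes "x \<in> programs" "y \<in> programs" "B \<in> sets M"
  shows "(\<lambda>\<omega>. if \<omega> \<in> B then x \<omega> else y \<omega>) \<in> programs"
proof -
  have "(\<lambda>\<omega>. if \<omega> \<in> B then x \<omega> else y \<omega>) = (\<lambda>\<omega>. \<chi> t. if \<omega> \<in> B then x \<omega> $ t else y \<omega> $ t)"
    by (auto simp: vec_eq_iff)
  then show ?thesis
    using switch_program[OF assms(1,2), of "\<lambda>_. B"] assms(3) by simp
qed

lemma switch_adapted:
  assumes "x \<in> adapted_programs" "y \<in> adapted_programs" "\<And>t. B t \<in> sets (G t)"
  shows "(\<lambda>\<omega>. \<chi> t. if \<omega> \<in> B t then x \<omega> $ t else y \<omega> $ t) \<in> adapted_programs"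
  unfolding adapted_programs_def
proof (intro CollectI conjI allI)
  show "(\<lambda>\<omega>. \<chi> t. if \<omega> \<in> B t then x \<omega> $ t else y \<omega> $ t) \<in> programs"
    using assms adapted_programsD(1) sets_G by (intro switch_program) auto
  fix t show "(\<lambda>\<omega>. (\<chi> t. if \<omega> \<in> B t then x \<omega> $ t else y \<omega> $ t) $ t) \<in> borel_measurable (G t)"
    using assms(3)[of t] adapted_programsD(2)[OF assms(1)] adapted_programsD(2)[OF assms(2)]
    by (auto intro!: measurable_If_set simp: space_G)
qed

lemma mix_program:
  assumes "x \<in> programs" "y \<in> programs" "0 \<le> u" "u \<le> 1"
  shows "(\<lambda>\<omega>. (1 - u) *\<^sub>R x \<omega> + u *\<^sub>R y \<omega>) \<in> programs"
proof (rule programsI)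
  fix t show "(\<lambda>\<omega>. ((1 - u) *\<^sub>R x \<omega> + u *\<^sub>R y \<omega>) $ t) \<in> borel_measurable M"
    using programsD(1)[OF assms(1)] programsD(1)[OF assms(2)] by simp
next
  show "AE \<omega> in M. (1 - u) *\<^sub>R x \<omega> + u *\<^sub>R y \<omega> \<in> Aprod \<omega>"
    using programsD(4)[OF assms(1)] programsD(4)[OF assms(2)] AE_space
    by eventually_elim (use convex_Aprod assms(3,4) in \<open>auto intro!: convexD\<close>)
qed (use programsD(3)[OF assms(1)] programsD(3)[OF assms(2)] in
    \<open>auto intro!: subspace_add subspace_scale subspace_V\<close>)

text \<open>The class of objectives for the induction, which has to contain both the given objective
  and linear costs. Continuity is demanded of the expectation along almost surely convergent
  programs, because that is what the condition on \<open>F\<close> provides.\<close>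

definition integrand :: "('a \<Rightarrow> ('c, 'b) vec \<Rightarrow> real) \<Rightarrow> bool" where
  "integrand f \<longleftrightarrow>
     (\<forall>x\<in>programs. (\<lambda>\<omega>. f \<omega> (x \<omega>)) \<in> borel_measurable M) \<and>
     (\<forall>\<omega>\<in>space M. concave_on (Aprod \<omega>) (f \<omega>)) \<and>
     (\<exists>d. integrable M d \<and> (\<forall>\<omega>\<in>space M. \<forall>a\<in>Aprod \<omega>. \<bar>f \<omega> a\<bar> \<le> d \<omega>)) \<and>
     (\<forall>x\<in>programs. \<forall>z. (\<forall>k::nat. z k \<in> programs) \<longrightarrow> (AE \<omega> in M. (\<lambda>k. z k \<omega>) \<longlonglongrightarrow> x \<omega>) \<longrightarrow>
       (\<lambda>k. expectation (\<lambda>\<omega>. f \<omega> (z k \<omega>))) \<longlonglongrightarrow> expectation (\<lambda>\<omega>. f \<omega> (x \<omega>)))"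

definition obj :: "('a \<Rightarrow> ('c, 'b) vec \<Rightarrow> real) \<Rightarrow> ('a \<Rightarrow> ('c, 'b) vec) \<Rightarrow> real" where
  "obj f x = expectation (\<lambda>\<omega>. f \<omega> (x \<omega>))"

lemma integrandD:
  assumes "integrand f"
  shows "x \<in> programs \<Longrightarrow> (\<lambda>\<omega>. f \<omega> (x \<omega>)) \<in> borel_measurable M"
    and "\<omega> \<in> space M \<Longrightarrow> concave_on (Aprod \<omega>) (f \<omega>)"
    and "x \<in> programs \<Longrightarrow> (\<And>k::nat. z k \<in> programs) \<Longrightarrow> AE \<omega> in M. (\<lambda>k. z k \<omega>) \<longlonglongrightarrow> x \<omega> \<Longrightarrow>
       (\<lambda>k. obj f (z k)) \<longlonglongrightarrow> obj f x"
  using assms unfolding integrand_def obj_def by blast+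

definition dom :: "('a \<Rightarrow> ('c, 'b) vec \<Rightarrow> real) \<Rightarrow> 'a \<Rightarrow> real" where
  "dom f = (SOME d. integrable M d \<and> (\<forall>\<omega>\<in>space M. \<forall>a\<in>Aprod \<omega>. \<bar>f \<omega> a\<bar> \<le> d \<omega>))"

lemma
  assumes "integrand f"
  shows integrable_dom: "integrable M (dom f)"
    and abs_le_dom: "\<omega> \<in> space M \<Longrightarrow> a \<in> Aprod \<omega> \<Longrightarrow> \<bar>f \<omega> a\<bar> \<le> dom f \<omega>"
proof -
  have "\<exists>d. integrable M d \<and> (\<forall>\<omega>\<in>space M. \<forall>a\<in>Aprod \<omega>. \<bar>f \<omega> a\<bar> \<le> d \<omega>)"
    using assms by (simp add: integrand_def)
  from someI_ex[OF this] show "integrable M (dom f)"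
    and "\<omega> \<in> space M \<Longrightarrow> a \<in> Aprod \<omega> \<Longrightarrow> \<bar>f \<omega> a\<bar> \<le> dom f \<omega>"
    unfolding dom_def[symmetric] by auto
qed

lemma program_le_dom:
  assumes "integrand f" "x \<in> programs"
  shows "AE \<omega> in M. \<bar>f \<omega> (x \<omega>)\<bar> \<le> dom f \<omega>"
  using programsD(4)[OF assms(2)] AE_space by eventually_elim (auto intro: abs_le_dom assms)

lemma integrable_integrand:
  assumes "integrand f" "x \<in> programs"
  shows "integrable M (\<lambda>\<omega>. f \<omega> (x \<omega>))"
  by (rule Bochner_Integration.integrable_bound[OF integrable_dom[OF assms(1)] integrandD(1)[OF assms]])
    (use program_le_dom[OF assms] in eventually_elim, simp)

lemma obj_le: 
  assumes "integrand f" "x \<in> programs"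
  shows "\<bar>obj f x\<bar> \<le> expectation (dom f)"
proof -
  have "\<bar>obj f x\<bar> \<le> expectation (\<lambda>\<omega>. \<bar>f \<omega> (x \<omega>)\<bar>)"
    unfolding obj_def by (rule integral_abs_bound)
  also have "\<dots> \<le> expectation (dom f)"
    using integrable_integrand[OF assms] integrable_dom[OF assms(1)] program_le_dom[OF assms]
    by (intro integral_mono_AE) auto
  finally show ?thesis .
qed

lemma obj_concave:
  assumes f: "integrand f" and x: "x \<in> programs" and y: "y \<in> programs" and u: "0 \<le> u" "u \<le> 1"
  shows "(1 - u) * obj f x + u * obj f y \<le> obj f (\<lambda>\<omega>. (1 - u) *\<^sub>R x \<omega> + u *\<^sub>R y \<omega>)"
proof -
  have "(1 - u) * obj f x + u * obj f y = expectation (\<lambda>\<omega>. (1 - u) * f \<omega> (x \<omega>) + u * f \<omega> (y \<omega>))"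
    using integrable_integrand[OF f x] integrable_integrand[OF f y] by (simp add: obj_def)
  also have "\<dots> \<le> obj f (\<lambda>\<omega>. (1 - u) *\<^sub>R x \<omega> + u *\<^sub>R y \<omega>)"
    unfolding obj_def
  proof (rule integral_mono_AE)
    show "AE \<omega> in M. (1 - u) * f \<omega> (x \<omega>) + u * f \<omega> (y \<omega>) \<le> f \<omega> ((1 - u) *\<^sub>R x \<omega> + u *\<^sub>R y \<omega>)"
      using programsD(4)[OF x] programsD(4)[OF y] AE_space
      by eventually_elim (use integrandD(2)[OF f] u in \<open>auto intro!: concave_onD\<close>)
    show "integrable M (\<lambda>\<omega>. (1 - u) * f \<omega> (x \<omega>) + u * f \<omega> (y \<omega>))"
      using integrable_integrand[OF f x] integrable_integrand[OF f y] by simp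
    show "integrable M (\<lambda>\<omega>. f \<omega> ((1 - u) *\<^sub>R x \<omega> + u *\<^sub>R y \<omega>))"
      by (rule integrable_integrand[OF f mix_program[OF x y u]])
  qed
  finally show ?thesis .
qed

lemma constr_concave:
  assumes x: "x \<in> programs" and y: "y \<in> programs" and u: "0 \<le> u" "u \<le> 1" and b: "b \<in> J t"
  shows "AE \<omega> in M. (1 - u) * (constr t x \<omega> \<bullet> b) + u * (constr t y \<omega> \<bullet> b)
    \<le> constr t (\<lambda>\<omega>. (1 - u) *\<^sub>R x \<omega> + u *\<^sub>R y \<omega>) \<omega> \<bullet> b"
  using programsD(4)[OF x] programsD(4)[OF y] AE_space
proof eventually_elim
  case (elim \<omega>)
  then show ?case
    using concave_onD[OF g_concave[of \<omega>, OF _ b] u] past_Aupto by (simp add: constr_def past_lin)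
qed

text \<open>Orthogonality of \<open>q t\<close> to \<open>G t\<close> is kept separate: the
  approximate multipliers have it, but their limit may lose it. The set \<open>S\<close> holds the
  constraints that are currently priced.\<close>

definition multipliers :: "'b set \<Rightarrow> ('b \<Rightarrow> 'a \<Rightarrow> 'd) \<Rightarrow> ('b \<Rightarrow> 'a \<Rightarrow> 'c) \<Rightarrow> bool" where
  "multipliers S p q \<longleftrightarrow>
     (\<forall>t. p t \<in> borel_measurable (G t) \<and> integrable M (p t) \<and>
       (\<forall>\<omega>\<in>space M. p t \<omega> \<in> W t \<and> le_W t 0 (p t \<omega>)) \<and> (t \<notin> S \<longrightarrow> (\<forall>\<omega>\<in>space M. p t \<omega> = 0))) \<and>
     (\<forall>t. integrable M (q t))"

lemma multipliersD:
  assumes "multipliers S p q"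
  shows "p t \<in> borel_measurable (G t)" "integrable M (p t)" "integrable M (q t)"
    "\<omega> \<in> space M \<Longrightarrow> p t \<omega> \<in> W t" "\<omega> \<in> space M \<Longrightarrow> le_W t 0 (p t \<omega>)"
    "t \<notin> S \<Longrightarrow> \<omega> \<in> space M \<Longrightarrow> p t \<omega> = 0"
  using assms by (auto simp: multipliers_def)

text \<open>The adaptedness term appears as \<open>q t\<close> paired with the decision itself,
  which makes sense pointwise; in expectation it agrees with the pairing with the deviation of a
  program from its conditional expectation as soon as \<open>q t\<close> is orthogonal to
  \<open>G t\<close>.\<close>

definition lag :: "('a \<Rightarrow> ('c, 'b) vec \<Rightarrow> real) \<Rightarrow> ('b \<Rightarrow> 'a \<Rightarrow> 'd) \<Rightarrow> ('b \<Rightarrow> 'a \<Rightarrow> 'c) \<Rightarrow>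
    'a \<Rightarrow> ('c, 'b) vec \<Rightarrow> real" where
  "lag f p q \<omega> a = f \<omega> a + (\<Sum>t\<in>UNIV. p t \<omega> \<bullet> g t \<omega> (past t a)) + (\<Sum>t\<in>UNIV. q t \<omega> \<bullet> a $ t)"

lemma
  assumes m: "multipliers S p q" and x: "x \<in> programs"
  shows integrable_p_constr: "integrable M (\<lambda>\<omega>. p t \<omega> \<bullet> constr t x \<omega>)"
    and integrable_q_program: "integrable M (\<lambda>\<omega>. q t \<omega> \<bullet> x \<omega> $ t)"
proof -
  show "integrable M (\<lambda>\<omega>. p t \<omega> \<bullet> constr t x \<omega>)"
    by (rule integrable_inner_AE_bounded(2)[where K = bound])
      (auto intro: multipliersD[OF m] constr_measurable[OF x] constr_bound[OF x])
  show "integrable M (\<lambda>\<omega>. q t \<omega> \<bullet> x \<omega> $ t)"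
    by (rule integrable_inner_AE_bounded(2)[OF multipliersD(3)[OF m] programsD(1)[OF x] program_bound[OF x]])
qed

lemma
  assumes f: "integrand f" and m: "multipliers S p q" and x: "x \<in> programs"
  shows integrable_lag: "integrable M (\<lambda>\<omega>. lag f p q \<omega> (x \<omega>))"
    and expectation_lag: "expectation (\<lambda>\<omega>. lag f p q \<omega> (x \<omega>)) = obj f x
      + (\<Sum>t\<in>UNIV. expectation (\<lambda>\<omega>. p t \<omega> \<bullet> constr t x \<omega>)) + (\<Sum>t\<in>UNIV. expectation (\<lambda>\<omega>. q t \<omega> \<bullet> x \<omega> $ t))"
  using integrable_integrand[OF f x] integrable_p_constr[OF m x] integrable_q_program[OF m x]
  by (simp_all add: lag_def constr_def obj_def)

lemma concave_lag:
  assumes f: "integrand f" and m: "multipliers S p q" and \<omega>: "\<omega> \<in> space M"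
  shows "concave_on (Aprod \<omega>) (lag f p q \<omega>)"
  unfolding concave_on_iff
proof (intro conjI ballI allI impI)
  fix a b :: "('c, 'b) vec" and u v :: real
  assume ab: "a \<in> Aprod \<omega>" "b \<in> Aprod \<omega>" and uv: "0 \<le> u" "0 \<le> v" "u + v = 1"
  have "u * f \<omega> a + v * f \<omega> b \<le> f \<omega> (u *\<^sub>R a + v *\<^sub>R b)"
    using integrandD(2)[OF f \<omega>] ab uv by (simp add: concave_on_iff)
  moreover have "u * (p t \<omega> \<bullet> g t \<omega> (past t a)) + v * (p t \<omega> \<bullet> g t \<omega> (past t b))
      \<le> p t \<omega> \<bullet> g t \<omega> (past t (u *\<^sub>R a + v *\<^sub>R b))" for t
  proof -
    have "le_W t (u *\<^sub>R g t \<omega> (past t a) + v *\<^sub>R g t \<omega> (past t b)) (g t \<omega> (past t (u *\<^sub>R a + v *\<^sub>R b)))"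
      unfolding le_W_def past_lin
      using g_concave[OF \<omega>, of _ t] past_Aupto[OF ab(1), of t] past_Aupto[OF ab(2), of t] uv
      by (auto simp: concave_on_iff inner_add_left)
    from inner_W_mono[OF multipliersD(4,5)[OF m \<omega>] this] show ?thesis
      by (simp add: inner_add_right)
  qed
  ultimately show "u * lag f p q \<omega> a + v * lag f p q \<omega> b \<le> lag f p q \<omega> (u *\<^sub>R a + v *\<^sub>R b)"
    using sum_mono[of UNIV "\<lambda>t. u * (p t \<omega> \<bullet> g t \<omega> (past t a)) + v * (p t \<omega> \<bullet> g t \<omega> (past t b))"
        "\<lambda>t. p t \<omega> \<bullet> g t \<omega> (past t (u *\<^sub>R a + v *\<^sub>R b))"]
    by (simp add: lag_def inner_add_right sum.distrib sum_distrib_left algebra_simps)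
qed (rule convex_Aprod[OF \<omega>])

text \<open>Gives the majorant for dominated convergence where the multipliers are bounded, and the
  lower bound required by the density argument for concave functions.\<close>

lemma abs_lag_le:
  assumes f: "integrand f" and \<omega>: "\<omega> \<in> space M" and a: "a \<in> Aprod \<omega>"
  shows "\<bar>lag f p q \<omega> a\<bar> \<le> dom f \<omega> + (\<Sum>t\<in>UNIV. norm (p t \<omega>) * bound) + (\<Sum>t\<in>UNIV. norm (q t \<omega>) * bound)"
proof -
  have "\<bar>p t \<omega> \<bullet> g t \<omega> (past t a)\<bar> \<le> norm (p t \<omega>) * bound" for t
    using Cauchy_Schwarz_ineq2[of "p t \<omega>" "g t \<omega> (past t a)"]
      mult_left_mono[OF g_bound[OF \<omega> past_Vupto[of a t]] norm_ge_zero, of "p t \<omega>"] Aprod_subset[OF \<omega>] a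
    by (auto intro: order_trans)
  then have "\<bar>\<Sum>t\<in>UNIV. p t \<omega> \<bullet> g t \<omega> (past t a)\<bar> \<le> (\<Sum>t\<in>UNIV. norm (p t \<omega>) * bound)"
    by (intro order_trans[OF sum_abs] sum_mono)
  moreover have "\<bar>q t \<omega> \<bullet> a $ t\<bar> \<le> norm (q t \<omega>) * bound" for t
    using Cauchy_Schwarz_ineq2[of "q t \<omega>" "a $ t"] a
      mult_left_mono[OF A_bound[OF \<omega>, of "a $ t" t] norm_ge_zero, of "q t \<omega>"]
    by (auto intro: order_trans simp: Aprod_def)
  then have "\<bar>\<Sum>t\<in>UNIV. q t \<omega> \<bullet> a $ t\<bar> \<le> (\<Sum>t\<in>UNIV. norm (q t \<omega>) * bound)"
    by (intro order_trans[OF sum_abs] sum_mono)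
  ultimately show ?thesis
    using abs_le_dom[OF f \<omega> a] unfolding lag_def by linarith
qed

subsection \<open>Penalised constraint violations\<close>

definition deviation :: "'b \<Rightarrow> ('a \<Rightarrow> ('c, 'b) vec) \<Rightarrow> 'a \<Rightarrow> 'c" where
  "deviation t x \<omega> = x \<omega> $ t - vec_cond_exp M (G t) (\<lambda>\<omega>. x \<omega> $ t) \<omega>"

text \<open>For a program that is not adapted, the constraint function is only measurable in
  \<open>M\<close>. Conditioning on \<open>G t\<close> keeps concavity, and it makes the multiplier
  formed from the violation measurable in \<open>G t\<close>.\<close>

definition cond_constr :: "'b \<Rightarrow> ('a \<Rightarrow> ('c, 'b) vec) \<Rightarrow> 'a \<Rightarrow> 'd" where
  "cond_constr t x = vec_cond_exp M (G t) (constr t x)"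

definition violation :: "'b \<Rightarrow> 'd \<Rightarrow> ('a \<Rightarrow> ('c, 'b) vec) \<Rightarrow> 'a \<Rightarrow> real" where
  "violation t b x \<omega> = max 0 (- (cond_constr t x \<omega> \<bullet> b))"

definition penalty :: "'b set \<Rightarrow> ('a \<Rightarrow> ('c, 'b) vec) \<Rightarrow> real" where
  "penalty S x = (\<Sum>t\<in>UNIV. expectation (\<lambda>\<omega>. (norm (deviation t x \<omega>))\<^sup>2))
     + (\<Sum>t\<in>S. \<Sum>b\<in>J t. expectation (\<lambda>\<omega>. (violation t b x \<omega>)\<^sup>2))"

text \<open>One \<open>bound\<close> for the decision, and \<open>DIM('c)\<close> times
  \<open>bound\<close> for its conditional expectation, which is estimated coordinate by
  coordinate.\<close>

definition "deviation_bound = (1 + real DIM('c)) * bound"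
definition "cond_constr_bound = real DIM('d) * bound"

lemma finite_J: "finite (J t)"
  using J_subset finite_Basis by (rule finite_subset)

lemma deviation_measurable: "x \<in> programs \<Longrightarrow> deviation t x \<in> borel_measurable M"
  unfolding deviation_def using programsD(1)
  by (intro borel_measurable_diff measurable_G[OF vec_cond_exp_measurable[OF subalgebra_G]]) auto

lemma deviation_le:
  assumes "x \<in> programs"
  shows "AE \<omega> in M. norm (deviation t x \<omega>) \<le> deviation_bound"
  using norm_vec_cond_exp_bounded[OF subalgebra_G programsD(1)[OF assms] program_bound[OF assms], of t t]
    program_bound[OF assms, of t]
proof eventually_elim
  case (elim \<omega>)
  then show ?case
    using norm_triangle_ineq4[of "x \<omega> $ t" "vec_cond_exp M (G t) (\<lambda>\<omega>. x \<omega> $ t) \<omega>"]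
    by (simp add: deviation_def deviation_bound_def algebra_simps)
qed

lemma integrable_deviation: "x \<in> programs \<Longrightarrow> integrable M (deviation t x)"
  by (rule integrable_const_bound[OF deviation_le deviation_measurable])

lemma integrable_deviation_inner: "x \<in> programs \<Longrightarrow> y \<in> programs \<Longrightarrow> integrable M (\<lambda>\<omega>. deviation t x \<omega> \<bullet> deviation t y \<omega>)"
  by (rule integrable_inner_AE_bounded(2)[OF integrable_deviation deviation_measurable deviation_le])

lemma integrable_deviation_square: "x \<in> programs \<Longrightarrow> integrable M (\<lambda>\<omega>. (norm (deviation t x \<omega>))\<^sup>2)"
  unfolding power2_norm_eq_inner by (rule integrable_deviation_inner)

lemma cond_constr_measurable_G: "cond_constr t x \<in> borel_measurable (G t)"
  unfolding cond_constr_def by (rule vec_cond_exp_measurable[OF subalgebra_G])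

lemma cond_constr_measurable: "cond_constr t x \<in> borel_measurable M"
  by (rule measurable_G[OF cond_constr_measurable_G])

lemma cond_constr_le: "x \<in> programs \<Longrightarrow> AE \<omega> in M. norm (cond_constr t x \<omega>) \<le> cond_constr_bound"
  unfolding cond_constr_def cond_constr_bound_def
  by (rule norm_vec_cond_exp_bounded[OF subalgebra_G constr_measurable AE_I2]) (auto intro: constr_bound)

lemma integrable_cond_constr: "x \<in> programs \<Longrightarrow> integrable M (cond_constr t x)"
  by (rule integrable_const_bound[OF cond_constr_le cond_constr_measurable])

lemma violation_measurable_G: "violation t b x \<in> borel_measurable (G t)"
  unfolding violation_def using cond_constr_measurable_G by measurable

lemma violation_measurable: "violation t b x \<in> borel_measurable M"
  by (rule measurable_G[OF violation_measurable_G])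

lemma violation_le:
  assumes "x \<in> programs" "b \<in> J t"
  shows "AE \<omega> in M. \<bar>violation t b x \<omega>\<bar> \<le> cond_constr_bound"
  using cond_constr_le[OF assms(1), of t]
proof eventually_elim
  case (elim \<omega>)
  have "\<bar>cond_constr t x \<omega> \<bullet> b\<bar> \<le> norm (cond_constr t x \<omega>)"
    using J_subset assms(2) by (intro Basis_le_norm) auto
  with elim show ?case
    by (auto simp: violation_def max_def)
qed

lemma integrable_violation: "x \<in> programs \<Longrightarrow> b \<in> J t \<Longrightarrow> integrable M (violation t b x)"
  using violation_le violation_measurable by (intro integrable_const_bound[of _ cond_constr_bound]) auto

lemma integrable_violation_square:
  assumes "x \<in> programs" "b \<in> J t"
  shows "integrable M (\<lambda>\<omega>. (violation t b x \<omega>)\<^sup>2)"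
proof (rule integrable_const_bound[of _ "cond_constr_bound\<^sup>2"])
  show "AE \<omega> in M. norm ((violation t b x \<omega>)\<^sup>2) \<le> cond_constr_bound\<^sup>2"
    using violation_le[OF assms] by eventually_elim (use power_mono[of "\<bar>violation t b x _\<bar>" cond_constr_bound 2] in simp)
  show "(\<lambda>\<omega>. (violation t b x \<omega>)\<^sup>2) \<in> borel_measurable M"
    using violation_measurable by measurable
qed

lemma integrable_violation_cond_constr:
  assumes "x \<in> programs" "y \<in> programs" "b \<in> J t"
  shows "integrable M (\<lambda>\<omega>. violation t b x \<omega> * (cond_constr t y \<omega> \<bullet> b))"
proof -
  have "AE \<omega> in M. norm (violation t b x \<omega> *\<^sub>R b) \<le> cond_constr_bound"
    using violation_le[OF assms(1,3)] assms(3) J_subset[of t] by (auto simp: subset_iff)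
  then show ?thesis
    using integrable_inner_AE_bounded(1)[OF integrable_cond_constr[OF assms(2)], of "\<lambda>\<omega>. violation t b x \<omega> *\<^sub>R b" cond_constr_bound t]
      violation_measurable by (simp add: inner_commute)
qed

section \<open>Behaviour of the penalty along segments\<close>

context
  fixes x y u
  assumes x: "x \<in> programs" and y: "y \<in> programs" and u: "0 \<le> u" "u \<le> (1::real)"
begin

abbreviation (input) "mix \<equiv> (\<lambda>\<omega>. (1 - u) *\<^sub>R x \<omega> + u *\<^sub>R y \<omega>)"

lemma deviation_mix: "AE \<omega> in M. deviation t mix \<omega> = (1 - u) *\<^sub>R deviation t x \<omega> + u *\<^sub>R deviation t y \<omega>"
  using vec_cond_exp_lin[OF subalgebra_G integrable_program[OF x] integrable_program[OF y], of t "1 - u" t u t]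
  by eventually_elim (simp add: deviation_def algebra_simps)

text \<open>Pointwise concavity of the constraint survives conditioning because conditional
  expectation is linear and monotone.\<close>

lemma cond_constr_mix:
  assumes b: "b \<in> J t"
  shows "AE \<omega> in M. (1 - u) * (cond_constr t x \<omega> \<bullet> b) + u * (cond_constr t y \<omega> \<bullet> b) \<le> cond_constr t mix \<omega> \<bullet> b"
proof -
  interpret H: sigma_finite_subalgebra M "G t"
    by (rule sigma_finite_subalgebraI[OF subalgebra_G])
  have bB: "b \<in> Basis"
    using b J_subset by auto
  have i: "integrable M (\<lambda>\<omega>. constr t z \<omega> \<bullet> b)" if "z \<in> programs" for z
    using integrable_constr[OF that] by simp
  have "AE \<omega> in M. real_cond_exp M (G t) (\<lambda>\<omega>. ((1 - u) *\<^sub>R constr t x \<omega> + u *\<^sub>R constr t y \<omega>) \<bullet> b) \<omega>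
      \<le> real_cond_exp M (G t) (\<lambda>\<omega>. constr t mix \<omega> \<bullet> b) \<omega>"
    using constr_concave[OF x y u b] i[OF x] i[OF y] i[OF mix_program[OF x y u]]
    by (intro H.real_cond_exp_mono) (auto simp: inner_add_left)
  with vec_cond_exp_lin[OF subalgebra_G integrable_constr[OF x] integrable_constr[OF y], of t "1 - u" t u t]
  show ?thesis
  proof eventually_elim
    case (elim \<omega>)
    have "(1 - u) * (cond_constr t x \<omega> \<bullet> b) + u * (cond_constr t y \<omega> \<bullet> b)
        = vec_cond_exp M (G t) (\<lambda>\<omega>. (1 - u) *\<^sub>R constr t x \<omega> + u *\<^sub>R constr t y \<omega>) \<omega> \<bullet> b"
      unfolding elim(1) by (simp add: cond_constr_def inner_add_left)
    then show ?case
      using elim(2) by (simp add: cond_constr_def vec_cond_exp_inner_Basis[OF subalgebra_G bB])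
  qed
qed

text \<open>The convex bounds make sublevel sets of the penalty closed under midpoints, as the
  extraction of almost surely convergent programs requires.\<close>

lemma deviation_square_mix_convex:
  "expectation (\<lambda>\<omega>. (norm (deviation t mix \<omega>))\<^sup>2)
     \<le> (1 - u) * expectation (\<lambda>\<omega>. (norm (deviation t x \<omega>))\<^sup>2) + u * expectation (\<lambda>\<omega>. (norm (deviation t y \<omega>))\<^sup>2)"
proof -
  have "expectation (\<lambda>\<omega>. (norm (deviation t mix \<omega>))\<^sup>2)
      \<le> expectation (\<lambda>\<omega>. (1 - u) * (norm (deviation t x \<omega>))\<^sup>2 + u * (norm (deviation t y \<omega>))\<^sup>2)"
  proof (rule integral_mono_AE)
    show "AE \<omega> in M. (norm (deviation t mix \<omega>))\<^sup>2 \<le> (1 - u) * (norm (deviation t x \<omega>))\<^sup>2 + u * (norm (deviation t y \<omega>))\<^sup>2"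
      using deviation_mix[of t]
    proof eventually_elim
      case (elim \<omega>)
      have "(norm ((1 - u) *\<^sub>R a + u *\<^sub>R b))\<^sup>2
          = (1 - u) * (norm a)\<^sup>2 + u * (norm b)\<^sup>2 - u * (1 - u) * (norm (a - b))\<^sup>2" for a b :: 'c
        unfolding power2_norm_eq_inner
        by (simp add: inner_add inner_diff inner_commute[of b a] algebra_simps)
      then show ?case
        unfolding elim using u by simp
    qed
  qed (use integrable_deviation_square x y mix_program[OF x y u] in auto)
  then show ?thesis
    using integrable_deviation_square[OF x, of t] integrable_deviation_square[OF y, of t] by simp
qed

text \<open>An expansion at \<open>x\<close> towards \<open>y\<close>, with a remainder uniform in
  \<open>y\<close>. The slope depends on \<open>y\<close> only through the pairing with
  \<open>deviation t x\<close>, which becomes the multiplier \<open>q\<close>.\<close>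

lemma deviation_square_mix_quadratic:
  "expectation (\<lambda>\<omega>. (norm (deviation t mix \<omega>))\<^sup>2)
     \<le> expectation (\<lambda>\<omega>. (norm (deviation t x \<omega>))\<^sup>2) + 2 * u * (expectation (\<lambda>\<omega>. deviation t x \<omega> \<bullet> deviation t y \<omega>)
        - expectation (\<lambda>\<omega>. (norm (deviation t x \<omega>))\<^sup>2)) + u\<^sup>2 * (2 * deviation_bound)\<^sup>2"
proof -
  have "expectation (\<lambda>\<omega>. (norm (deviation t mix \<omega>))\<^sup>2)
      \<le> expectation (\<lambda>\<omega>. (norm (deviation t x \<omega>))\<^sup>2 + 2 * u * (deviation t x \<omega> \<bullet> deviation t y \<omega> - (norm (deviation t x \<omega>))\<^sup>2)
        + u\<^sup>2 * (2 * deviation_bound)\<^sup>2)"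
  proof (rule integral_mono_AE)
    show "AE \<omega> in M. (norm (deviation t mix \<omega>))\<^sup>2
      \<le> (norm (deviation t x \<omega>))\<^sup>2 + 2 * u * (deviation t x \<omega> \<bullet> deviation t y \<omega> - (norm (deviation t x \<omega>))\<^sup>2) + u\<^sup>2 * (2 * deviation_bound)\<^sup>2"
      using deviation_mix[of t] deviation_le[OF x, of t] deviation_le[OF y, of t]
    proof eventually_elim
      case (elim \<omega>)
      have "norm (deviation t y \<omega> - deviation t x \<omega>) \<le> 2 * deviation_bound"
        using elim(2,3) norm_triangle_ineq4[of "deviation t y \<omega>" "deviation t x \<omega>"] by linarith
      then have "(norm (deviation t y \<omega> - deviation t x \<omega>))\<^sup>2 \<le> (2 * deviation_bound)\<^sup>2"
        by (intro power_mono) auto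
      then have "u\<^sup>2 * (norm (deviation t y \<omega> - deviation t x \<omega>))\<^sup>2 \<le> u\<^sup>2 * (2 * deviation_bound)\<^sup>2"
        by (intro mult_left_mono) auto
      moreover have "(norm ((1 - u) *\<^sub>R a + u *\<^sub>R b))\<^sup>2
          = (norm a)\<^sup>2 + 2 * u * (a \<bullet> b - (norm a)\<^sup>2) + u\<^sup>2 * (norm (b - a))\<^sup>2" for a b :: 'c
        unfolding power2_norm_eq_inner
        by (simp add: inner_add inner_diff inner_commute[of b a] algebra_simps power2_eq_square)
      ultimately show ?case
        unfolding elim(1) by simp
    qed
  qed (use integrable_deviation_square[of _ t] integrable_deviation_inner[of _ _ t] x y mix_program[OF x y u] in auto)
  then show ?thesis
    using integrable_deviation_square[OF x, of t] integrable_deviation_inner[OF x y, of t] by (simp add: prob_space)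
qed

lemma violation_square_mix_convex:
  assumes b: "b \<in> J t"
  shows "expectation (\<lambda>\<omega>. (violation t b mix \<omega>)\<^sup>2)
     \<le> (1 - u) * expectation (\<lambda>\<omega>. (violation t b x \<omega>)\<^sup>2) + u * expectation (\<lambda>\<omega>. (violation t b y \<omega>)\<^sup>2)"
proof -
  have "expectation (\<lambda>\<omega>. (violation t b mix \<omega>)\<^sup>2)
      \<le> expectation (\<lambda>\<omega>. (1 - u) * (violation t b x \<omega>)\<^sup>2 + u * (violation t b y \<omega>)\<^sup>2)"
  proof (rule integral_mono_AE)
    show "AE \<omega> in M. (violation t b mix \<omega>)\<^sup>2 \<le> (1 - u) * (violation t b x \<omega>)\<^sup>2 + u * (violation t b y \<omega>)\<^sup>2"
      using cond_constr_mix[OF b] by eventually_elim (unfold violation_def, rule neg_part_square_mix(1)[OF _ u])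
  qed (use integrable_violation_square[OF _ b] x y mix_program[OF x y u] in auto)
  then show ?thesis
    using integrable_violation_square[OF x b] integrable_violation_square[OF y b] by simp
qed

text \<open>Here the slope depends on \<open>y\<close> through \<open>violation t b x\<close> times
  the conditional constraint, which becomes the pairing of \<open>p\<close> with the constraint.
  Only an upper bound is available, since the constraint is concave rather than affine, and an upper
  bound is what a comparison with a maximiser uses.\<close>

lemma violation_square_mix_quadratic:
  assumes b: "b \<in> J t"
  shows "expectation (\<lambda>\<omega>. (violation t b mix \<omega>)\<^sup>2)
     \<le> expectation (\<lambda>\<omega>. (violation t b x \<omega>)\<^sup>2) + 2 * u * (- expectation (\<lambda>\<omega>. violation t b x \<omega> * (cond_constr t y \<omega> \<bullet> b))
        - expectation (\<lambda>\<omega>. (violation t b x \<omega>)\<^sup>2)) + u\<^sup>2 * (2 * cond_constr_bound)\<^sup>2"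
proof -
  have "expectation (\<lambda>\<omega>. (violation t b mix \<omega>)\<^sup>2)
      \<le> expectation (\<lambda>\<omega>. (violation t b x \<omega>)\<^sup>2 + 2 * u * (- (violation t b x \<omega> * (cond_constr t y \<omega> \<bullet> b)) - (violation t b x \<omega>)\<^sup>2)
        + u\<^sup>2 * (2 * cond_constr_bound)\<^sup>2)"
  proof (rule integral_mono_AE)
    show "AE \<omega> in M. (violation t b mix \<omega>)\<^sup>2
      \<le> (violation t b x \<omega>)\<^sup>2 + 2 * u * (- (violation t b x \<omega> * (cond_constr t y \<omega> \<bullet> b)) - (violation t b x \<omega>)\<^sup>2) + u\<^sup>2 * (2 * cond_constr_bound)\<^sup>2"
      using cond_constr_mix[OF b] cond_constr_le[OF x, of t] cond_constr_le[OF y, of t]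
    proof eventually_elim
      case (elim \<omega>)
      have "b \<in> Basis"
        using b J_subset by auto
      then have "\<bar>cond_constr t y \<omega> \<bullet> b - cond_constr t x \<omega> \<bullet> b\<bar> \<le> 2 * cond_constr_bound"
        using elim(2,3) Basis_le_norm[of b "cond_constr t x \<omega>"] Basis_le_norm[of b "cond_constr t y \<omega>"] by linarith
      then have "\<bar>cond_constr t y \<omega> \<bullet> b - cond_constr t x \<omega> \<bullet> b\<bar>\<^sup>2 \<le> (2 * cond_constr_bound)\<^sup>2"
        by (intro power_mono) auto
      then have "u\<^sup>2 * (cond_constr t y \<omega> \<bullet> b - cond_constr t x \<omega> \<bullet> b)\<^sup>2 \<le> u\<^sup>2 * (2 * cond_constr_bound)\<^sup>2"
        by (intro mult_left_mono) auto
      then show ?case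
        using neg_part_square_mix(2)[OF elim(1) u] by (simp add: violation_def)
    qed
  qed (use integrable_violation_square[OF _ b] integrable_violation_cond_constr[OF x y b] x y mix_program[OF x y u] in auto)
  then show ?thesis
    using integrable_violation_square[OF x b] integrable_violation_cond_constr[OF x y b] by (simp add: prob_space)
qed

end

lemma penalty_midpoint:
  assumes x: "x \<in> programs" and y: "y \<in> programs" and d: "penalty S x \<le> d" "penalty S y \<le> d"
  shows "penalty S (\<lambda>\<omega>. (1/2) *\<^sub>R (x \<omega> + y \<omega>)) \<le> d"
proof -
  have eq: "(\<lambda>\<omega>. (1/2) *\<^sub>R (x \<omega> + y \<omega>)) = (\<lambda>\<omega>. (1 - 1/2) *\<^sub>R x \<omega> + (1/2) *\<^sub>R y \<omega>)"
    by (simp add: scaleR_add_right)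
  have "penalty S (\<lambda>\<omega>. (1/2) *\<^sub>R (x \<omega> + y \<omega>)) \<le>
      (\<Sum>t\<in>UNIV. (1 - 1/2) * expectation (\<lambda>\<omega>. (norm (deviation t x \<omega>))\<^sup>2) + (1/2) * expectation (\<lambda>\<omega>. (norm (deviation t y \<omega>))\<^sup>2))
     + (\<Sum>t\<in>S. \<Sum>b\<in>J t. (1 - 1/2) * expectation (\<lambda>\<omega>. (violation t b x \<omega>)\<^sup>2) + (1/2) * expectation (\<lambda>\<omega>. (violation t b y \<omega>)\<^sup>2))"
    unfolding penalty_def eq
    by (intro add_mono sum_mono deviation_square_mix_convex violation_square_mix_convex x y) auto
  also have "\<dots> = (1/2) * penalty S x + (1/2) * penalty S y"
    by (simp add: penalty_def sum.distrib sum_divide_distrib add_divide_distrib)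
  also have "\<dots> \<le> d"
    using d by simp
  finally show ?thesis .
qed

lemma penalty_nonneg: "0 \<le> penalty S x"
  unfolding penalty_def by (intro add_nonneg_nonneg sum_nonneg) (auto intro: integral_nonneg_AE)

lemma deviation_square_le_penalty: "expectation (\<lambda>\<omega>. (norm (deviation t x \<omega>))\<^sup>2) \<le> penalty S x"
proof -
  have "expectation (\<lambda>\<omega>. (norm (deviation t x \<omega>))\<^sup>2) \<le> (\<Sum>t\<in>UNIV. expectation (\<lambda>\<omega>. (norm (deviation t x \<omega>))\<^sup>2))"
    by (rule member_le_sum) auto
  moreover have "0 \<le> (\<Sum>t\<in>S. \<Sum>b\<in>J t. expectation (\<lambda>\<omega>. (violation t b x \<omega>)\<^sup>2))"
    by (intro sum_nonneg) auto
  ultimately show ?thesis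
    by (simp add: penalty_def)
qed

lemma violation_square_le_penalty:
  assumes "t \<in> S" "b \<in> J t"
  shows "expectation (\<lambda>\<omega>. (violation t b x \<omega>)\<^sup>2) \<le> penalty S x"
proof -
  have "expectation (\<lambda>\<omega>. (violation t b x \<omega>)\<^sup>2) \<le> (\<Sum>b\<in>J t. expectation (\<lambda>\<omega>. (violation t b x \<omega>)\<^sup>2))"
    using assms finite_J by (intro member_le_sum) auto
  also have "\<dots> \<le> (\<Sum>t\<in>S. \<Sum>b\<in>J t. expectation (\<lambda>\<omega>. (violation t b x \<omega>)\<^sup>2))"
    using assms by (intro member_le_sum[of t S "\<lambda>t. \<Sum>b\<in>J t. expectation (\<lambda>\<omega>. (violation t b x \<omega>)\<^sup>2)"])
      (auto intro: sum_nonneg)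
  moreover have "0 \<le> (\<Sum>t\<in>UNIV. expectation (\<lambda>\<omega>. (norm (deviation t x \<omega>))\<^sup>2))"
    by (intro sum_nonneg) auto
  ultimately show ?thesis
    by (simp add: penalty_def)
qed

lemma cond_constr_adapted:
  assumes "x \<in> adapted_programs"
  shows "AE \<omega> in M. cond_constr t x \<omega> = constr t x \<omega>"
  unfolding cond_constr_def
  by (intro vec_cond_exp_measurable_eq subalgebra_G integrable_constr constr_measurable_G
      adapted_programsD(1) assms)

lemma deviation_adapted:
  assumes "x \<in> adapted_programs"
  shows "AE \<omega> in M. deviation t x \<omega> = 0"
  using vec_cond_exp_measurable_eq[OF subalgebra_G integrable_program[OF adapted_programsD(1)[OF assms]]
      adapted_programsD(2)[OF assms], of t]
  by eventually_elim (simp add: deviation_def)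

lemma penalty_feasible:
  assumes x: "x \<in> adapted_programs" and S: "\<And>t. t \<in> S \<Longrightarrow> satisfies_constraint t x"
  shows "penalty S x = 0"
proof -
  have "expectation (\<lambda>\<omega>. (norm (deviation t x \<omega>))\<^sup>2) = expectation (\<lambda>\<omega>. 0)" for t
    using deviation_adapted[OF x, of t] deviation_measurable[OF adapted_programsD(1)[OF x]]
    by (intro integral_cong_AE) auto
  moreover have "expectation (\<lambda>\<omega>. (violation t b x \<omega>)\<^sup>2) = expectation (\<lambda>\<omega>. 0)" if "t \<in> S" "b \<in> J t" for t b
  proof (rule integral_cong_AE)
    show "AE \<omega> in M. (violation t b x \<omega>)\<^sup>2 = 0"
      using cond_constr_adapted[OF x, of t] S[OF that(1), unfolded satisfies_constraint_iff]
      by eventually_elim (use that(2) in \<open>simp add: violation_def le_W_def\<close>)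
  qed (use violation_measurable in auto)
  ultimately show ?thesis
    by (simp add: penalty_def)
qed

subsection \<open>Approximate multipliers\<close>

lemma program_limit:
  assumes h: "\<And>n::nat. h n \<in> programs" and conv: "AE \<omega> in M. convergent (\<lambda>n. h n \<omega>)"
  obtains z where "z \<in> programs" and "AE \<omega> in M. (\<lambda>n. h n \<omega>) \<longlonglongrightarrow> z \<omega>"
proof -
  define y where "y \<omega> = lim (\<lambda>n. h n \<omega>)" for \<omega>
  have y: "AE \<omega> in M. (\<lambda>n. h n \<omega>) \<longlonglongrightarrow> y \<omega>"
    using conv by eventually_elim (simp add: y_def convergent_LIMSEQ_iff)
  have ymeas: "y \<in> borel_measurable M"
    unfolding y_def using programsD(5)[OF h] by measurable
  \<comment> \<open>Programs lie in \<open>A t\<close> only almost surely but in \<open>V t\<close>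
    everywhere, so the limit is reset to 0 where it leaves \<open>Vprod\<close>.\<close>
  define z where "z \<omega> = (if y \<omega> \<in> Vprod then y \<omega> else 0)" for \<omega>
  have "closed Vprod"
    by (rule closed_subspace[OF subspace_Vprod])
  then have zmeas: "z \<in> borel_measurable M"
    unfolding z_def by (rule measurable_If_closed[OF _ ymeas])
  have all: "AE \<omega> in M. \<forall>n. h n \<omega> \<in> Aprod \<omega>"
    using programsD(4)[OF h] by (simp add: AE_all_countable)
  have yA: "AE \<omega> in M. y \<omega> \<in> Aprod \<omega>"
    using all y AE_space
  proof eventually_elim
    case (elim \<omega>)
    have "y \<omega> $ t \<in> A t \<omega>" for t
      by (rule closed_sequentially[OF A_closed[OF elim(3)] _ tendsto_vec_nth[OF elim(2)]])
        (use elim(1) in \<open>simp add: Aprod_def\<close>)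
    then show ?case
      by (simp add: Aprod_def)
  qed
  have zy: "AE \<omega> in M. z \<omega> = y \<omega>"
    using yA AE_space by eventually_elim (use Aprod_subset in \<open>auto simp: z_def\<close>)
  show ?thesis
  proof (rule that[OF programsI])
    show "(\<lambda>\<omega>. z \<omega> $ t) \<in> borel_measurable M" for t
      by (rule borel_measurable_vec_nth[OF zmeas])
    show "z \<omega> $ t \<in> V t" for \<omega> t
      using subspace_0[OF subspace_V] by (simp add: z_def Vprod_def)
    show "AE \<omega> in M. z \<omega> \<in> Aprod \<omega>"
      using zy yA by eventually_elim simp
    show "AE \<omega> in M. (\<lambda>n. h n \<omega>) \<longlonglongrightarrow> z \<omega>"
      using zy y by eventually_elim simp
  qed
qed

lemma program_L1_limit:
  assumes h: "\<And>n::nat. h n \<in> programs" and z: "z \<in> programs" and lim: "AE \<omega> in M. (\<lambda>n. h n \<omega>) \<longlonglongrightarrow> z \<omega>"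
  shows "(\<lambda>n. expectation (\<lambda>\<omega>. norm (z \<omega> $ t - h n \<omega> $ t))) \<longlonglongrightarrow> 0"
proof -
  have "(\<lambda>n. expectation (\<lambda>\<omega>. norm (z \<omega> $ t - h n \<omega> $ t))) \<longlonglongrightarrow> expectation (\<lambda>\<omega>. 0)"
  proof (rule integral_dominated_convergence[where w = "\<lambda>_. 2 * bound"])
    show "AE \<omega> in M. (\<lambda>n. norm (z \<omega> $ t - h n \<omega> $ t)) \<longlonglongrightarrow> 0"
      using lim
    proof eventually_elim
      case (elim \<omega>)
      have "(\<lambda>n. norm (z \<omega> $ t - h n \<omega> $ t)) \<longlonglongrightarrow> norm (z \<omega> $ t - z \<omega> $ t)"
        by (intro tendsto_intros elim)
      then show ?case
        by simp
    qed
    show "AE \<omega> in M. norm (norm (z \<omega> $ t - h n \<omega> $ t)) \<le> 2 * bound" for n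
      using program_bound[OF z, of t] program_bound[OF h, of n t]
    proof eventually_elim
      case (elim \<omega>)
      then show ?case
        using norm_triangle_ineq4[of "z \<omega> $ t" "h n \<omega> $ t"] by simp
    qed
  qed (use programsD(1)[OF h] programsD(1)[OF z] in auto)
  then show ?thesis
    by simp
qed

lemma constr_tendsto:
  assumes h: "\<And>n::nat. h n \<in> programs" and z: "z \<in> programs" and lim: "AE \<omega> in M. (\<lambda>n. h n \<omega>) \<longlonglongrightarrow> z \<omega>"
  shows "AE \<omega> in M. (\<lambda>n. constr t (h n) \<omega>) \<longlonglongrightarrow> constr t z \<omega>"
proof -
  have "AE \<omega> in M. \<forall>n. h n \<omega> \<in> Aprod \<omega>"
    using programsD(4)[OF h] by (simp add: AE_all_countable)
  with lim programsD(4)[OF z] AE_space show ?thesis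
  proof eventually_elim
    case (elim \<omega>)
    have "(\<lambda>n. past t (h n \<omega>)) \<longlonglongrightarrow> past t (z \<omega>)"
    proof (rule vec_tendstoI)
      fix i show "(\<lambda>n. past t (h n \<omega>) $ i) \<longlonglongrightarrow> past t (z \<omega>) $ i"
        using tendsto_vec_nth[OF elim(1), of i] by (simp add: past_def)
    qed
    then show ?case
      unfolding constr_def
      using past_Aupto[OF elim(2)] past_Aupto[OF elim(4)[rule_format]] elim(3)
      by (intro continuous_on_tendsto_compose[OF g_continuous]) auto
  qed
qed

lemma constr_L1_limit:
  assumes h: "\<And>n::nat. h n \<in> programs" and z: "z \<in> programs" and lim: "AE \<omega> in M. (\<lambda>n. h n \<omega>) \<longlonglongrightarrow> z \<omega>"
  shows "(\<lambda>n. expectation (\<lambda>\<omega>. norm (constr t z \<omega> - constr t (h n) \<omega>))) \<longlonglongrightarrow> 0"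
proof -
  have "(\<lambda>n. expectation (\<lambda>\<omega>. norm (constr t z \<omega> - constr t (h n) \<omega>))) \<longlonglongrightarrow> expectation (\<lambda>\<omega>. 0)"
  proof (rule integral_dominated_convergence[where w = "\<lambda>_. 2 * bound"])
    show "AE \<omega> in M. (\<lambda>n. norm (constr t z \<omega> - constr t (h n) \<omega>)) \<longlonglongrightarrow> 0"
      using constr_tendsto[OF assms, of t]
    proof eventually_elim
      case (elim \<omega>)
      have "(\<lambda>n. norm (constr t z \<omega> - constr t (h n) \<omega>)) \<longlonglongrightarrow> norm (constr t z \<omega> - constr t z \<omega>)"
        by (intro tendsto_intros elim)
      then show ?case
        by simp
    qed
    show "AE \<omega> in M. norm (norm (constr t z \<omega> - constr t (h n) \<omega>)) \<le> 2 * bound" for n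
      using AE_space
    proof eventually_elim
      case (elim \<omega>)
      then show ?case
        using norm_triangle_ineq4[of "constr t z \<omega>" "constr t (h n) \<omega>"] constr_bound[OF z elim, of t]
          constr_bound[OF h elim, of t n] by simp
    qed
  qed (use constr_measurable[OF h] constr_measurable[OF z] in auto)
  then show ?thesis
    by simp
qed

text \<open>Almost sure convergence alone does not pass through \<open>vec_cond_exp\<close>, but L^1
  convergence does, and bounded programs that converge almost surely converge in L^1.\<close>

lemma deviation_lipschitz:
  assumes x: "x \<in> programs" and y: "y \<in> programs"
  shows "expectation (\<lambda>\<omega>. norm (deviation t x \<omega>))
    \<le> expectation (\<lambda>\<omega>. norm (deviation t y \<omega>)) + (1 + real DIM('c)) * expectation (\<lambda>\<omega>. norm (x \<omega> $ t - y \<omega> $ t))"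
proof -
  let ?d = "\<lambda>\<omega>. 1 *\<^sub>R x \<omega> $ t + (- 1) *\<^sub>R y \<omega> $ t"
  have i: "integrable M ?d"
    using integrable_program[OF x, of t] integrable_program[OF y, of t] by simp
  have "expectation (\<lambda>\<omega>. norm (deviation t x \<omega>))
      \<le> expectation (\<lambda>\<omega>. norm (deviation t y \<omega>) + norm (?d \<omega>) + norm (vec_cond_exp M (G t) ?d \<omega>))"
  proof (rule integral_mono_AE)
    show "AE \<omega> in M. norm (deviation t x \<omega>) \<le> norm (deviation t y \<omega>) + norm (?d \<omega>) + norm (vec_cond_exp M (G t) ?d \<omega>)"
      using vec_cond_exp_lin[OF subalgebra_G integrable_program[OF x] integrable_program[OF y], of t 1 t "-1" t]
    proof eventually_elim
      case (elim \<omega>)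
      have eq: "deviation t x \<omega> = deviation t y \<omega> + ?d \<omega> - vec_cond_exp M (G t) ?d \<omega>"
        unfolding elim by (simp add: deviation_def)
      show ?case
        unfolding eq
        using norm_triangle_ineq4[of "deviation t y \<omega> + ?d \<omega>" "vec_cond_exp M (G t) ?d \<omega>"]
          norm_triangle_ineq[of "deviation t y \<omega>" "?d \<omega>"] by linarith
    qed
  qed (use integrable_deviation[OF x, of t] integrable_deviation[OF y, of t] i
      integrable_vec_cond_exp[OF subalgebra_G i, of t] in auto)
  also have "\<dots> = expectation (\<lambda>\<omega>. norm (deviation t y \<omega>)) + expectation (\<lambda>\<omega>. norm (?d \<omega>))
      + expectation (\<lambda>\<omega>. norm (vec_cond_exp M (G t) ?d \<omega>))"
    using integrable_norm[OF integrable_deviation[OF y, of t]] integrable_norm[OF i]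
      integrable_norm[OF integrable_vec_cond_exp[OF subalgebra_G i, of t]] by simp
  also have "\<dots> \<le> expectation (\<lambda>\<omega>. norm (deviation t y \<omega>)) + expectation (\<lambda>\<omega>. norm (?d \<omega>))
      + real DIM('c) * expectation (\<lambda>\<omega>. norm (?d \<omega>))"
    using expectation_norm_vec_cond_exp_le[OF subalgebra_G i, of t] by simp
  finally show ?thesis
    by (simp add: algebra_simps)
qed

lemma violation_lipschitz:
  assumes x: "x \<in> programs" and y: "y \<in> programs" and b: "b \<in> J t"
  shows "expectation (violation t b x) \<le> expectation (violation t b y)
    + real DIM('d) * expectation (\<lambda>\<omega>. norm (constr t x \<omega> - constr t y \<omega>))"
proof -
  let ?d = "\<lambda>\<omega>. 1 *\<^sub>R constr t x \<omega> + (- 1) *\<^sub>R constr t y \<omega>"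
  have i: "integrable M ?d"
    using integrable_constr[OF x, of t] integrable_constr[OF y, of t] by simp
  have bB: "b \<in> Basis"
    using b J_subset by auto
  have "expectation (violation t b x)
      \<le> expectation (\<lambda>\<omega>. violation t b y \<omega> + norm (vec_cond_exp M (G t) ?d \<omega>))"
  proof (rule integral_mono_AE)
    show "AE \<omega> in M. violation t b x \<omega> \<le> violation t b y \<omega> + norm (vec_cond_exp M (G t) ?d \<omega>)"
      using vec_cond_exp_lin[OF subalgebra_G integrable_constr[OF x] integrable_constr[OF y], of t 1 t "-1" t]
    proof eventually_elim
      case (elim \<omega>)
      have eq: "cond_constr t x \<omega> \<bullet> b = cond_constr t y \<omega> \<bullet> b + vec_cond_exp M (G t) ?d \<omega> \<bullet> b"
        unfolding elim by (simp add: cond_constr_def inner_diff_left)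
      show ?case
        unfolding violation_def eq
        using Basis_le_norm[OF bB, of "vec_cond_exp M (G t) ?d \<omega>"] by linarith
    qed
  qed (use integrable_violation[OF x b] integrable_violation[OF y b]
      integrable_norm[OF integrable_vec_cond_exp[OF subalgebra_G i, of t]] in auto)
  also have "\<dots> = expectation (violation t b y) + expectation (\<lambda>\<omega>. norm (vec_cond_exp M (G t) ?d \<omega>))"
    using integrable_violation[OF y b] integrable_norm[OF integrable_vec_cond_exp[OF subalgebra_G i, of t]] by simp
  also have "\<dots> \<le> expectation (violation t b y) + real DIM('d) * expectation (\<lambda>\<omega>. norm (?d \<omega>))"
    using expectation_norm_vec_cond_exp_le[OF subalgebra_G i, of t] by simp
  finally show ?thesis
    by simp
qed

lemma integrable_program_vec: "x \<in> programs \<Longrightarrow> integrable M x"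
  and expectation_norm_program_le: "x \<in> programs \<Longrightarrow> expectation (\<lambda>\<omega>. norm (x \<omega>)) \<le> real CARD('b) * bound"
proof -
  assume x: "x \<in> programs"
  have "AE \<omega> in M. \<forall>t\<in>UNIV. norm (x \<omega> $ t) \<le> bound"
    using program_bound[OF x] by (intro AE_ball_countable[THEN iffD2]) (auto intro: countable_finite)
  then have le: "AE \<omega> in M. norm (x \<omega>) \<le> real CARD('b) * bound"
  proof eventually_elim
    case (elim \<omega>)
    have "(\<Sum>t\<in>UNIV. norm (x \<omega> $ t)) \<le> (\<Sum>t\<in>(UNIV::'b set). bound)"
      using elim by (intro sum_mono) auto
    then show ?case
      using norm_vec_le_sum[of "x \<omega>"] by simp
  qed
  show i: "integrable M x"
    by (rule integrable_const_bound[OF le programsD(5)[OF x]])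
  show "expectation (\<lambda>\<omega>. norm (x \<omega>)) \<le> real CARD('b) * bound"
    using integral_mono_AE[OF integrable_norm[OF i] integrable_const le] by (simp add: prob_space)
qed

text \<open>The penalty bound makes the deviations and violations of \<open>h n\<close> at most
  \<open>sqrt (1 / real (Suc n))\<close> in L^1, and the Lipschitz bounds transfer this to the
  limit.\<close>

lemma zero_penalty_limit:
  assumes h: "\<And>n::nat. h n \<in> programs" and z: "z \<in> programs" and lim: "AE \<omega> in M. (\<lambda>n. h n \<omega>) \<longlonglongrightarrow> z \<omega>"
    and pen: "\<And>n. penalty S (h n) \<le> 1 / real (Suc n)"
  shows "AE \<omega> in M. deviation t z \<omega> = 0" and "t \<in> S \<Longrightarrow> b \<in> J t \<Longrightarrow> AE \<omega> in M. violation t b z \<omega> = 0"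
proof -
  have sq0: "(\<lambda>n. sqrt (1 / real (Suc n))) \<longlonglongrightarrow> 0"
    using tendsto_real_sqrt[OF LIMSEQ_Suc[OF lim_1_over_n]] by simp
  have sq: "(sqrt (1 / real (Suc n)))\<^sup>2 = 1 / real (Suc n)" for n
    by simp
  have "expectation (\<lambda>\<omega>. norm (deviation t z \<omega>)) \<le> 0"
  proof (rule LIMSEQ_le_const)
    show "(\<lambda>n. sqrt (1 / real (Suc n)) + (1 + real DIM('c)) * expectation (\<lambda>\<omega>. norm (z \<omega> $ t - h n \<omega> $ t))) \<longlonglongrightarrow> 0"
      using tendsto_add[OF sq0 tendsto_mult_left[OF program_L1_limit[OF h z lim]]] by simp
    have "expectation (\<lambda>\<omega>. \<bar>norm (deviation t (h n) \<omega>)\<bar>) \<le> sqrt (1 / real (Suc n))" for n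
    proof (rule integral_abs_le_sqrt)
      show "expectation (\<lambda>\<omega>. (norm (deviation t (h n) \<omega>))\<^sup>2) \<le> (sqrt (1 / real (Suc n)))\<^sup>2"
        unfolding sq by (rule order_trans[OF deviation_square_le_penalty pen])
    qed (use integrable_deviation[OF h] integrable_deviation_square[OF h] in auto)
    then show "\<exists>N. \<forall>n\<ge>N. expectation (\<lambda>\<omega>. norm (deviation t z \<omega>))
        \<le> sqrt (1 / real (Suc n)) + (1 + real DIM('c)) * expectation (\<lambda>\<omega>. norm (z \<omega> $ t - h n \<omega> $ t))"
      using deviation_lipschitz[OF z h, of t] by (intro exI[of _ 0] allI impI) (smt (verit) abs_norm_cancel
          Bochner_Integration.integral_cong)
  qed
  then have "expectation (\<lambda>\<omega>. norm (deviation t z \<omega>)) = 0"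
    by (simp add: antisym)
  then show "AE \<omega> in M. deviation t z \<omega> = 0"
    using integral_nonneg_eq_0_iff_AE[OF integrable_norm[OF integrable_deviation[OF z, of t]]] by auto
next
  assume tb: "t \<in> S" "b \<in> J t"
  have sq0: "(\<lambda>n. sqrt (1 / real (Suc n))) \<longlonglongrightarrow> 0"
    using tendsto_real_sqrt[OF LIMSEQ_Suc[OF lim_1_over_n]] by simp
  have sq: "(sqrt (1 / real (Suc n)))\<^sup>2 = 1 / real (Suc n)" for n
    by simp
  have nn: "0 \<le> violation t b y \<omega>" for y \<omega>
    by (simp add: violation_def)
  have "expectation (violation t b z) \<le> 0"
  proof (rule LIMSEQ_le_const)
    show "(\<lambda>n. sqrt (1 / real (Suc n)) + real DIM('d) * expectation (\<lambda>\<omega>. norm (constr t z \<omega> - constr t (h n) \<omega>))) \<longlonglongrightarrow> 0"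
      using tendsto_add[OF sq0 tendsto_mult_left[OF constr_L1_limit[OF h z lim]]] by simp
    have "expectation (\<lambda>\<omega>. \<bar>violation t b (h n) \<omega>\<bar>) \<le> sqrt (1 / real (Suc n))" for n
    proof (rule integral_abs_le_sqrt)
      show "expectation (\<lambda>\<omega>. (violation t b (h n) \<omega>)\<^sup>2) \<le> (sqrt (1 / real (Suc n)))\<^sup>2"
        unfolding sq by (rule order_trans[OF violation_square_le_penalty[OF tb] pen])
    qed (use integrable_violation[OF h tb(2)] integrable_violation_square[OF h tb(2)] in auto)
    then have "expectation (violation t b (h n)) \<le> sqrt (1 / real (Suc n))" for n
      using nn by simp
    then show "\<exists>N. \<forall>n\<ge>N. expectation (violation t b z)
        \<le> sqrt (1 / real (Suc n)) + real DIM('d) * expectation (\<lambda>\<omega>. norm (constr t z \<omega> - constr t (h n) \<omega>))"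
      using violation_lipschitz[OF z h tb(2)] by (intro exI[of _ 0] allI impI) (meson add_mono order_refl order_trans)
  qed
  moreover have "0 \<le> expectation (violation t b z)"
    using nn by simp
  ultimately have "expectation (violation t b z) = 0"
    by simp
  then show "AE \<omega> in M. violation t b z \<omega> = 0"
    using integral_nonneg_eq_0_iff_AE[OF integrable_violation[OF z tb(2)]] nn by auto
qed

text \<open>A vanishing deviation says that each component equals its conditional expectation almost
  surely, and the latter is measurable in \<open>G t\<close>. A new version is taken because
  \<open>G t\<close> need not contain the null sets of \<open>M\<close>.\<close>

lemma adapted_version:
  assumes z: "z \<in> programs" and deviation: "\<And>t. AE \<omega> in M. deviation t z \<omega> = 0"
  obtains x where "x \<in> adapted_programs" and "AE \<omega> in M. x \<omega> = z \<omega>"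
proof -
  define e where "e t = vec_cond_exp M (G t) (\<lambda>\<omega>. z \<omega> $ t)" for t
  define x where "x \<omega> = (\<chi> t. if e t \<omega> \<in> V t then e t \<omega> else 0)" for \<omega>
  have emeas: "e t \<in> borel_measurable (G t)" for t
    unfolding e_def by (rule vec_cond_exp_measurable[OF subalgebra_G])
  have "closed (V t)" for t
    by (rule closed_subspace[OF subspace_V])
  then have xmeas: "(\<lambda>\<omega>. x \<omega> $ t) \<in> borel_measurable (G t)" for t
    unfolding x_def vec_lambda_beta by (rule measurable_If_closed[OF _ emeas])
  have "AE \<omega> in M. \<forall>t\<in>UNIV. deviation t z \<omega> = 0"
    using deviation by (intro AE_ball_countable[THEN iffD2]) (auto intro: countable_finite)
  then have xz: "AE \<omega> in M. x \<omega> = z \<omega>"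
    using AE_space
  proof eventually_elim
    case (elim \<omega>)
    then have "e t \<omega> = z \<omega> $ t" for t
      by (simp add: e_def deviation_def)
    then show ?case
      using programsD(3)[OF z elim(2)] by (simp add: x_def vec_eq_iff)
  qed
  have "x \<in> programs"
  proof (rule programsI)
    show "x \<omega> $ t \<in> V t" for \<omega> t
      using subspace_0[OF subspace_V] by (simp add: x_def)
    show "AE \<omega> in M. x \<omega> \<in> Aprod \<omega>"
      using xz programsD(4)[OF z] by eventually_elim simp
  qed (rule measurable_G[OF xmeas])
  then have "x \<in> adapted_programs"
    using xmeas by (simp add: adapted_programs_def)
  then show ?thesis
    using that xz by blast
qed

text \<open>The value is stable under relaxation of the constraints. Otherwise the programs with
  penalty at most \<open>1 / real (Suc n)\<close> and value at least \<open>v + \<epsilon>\<close>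
  form nonempty decreasing sets closed under midpoints; an almost sure limit of such programs has an
  adapted version that meets the constraints, and continuity of the objective contradicts
  optimality.\<close>

lemma obj_le_of_small_penalty:
  assumes f: "integrand f"
    and opt: "\<And>x. x \<in> adapted_programs \<Longrightarrow> (\<And>t. t \<in> S \<Longrightarrow> satisfies_constraint t x) \<Longrightarrow> obj f x \<le> v"
    and \<epsilon>: "0 < \<epsilon>"
  obtains \<delta> where "0 < \<delta>" and "\<And>x. x \<in> programs \<Longrightarrow> penalty S x \<le> \<delta> \<Longrightarrow> obj f x \<le> v + \<epsilon>"
proof (rule ccontr)
  assume neg: "\<not> thesis"
  define C where "C n = {x \<in> programs. penalty S x \<le> 1 / real (Suc n) \<and> v + \<epsilon> \<le> obj f x}" for n
  have ne: "C n \<noteq> {}" for n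
  proof -
    have "\<exists>x\<in>programs. penalty S x \<le> 1 / real (Suc n) \<and> v + \<epsilon> < obj f x"
      using neg that[of "1 / real (Suc n)"] by (meson divide_pos_pos of_nat_0_less_iff not_le zero_less_Suc zero_less_one)
    then show ?thesis
      by (force simp: C_def)
  qed
  have dec: "C (Suc n) \<subseteq> C n" for n
  proof -
    have "1 / real (Suc (Suc n)) \<le> 1 / real (Suc n)"
      by (intro divide_left_mono) auto
    then show ?thesis
      by (auto simp: C_def)
  qed
  have mid: "(\<lambda>\<omega>. (1/2) *\<^sub>R (h \<omega> + k \<omega>)) \<in> C n" if "h \<in> C n" "k \<in> C n" for n h k
  proof -
    have hk: "h \<in> programs" "k \<in> programs"
      using that by (auto simp: C_def)
    have eq: "(\<lambda>\<omega>. (1/2) *\<^sub>R (h \<omega> + k \<omega>)) = (\<lambda>\<omega>. (1 - 1/2) *\<^sub>R h \<omega> + (1/2) *\<^sub>R k \<omega>)"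
      by (simp add: scaleR_add_right)
    have "(1 - 1/2) * obj f h + 1/2 * obj f k \<le> obj f (\<lambda>\<omega>. (1/2) *\<^sub>R (h \<omega> + k \<omega>))"
      unfolding eq by (rule obj_concave[OF f hk]) auto
    moreover have "(\<lambda>\<omega>. (1/2) *\<^sub>R (h \<omega> + k \<omega>)) \<in> programs"
      unfolding eq by (rule mix_program[OF hk]) auto
    ultimately show ?thesis
      using that penalty_midpoint[OF hk, of S "1 / real (Suc n)"] by (simp add: C_def)
  qed
  obtain h where hC: "\<And>n. h n \<in> C n" and conv: "AE \<omega> in M. convergent (\<lambda>n. h n \<omega>)"
    by (rule midpoint_closed_AE_convergent[of C "real CARD('b) * bound", OF ne dec mid])
      (auto simp: C_def intro: integrable_program_vec expectation_norm_program_le)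
  have h: "h n \<in> programs" "penalty S (h n) \<le> 1 / real (Suc n)" "v + \<epsilon> \<le> obj f (h n)" for n
    using hC[of n] by (auto simp: C_def)
  obtain z where z: "z \<in> programs" "AE \<omega> in M. (\<lambda>n. h n \<omega>) \<longlonglongrightarrow> z \<omega>"
    by (rule program_limit[of h, OF h(1) conv])
  obtain x where x: "x \<in> adapted_programs" "AE \<omega> in M. x \<omega> = z \<omega>"
    by (rule adapted_version[OF z(1) zero_penalty_limit(1)[of h, OF h(1) z h(2)]])
  have xP: "x \<in> programs"
    by (rule adapted_programsD(1)[OF x(1)])
  have lim: "AE \<omega> in M. (\<lambda>n. h n \<omega>) \<longlonglongrightarrow> x \<omega>"
    using z(2) x(2) by eventually_elim simp
  have "v + \<epsilon> \<le> obj f x"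
    by (rule LIMSEQ_le_const[OF integrandD(3)[OF f xP h(1) lim]]) (use h(3) in auto)
  moreover have "satisfies_constraint t x" if "t \<in> S" for t
  proof -
    have "AE \<omega> in M. \<forall>b\<in>J t. violation t b x \<omega> = 0"
      using zero_penalty_limit(2)[of h, OF h(1) xP lim h(2) that] finite_J
      by (intro AE_ball_countable[THEN iffD2]) (auto intro: countable_finite)
    with cond_constr_adapted[OF x(1), of t] show ?thesis
      unfolding satisfies_constraint_iff
      by eventually_elim (auto simp: le_W_def violation_def max_def split: if_splits)
  qed
  then have "obj f x \<le> v"
    by (rule opt[OF x(1)])
  ultimately show False
    using \<epsilon> by simp
qed

text \<open>A near maximiser \<open>x\<close> of the penalised objective is compared with points on
  the segment towards an arbitrary program \<open>y\<close>. The first-order condition reads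
  \<open>obj f y - k * B y \<le> v + \<epsilon>\<close>, and its left side is the expected
  Lagrangian of \<open>y\<close> for the scaled violations of \<open>x\<close>.\<close>

lemma approximate_multipliers:
  assumes f: "integrand f"
    and opt: "\<And>x. x \<in> adapted_programs \<Longrightarrow> (\<And>t. t \<in> S \<Longrightarrow> satisfies_constraint t x) \<Longrightarrow> obj f x \<le> v"
    and xb: "xb \<in> adapted_programs" "\<And>t. t \<in> S \<Longrightarrow> satisfies_constraint t xb" "obj f xb = v"
    and \<epsilon>: "0 < \<epsilon>"
  obtains p q where "multipliers S p q" and "\<And>t. orthogonal_to (G t) (q t)" and "\<And>t \<omega>. q t \<omega> \<in> V t"
    and "\<And>x. x \<in> programs \<Longrightarrow> expectation (\<lambda>\<omega>. lag f p q \<omega> (x \<omega>)) \<le> v + \<epsilon>"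
proof -
  obtain \<delta> where \<delta>: "0 < \<delta>" "\<And>x. x \<in> programs \<Longrightarrow> penalty S x \<le> \<delta> \<Longrightarrow> obj f x \<le> v + \<epsilon> / 2"
    by (rule obj_le_of_small_penalty[OF f opt, of S "\<epsilon> / 2"]) (use \<epsilon> in auto)
  define c where "c = (\<Sum>t\<in>(UNIV::'b set). (2 * deviation_bound)\<^sup>2) + (\<Sum>t\<in>S. \<Sum>b\<in>J t. (2 * cond_constr_bound)\<^sup>2)"
  define D where "D = expectation (dom f)"
  have c: "0 \<le> c"
    unfolding c_def by (intro add_nonneg_nonneg sum_nonneg) auto
  have D: "\<bar>obj f x\<bar> \<le> D" if "x \<in> programs" for x
    unfolding D_def by (rule obj_le[OF f that])
  have xbP: "xb \<in> programs"
    by (rule adapted_programsD(1)[OF xb(1)])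
  have D0: "0 \<le> D"
    using D[OF xbP] by linarith
  \<comment> \<open>The three terms ensure in turn \<open>k \<ge> 1\<close>, a penalty of at most
    \<open>\<delta>\<close> at the near maximiser (where \<open>k\<close> times the penalty is at
    most \<open>4 * D + 2\<close>), and an error of at most \<open>\<epsilon> / 2\<close> in the
    first-order condition.\<close>
  define k where "k = 1 + (4 * D + 2) / \<delta> + (2 + c) / \<epsilon>"
  have k: "1 \<le> k" "(4 * D + 2) / \<delta> \<le> k" "(2 + c) / \<epsilon> \<le> k"
    using D0 c \<epsilon> \<delta>(1) by (auto simp: k_def)
  \<comment> \<open>With this step length the remainder \<open>k * u * c / 2\<close> is of order
    \<open>1 / k\<close>, although the penalty carries the weight \<open>k\<close>. The maximum is
    attained up to \<open>u\<^sup>2\<close>, which leaves \<open>u\<close> after division by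
    \<open>u\<close>.\<close>
  define u where "u = 1 / k\<^sup>2"
  have u: "0 < u" "u \<le> 1" "k * u = 1 / k"
    using k(1) one_le_power[OF k(1), of 2] by (auto simp: u_def power2_eq_square)
  define \<Psi> where "\<Psi> x = obj f x - k / 2 * penalty S x" for x
  have bdd: "bdd_above (\<Psi> ` programs)"
  proof (rule bdd_aboveI2)
    fix x assume "x \<in> programs"
    moreover have "0 \<le> k / 2 * penalty S x"
      using penalty_nonneg[of S x] k(1) by simp
    ultimately show "\<Psi> x \<le> D"
      using D[of x] unfolding \<Psi>_def by linarith
  qed
  have "\<exists>x\<in>programs. Sup (\<Psi> ` programs) - u\<^sup>2 < \<Psi> x"
    using less_cSup_iff[OF _ bdd, of "Sup (\<Psi> ` programs) - u\<^sup>2"] xbP u(1) by auto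
  then obtain x where x: "x \<in> programs" and supx: "Sup (\<Psi> ` programs) - u\<^sup>2 < \<Psi> x"
    by blast
  have xmax: "\<Psi> y \<le> \<Psi> x + u\<^sup>2" if "y \<in> programs" for y
    using cSup_upper[OF imageI[OF that] bdd] supx by linarith
  have usq: "u\<^sup>2 \<le> u"
    using u by (simp add: power2_eq_square mult_left_le)
  have "penalty S x \<le> \<delta>"
  proof -
    have "v \<le> obj f x - k / 2 * penalty S x + 1"
      using xmax[OF xbP] penalty_feasible[OF xb(1,2)] xb(3) usq u(2) by (simp add: \<Psi>_def)
    then have "k * penalty S x \<le> 4 * D + 2"
      using D[OF x] D[OF xbP] xb(3) by (simp add: abs_le_iff)
    also have "\<dots> \<le> k * \<delta>"
      using k(2) \<delta>(1) by (simp add: divide_le_eq)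
    finally show ?thesis
      using k(1) by simp
  qed
  then have objx: "obj f x \<le> v + \<epsilon> / 2"
    by (rule \<delta>(2)[OF x])
  \<comment> \<open>In the bound for the penalty on the segment, half the slope at \<open>x\<close>
    is \<open>B y - penalty S x\<close>; \<open>B y\<close> is the part that depends on
    \<open>y\<close>.\<close>
  define B where "B y = (\<Sum>t\<in>UNIV. expectation (\<lambda>\<omega>. deviation t x \<omega> \<bullet> deviation t y \<omega>))
    - (\<Sum>t\<in>S. \<Sum>b\<in>J t. expectation (\<lambda>\<omega>. violation t b x \<omega> * (cond_constr t y \<omega> \<bullet> b)))" for y
  have main: "obj f y - k * B y \<le> v + \<epsilon>" if y: "y \<in> programs" for y
  proof -
    let ?w = "\<lambda>\<omega>. (1 - u) *\<^sub>R x \<omega> + u *\<^sub>R y \<omega>"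
    have "penalty S ?w \<le> (\<Sum>t\<in>UNIV. expectation (\<lambda>\<omega>. (norm (deviation t x \<omega>))\<^sup>2)
          + 2 * u * (expectation (\<lambda>\<omega>. deviation t x \<omega> \<bullet> deviation t y \<omega>) - expectation (\<lambda>\<omega>. (norm (deviation t x \<omega>))\<^sup>2))
          + u\<^sup>2 * (2 * deviation_bound)\<^sup>2)
        + (\<Sum>t\<in>S. \<Sum>b\<in>J t. expectation (\<lambda>\<omega>. (violation t b x \<omega>)\<^sup>2)
          + 2 * u * (- expectation (\<lambda>\<omega>. violation t b x \<omega> * (cond_constr t y \<omega> \<bullet> b)) - expectation (\<lambda>\<omega>. (violation t b x \<omega>)\<^sup>2))
          + u\<^sup>2 * (2 * cond_constr_bound)\<^sup>2)"
      unfolding penalty_def using u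
      by (intro add_mono sum_mono deviation_square_mix_quadratic violation_square_mix_quadratic x y) auto
    also have "\<dots> = penalty S x + 2 * u * (B y - penalty S x) + u\<^sup>2 * c"
      by (simp add: penalty_def B_def c_def sum.distrib sum_subtractf sum_distrib_left[symmetric] sum_negf algebra_simps)
        (simp add: sum_distrib_left algebra_simps)
    finally have pen: "penalty S ?w \<le> penalty S x + 2 * u * (B y - penalty S x) + u\<^sup>2 * c" .
    have wP: "?w \<in> programs"
      by (rule mix_program[OF x y]) (use u in auto)
    have "(1 - u) * obj f x + u * obj f y \<le> obj f ?w"
      by (rule obj_concave[OF f x y]) (use u in auto)
    also have "\<dots> = \<Psi> ?w + k / 2 * penalty S ?w"
      by (simp add: \<Psi>_def)
    also have "\<dots> \<le> \<Psi> x + u\<^sup>2 + k / 2 * (penalty S x + 2 * u * (B y - penalty S x) + u\<^sup>2 * c)"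
      using xmax[OF wP] pen k(1) by (intro add_mono mult_left_mono) auto
    also have "\<dots> = obj f x + u\<^sup>2 + k * u * (B y - penalty S x) + k * u\<^sup>2 * c / 2"
      by (simp add: \<Psi>_def algebra_simps)
    finally have "u * (obj f y - obj f x - k * (B y - penalty S x)) \<le> u * (u + k * u * c / 2)"
      by (simp add: algebra_simps power2_eq_square)
    then have "obj f y - obj f x - k * (B y - penalty S x) \<le> u + k * u * c / 2"
      using u(1) by simp
    moreover have "k * (B y - penalty S x) \<le> k * B y"
      using penalty_nonneg[of S x] k(1) by (intro mult_left_mono) auto
    moreover have "u + k * u * c / 2 \<le> \<epsilon> / 2"
    proof -
      have "u \<le> 1 / k"
        using k(1) by (simp add: u_def power2_eq_square divide_le_eq field_simps)
      then have "u + k * u * c / 2 \<le> 1 / k + 1 / k * c / 2"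
        unfolding u(3) by simp
      also have "\<dots> = ((2 + c) / 2) / k"
        by (simp add: add_divide_distrib)
      also have "\<dots> \<le> \<epsilon> / 2"
        using k(1,3) \<epsilon> by (simp add: divide_le_eq mult.commute)
      finally show ?thesis .
    qed
    ultimately show ?thesis
      using objx by linarith
  qed
  have "\<exists>P. bounded_linear P \<and> (\<forall>v. P v \<in> V t) \<and> (\<forall>v\<in>V t. P v = v) \<and> (\<forall>v w. P v \<bullet> w = v \<bullet> P w)" for t
    by (rule linear_retraction_exists[OF subspace_V, of t]) blast
  then obtain P where P: "\<And>t. bounded_linear (P t)" "\<And>t v. P t v \<in> V t" "\<And>t v. v \<in> V t \<Longrightarrow> P t v = v"
      "\<And>t v w. P t v \<bullet> w = v \<bullet> P t w"
    by metis
  \<comment> \<open>The conditional expectation in the deviation need not lie in \<open>V t\<close>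
    at every point; projecting puts \<open>q\<close> there everywhere.\<close>
  define q where "q t \<omega> = P t ((- k) *\<^sub>R deviation t x \<omega>)" for t \<omega>
  define p where "p t \<omega> = (if t \<in> S then k *\<^sub>R (\<Sum>b\<in>J t. violation t b x \<omega> *\<^sub>R b) else 0)" for t \<omega>
  have orth_deviation: "orthogonal_to (G t) (deviation t x)" for t
    unfolding deviation_def by (rule orthogonal_to_diff_vec_cond_exp[OF subalgebra_G integrable_program[OF x]])
  show ?thesis
  proof (rule that)
    have pi: "integrable M (p t)" for t
      unfolding p_def using integrable_violation[OF x, of _ t] by (cases "t \<in> S") auto
    have qi: "integrable M (q t)" for t
      unfolding q_def using integrable_deviation[OF x, of t]
      by (intro integrable_bounded_linear[OF P(1)]) auto
    show m: "multipliers S p q"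
      unfolding multipliers_def
    proof (intro conjI allI ballI impI pi qi)
      fix t
      have "p t = (\<lambda>\<omega>. if t \<in> S then k *\<^sub>R (\<Sum>b\<in>J t. violation t b x \<omega> *\<^sub>R b) else 0)"
        by (simp add: p_def fun_eq_iff)
      then show "p t \<in> borel_measurable (G t)"
        using violation_measurable_G[of t _ x] by (cases "t \<in> S") auto
      fix \<omega>
      show "p t \<omega> \<in> W t"
        unfolding p_def using subspace_0[OF subspace_W]
        by (auto intro!: subspace_scale subspace_sum subspace_W simp: W_def span_base)
      have "0 \<le> p t \<omega> \<bullet> b" if "b \<in> J t" for b
      proof -
        have "c \<bullet> b = (if c = b then 1 else 0)" if "c \<in> J t" for c
          using that \<open>b \<in> J t\<close> J_subset[of t] by (auto simp: inner_Basis subset_iff)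
        then have "(\<Sum>c\<in>J t. violation t c x \<omega> * (c \<bullet> b)) = (\<Sum>c\<in>J t. if c = b then violation t c x \<omega> else 0)"
          by (intro sum.cong) auto
        then show ?thesis
          using k(1) that finite_J by (simp add: p_def inner_sum_left violation_def)
      qed
      then show "le_W t 0 (p t \<omega>)"
        by (simp add: le_W_def)
    qed (simp add: p_def)
    show "orthogonal_to (G t) (q t)" for t
    proof -
      have "orthogonal_to (G t) (\<lambda>\<omega>. (- k) *\<^sub>R deviation t x \<omega>)"
        using orthogonal_to_lin[OF subalgebra_G integrable_deviation[OF x] integrable_deviation[OF x] orth_deviation orth_deviation, where a = "- k" and b = 0]
        by simp
      then show ?thesis
        unfolding q_def[abs_def] by (rule orthogonal_to_retraction[OF P(1,4)])
    qed
    show "q t \<omega> \<in> V t" for t \<omega>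
      by (simp add: q_def P(2))
    fix y assume y: "y \<in> programs"
    \<comment> \<open>The Lagrangian contains \<open>y\<close> itself instead of its deviation; the
      difference is bounded and measurable in \<open>G t\<close>, hence annihilated by
      \<open>deviation t x\<close>.\<close>
    have "expectation (\<lambda>\<omega>. q t \<omega> \<bullet> y \<omega> $ t) = - k * expectation (\<lambda>\<omega>. deviation t x \<omega> \<bullet> deviation t y \<omega>)" for t
    proof -
      have yv: "AE \<omega> in M. norm (vec_cond_exp M (G t) (\<lambda>\<omega>. y \<omega> $ t) \<omega>) \<le> real DIM('c) * bound"
        by (rule norm_vec_cond_exp_bounded[OF subalgebra_G programsD(1)[OF y] program_bound[OF y]])
      have 0: "expectation (\<lambda>\<omega>. deviation t x \<omega> \<bullet> vec_cond_exp M (G t) (\<lambda>\<omega>. y \<omega> $ t) \<omega>) = 0"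
        by (rule orthogonal_toD[OF orth_deviation vec_cond_exp_measurable[OF subalgebra_G] yv])
      have i1: "integrable M (\<lambda>\<omega>. deviation t x \<omega> \<bullet> vec_cond_exp M (G t) (\<lambda>\<omega>. y \<omega> $ t) \<omega>)"
        by (rule integrable_inner_AE_bounded(2)[OF integrable_deviation[OF x]
              measurable_G[OF vec_cond_exp_measurable[OF subalgebra_G]] yv])
      have i2: "integrable M (\<lambda>\<omega>. deviation t x \<omega> \<bullet> y \<omega> $ t)"
        by (rule integrable_inner_AE_bounded(2)[OF integrable_deviation[OF x] programsD(1)[OF y] program_bound[OF y]])
      have "expectation (\<lambda>\<omega>. deviation t x \<omega> \<bullet> deviation t y \<omega>) = expectation (\<lambda>\<omega>. deviation t x \<omega> \<bullet> y \<omega> $ t)"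
        unfolding deviation_def[of t y] using i1 i2 0 by (simp add: inner_diff_right)
      moreover have "expectation (\<lambda>\<omega>. q t \<omega> \<bullet> y \<omega> $ t) = expectation (\<lambda>\<omega>. - k * (deviation t x \<omega> \<bullet> y \<omega> $ t))"
        using programsD(3)[OF y] by (intro Bochner_Integration.integral_cong) (auto simp: q_def P(3,4))
      ultimately show ?thesis
        by simp
    qed
    moreover have "expectation (\<lambda>\<omega>. p t \<omega> \<bullet> constr t y \<omega>)
        = k * (\<Sum>b\<in>J t. expectation (\<lambda>\<omega>. violation t b x \<omega> * (cond_constr t y \<omega> \<bullet> b)))" if "t \<in> S" for t
    proof -
      have pb: "AE \<omega> in M. norm (p t \<omega>) \<le> k * (\<Sum>b\<in>J t. cond_constr_bound)"
      proof -
        have "AE \<omega> in M. \<forall>b\<in>J t. \<bar>violation t b x \<omega>\<bar> \<le> cond_constr_bound"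
          using violation_le[OF x] finite_J by (intro AE_ball_countable[THEN iffD2]) (auto intro: countable_finite)
        then show ?thesis
        proof eventually_elim
          case (elim \<omega>)
          have "norm (violation t b x \<omega> *\<^sub>R b) \<le> cond_constr_bound" if "b \<in> J t" for b
            using elim that J_subset[of t] by (auto simp: subset_iff)
          then have "norm (\<Sum>b\<in>J t. violation t b x \<omega> *\<^sub>R b) \<le> (\<Sum>b\<in>J t. cond_constr_bound)"
            by (rule sum_norm_le)
          then show ?case
            using k(1) \<open>t \<in> S\<close> by (simp add: p_def mult_left_mono)
        qed
      qed
      have "expectation (\<lambda>\<omega>. p t \<omega> \<bullet> constr t y \<omega>) = expectation (\<lambda>\<omega>. p t \<omega> \<bullet> cond_constr t y \<omega>)"
        unfolding cond_constr_def
        by (rule vec_cond_exp_inner[OF subalgebra_G integrable_constr[OF y] multipliersD(1)[OF m] pb, symmetric])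
      also have "\<dots> = expectation (\<lambda>\<omega>. k * (\<Sum>b\<in>J t. violation t b x \<omega> * (cond_constr t y \<omega> \<bullet> b)))"
        using that by (simp add: p_def inner_commute[of _ "cond_constr t y _"] inner_sum_right)
      also have "\<dots> = k * (\<Sum>b\<in>J t. expectation (\<lambda>\<omega>. violation t b x \<omega> * (cond_constr t y \<omega> \<bullet> b)))"
        using integrable_violation_cond_constr[OF x y] by simp
      finally show ?thesis .
    qed
    moreover have "(\<Sum>t\<in>UNIV. expectation (\<lambda>\<omega>. p t \<omega> \<bullet> constr t y \<omega>))
        = (\<Sum>t\<in>S. expectation (\<lambda>\<omega>. p t \<omega> \<bullet> constr t y \<omega>))"
      by (rule sum.mono_neutral_right) (auto simp: p_def)
    ultimately show "expectation (\<lambda>\<omega>. lag f p q \<omega> (y \<omega>)) \<le> v + \<epsilon>"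
      using main[OF y] unfolding expectation_lag[OF f m y]
      by (simp add: B_def sum_distrib_left[symmetric] sum_negf algebra_simps)
  qed
qed

subsection \<open>Convergence of approximate multipliers\<close>

lemma norm_W_le_sum:
  assumes "w \<in> W t" "le_W t 0 w"
  shows "norm w \<le> (\<Sum>b\<in>J t. w \<bullet> b)"
proof -
  have "norm w \<le> (\<Sum>b\<in>Basis. \<bar>w \<bullet> b\<bar>)"
    by (rule norm_le_l1)
  also have "\<dots> = (\<Sum>b\<in>J t. \<bar>w \<bullet> b\<bar>)"
    using assms(1) J_subset by (intro sum.mono_neutral_right) (auto simp: W_iff)
  also have "\<dots> = (\<Sum>b\<in>J t. w \<bullet> b)"
    using assms(2) by (intro sum.cong) (auto simp: le_W_def)
  finally show ?thesis .
qed

text \<open>The strictly feasible program is adapted, so \<open>q\<close> does not see it, and its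
  Lagrangian bounds \<open>p\<close> in L^1. Then the interior program is moved by
  \<open>\<theta>\<close> in the direction of \<open>q\<close>, which bounds \<open>q\<close> in L^1
  in terms of the bound for \<open>p\<close>.\<close>

lemma multipliers_L1_bound:
  assumes f: "integrand f"
  obtains K where "\<forall>S p q. multipliers S p q \<and> (\<forall>t. orthogonal_to (G t) (q t)) \<and>
    (\<forall>t. \<forall>\<omega>\<in>space M. q t \<omega> \<in> V t) \<and>
    (\<forall>x\<in>programs. expectation (\<lambda>\<omega>. lag f p q \<omega> (x \<omega>)) \<le> v + 1) \<longrightarrow>
    (\<Sum>t\<in>UNIV. expectation (\<lambda>\<omega>. norm (p t \<omega>))) + (\<Sum>t\<in>UNIV. expectation (\<lambda>\<omega>. norm (q t \<omega>))) \<le> K"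
proof -
  obtain xh \<kappa> where xh: "xh \<in> adapted_programs" and \<kappa>: "\<And>t. less_W t 0 (\<kappa> t)"
      "\<And>t. AE \<omega> in M. le_W t (\<kappa> t) (constr t xh \<omega>)"
    using strictly_feasible_program unfolding constr_def by blast
  obtain xi \<theta> where xi: "xi \<in> adapted_programs" and \<theta>: "0 < \<theta>"
      "\<And>t \<omega>. \<omega> \<in> space M \<Longrightarrow> cball (xi \<omega> $ t) \<theta> \<inter> V t \<subseteq> A t \<omega>"
    using interior_program by blast
  have xhP: "xh \<in> programs" and xiP: "xi \<in> programs"
    using xh xi by (auto intro: adapted_programsD)
  \<comment> \<open>The element 1 keeps \<open>Z\<close> nonempty when all the sets
    \<open>J t\<close> are empty.\<close>
  define Z where "Z = insert 1 (\<Union>t\<in>UNIV. (\<lambda>b. \<kappa> t \<bullet> b) ` J t)"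
  have Z: "finite Z" "\<And>z. z \<in> Z \<Longrightarrow> 0 < z"
    using finite_J \<kappa>(1) by (auto simp: Z_def less_W_def)
  define m where "m = Min Z"
  have m: "0 < m" "\<And>t b. b \<in> J t \<Longrightarrow> m \<le> \<kappa> t \<bullet> b"
    using Z by (auto simp: m_def Z_def intro!: Min_le)
  define D where "D = expectation (dom f)"
  define K1 where "K1 = (v + 1 + D) / m"
  define K2 where "K2 = (v + 1 + D + bound * K1) / \<theta>"
  show ?thesis
  proof (rule that[of "K1 + K2"], intro allI impI, elim conjE)
    fix S p q
    assume mult: "multipliers S p q" and orth: "\<forall>t. orthogonal_to (G t) (q t)"
      and qV: "\<forall>t. \<forall>\<omega>\<in>space M. q t \<omega> \<in> V t"
      and "\<forall>x\<in>programs. expectation (\<lambda>\<omega>. lag f p q \<omega> (x \<omega>)) \<le> v + 1"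
    then have le: "expectation (\<lambda>\<omega>. lag f p q \<omega> (x \<omega>)) \<le> v + 1" if "x \<in> programs" for x
      using that by blast
    note pm = multipliersD[OF mult]
    have qz: "expectation (\<lambda>\<omega>. q t \<omega> \<bullet> x \<omega> $ t) = 0" if "x \<in> adapted_programs" for x t
      by (rule orthogonal_toD[OF orth[rule_format] adapted_programsD(2)[OF that] program_bound[OF adapted_programsD(1)[OF that]]])
    have "m * expectation (\<lambda>\<omega>. norm (p t \<omega>)) \<le> expectation (\<lambda>\<omega>. p t \<omega> \<bullet> constr t xh \<omega>)" for t
    proof -
      have "expectation (\<lambda>\<omega>. m * norm (p t \<omega>)) \<le> expectation (\<lambda>\<omega>. p t \<omega> \<bullet> constr t xh \<omega>)"
      proof (rule integral_mono_AE)
        show "AE \<omega> in M. m * norm (p t \<omega>) \<le> p t \<omega> \<bullet> constr t xh \<omega>"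
          using \<kappa>(2)[of t] AE_space
        proof eventually_elim
          case (elim \<omega>)
          note w = pm(4,5)[OF elim(2), of t]
          have "m * norm (p t \<omega>) \<le> m * (\<Sum>b\<in>J t. p t \<omega> \<bullet> b)"
            using norm_W_le_sum[OF w] m(1) by simp
          also have "\<dots> = (\<Sum>b\<in>J t. (p t \<omega> \<bullet> b) * m)"
            by (simp add: sum_distrib_left mult.commute)
          also have "\<dots> \<le> (\<Sum>b\<in>J t. (p t \<omega> \<bullet> b) * (\<kappa> t \<bullet> b))"
            using m(2) w(2) by (intro sum_mono mult_left_mono) (auto simp: le_W_def)
          also have "\<dots> = p t \<omega> \<bullet> \<kappa> t"
            by (rule inner_W[OF w(1), symmetric])
          also have "\<dots> \<le> p t \<omega> \<bullet> constr t xh \<omega>"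
            by (rule inner_W_mono[OF w elim(1)])
          finally show ?case .
        qed
      qed (use pm(2) integrable_p_constr[OF mult xhP] in auto)
      then show ?thesis
        by simp
    qed
    then have "m * (\<Sum>t\<in>UNIV. expectation (\<lambda>\<omega>. norm (p t \<omega>))) \<le> (\<Sum>t\<in>UNIV. expectation (\<lambda>\<omega>. p t \<omega> \<bullet> constr t xh \<omega>))"
      by (simp add: sum_distrib_left sum_mono)
    also have "\<dots> \<le> v + 1 + D"
      using le[OF xhP] obj_le[OF f xhP] qz[OF xh] unfolding expectation_lag[OF f mult xhP] D_def by simp
    finally have K1: "(\<Sum>t\<in>UNIV. expectation (\<lambda>\<omega>. norm (p t \<omega>))) \<le> K1"
      using m(1) by (simp add: K1_def le_divide_eq mult.commute)
    \<comment> \<open>This program follows the direction of \<open>q t\<close>, so in general it is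
      not adapted. The ball is contained in \<open>A t\<close> only within \<open>V t\<close>, which
      is why \<open>q\<close> is required to take values there.\<close>
    define y where "y \<omega> = (\<chi> t. xi \<omega> $ t + \<theta> *\<^sub>R sgn (q t \<omega>))" for \<omega>
    have qmeas: "q t \<in> borel_measurable M" for t
      using pm(3) by auto
    have yV: "y \<omega> $ t \<in> V t" if "\<omega> \<in> space M" for \<omega> t
      using programsD(3)[OF xiP that] qV that
      by (auto simp: y_def sgn_div_norm intro!: subspace_add subspace_scale subspace_V)
    have y: "y \<in> programs"
    proof (rule programsI)
      show "(\<lambda>\<omega>. y \<omega> $ t) \<in> borel_measurable M" for t
        using programsD(1)[OF xiP, of t] qmeas[of t] by (simp add: y_def sgn_div_norm)
      show "AE \<omega> in M. y \<omega> \<in> Aprod \<omega>"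
        using AE_space
      proof eventually_elim
        case (elim \<omega>)
        have "y \<omega> $ t \<in> cball (xi \<omega> $ t) \<theta>" for t
          using \<theta>(1) by (simp add: y_def dist_norm norm_sgn)
        then show ?case
          using \<theta>(2)[OF elim] yV[OF elim] by (simp add: Aprod_def subset_iff)
      qed
    qed (rule yV)
    have "expectation (\<lambda>\<omega>. q t \<omega> \<bullet> y \<omega> $ t) = \<theta> * expectation (\<lambda>\<omega>. norm (q t \<omega>))" for t
    proof -
      have "q t \<omega> \<bullet> sgn (q t \<omega>) = norm (q t \<omega>)" for \<omega>
        by (cases "q t \<omega> = 0") (simp_all add: sgn_div_norm power2_norm_eq_inner[symmetric] power2_eq_square)
      then have "expectation (\<lambda>\<omega>. q t \<omega> \<bullet> y \<omega> $ t) = expectation (\<lambda>\<omega>. q t \<omega> \<bullet> xi \<omega> $ t + \<theta> * norm (q t \<omega>))"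
        by (simp add: y_def inner_add_right)
      also have "\<dots> = \<theta> * expectation (\<lambda>\<omega>. norm (q t \<omega>))"
        using integrable_q_program[OF mult xiP, of t] pm(3)[of t] qz[OF xi, of t] by simp
      finally show ?thesis .
    qed
    moreover have "- (bound * expectation (\<lambda>\<omega>. norm (p t \<omega>))) \<le> expectation (\<lambda>\<omega>. p t \<omega> \<bullet> constr t y \<omega>)" for t
    proof -
      have "expectation (\<lambda>\<omega>. - (bound * norm (p t \<omega>))) \<le> expectation (\<lambda>\<omega>. p t \<omega> \<bullet> constr t y \<omega>)"
      proof (rule integral_mono)
        fix \<omega> assume "\<omega> \<in> space M"
        then have "norm (p t \<omega>) * norm (constr t y \<omega>) \<le> norm (p t \<omega>) * bound"
          using constr_bound[OF y] by (intro mult_left_mono) auto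
        then show "- (bound * norm (p t \<omega>)) \<le> p t \<omega> \<bullet> constr t y \<omega>"
          using Cauchy_Schwarz_ineq2[of "p t \<omega>" "constr t y \<omega>"] by (simp add: mult.commute)
      qed (use pm(2)[of t] integrable_p_constr[OF mult y, of t] in auto)
      then show ?thesis
        by simp
    qed
    then have "(\<Sum>t\<in>UNIV. - (bound * expectation (\<lambda>\<omega>. norm (p t \<omega>))))
        \<le> (\<Sum>t\<in>UNIV. expectation (\<lambda>\<omega>. p t \<omega> \<bullet> constr t y \<omega>))"
      by (intro sum_mono) auto
    then have "- (bound * (\<Sum>t\<in>UNIV. expectation (\<lambda>\<omega>. norm (p t \<omega>)))) \<le> (\<Sum>t\<in>UNIV. expectation (\<lambda>\<omega>. p t \<omega> \<bullet> constr t y \<omega>))"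
      by (simp add: sum_distrib_left sum_negf)
    moreover have "bound * (\<Sum>t\<in>UNIV. expectation (\<lambda>\<omega>. norm (p t \<omega>))) \<le> bound * K1"
      using K1 bound_pos by (intro mult_left_mono) auto
    ultimately have "\<theta> * (\<Sum>t\<in>UNIV. expectation (\<lambda>\<omega>. norm (q t \<omega>))) \<le> v + 1 + D + bound * K1"
      using le[OF y] obj_le[OF f y] unfolding expectation_lag[OF f mult y] D_def
      by (simp add: sum_distrib_left[symmetric] abs_le_iff)
    then have "(\<Sum>t\<in>UNIV. expectation (\<lambda>\<omega>. norm (q t \<omega>))) \<le> K2"
      using \<theta>(1) by (simp add: K2_def le_divide_eq mult.commute)
    with K1 show "(\<Sum>t\<in>UNIV. expectation (\<lambda>\<omega>. norm (p t \<omega>))) + (\<Sum>t\<in>UNIV. expectation (\<lambda>\<omega>. norm (q t \<omega>))) \<le> K1 + K2"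
      by simp
  qed
qed

lemma multipliers_lin:
  assumes "multipliers S p q" "multipliers S' p' q'" "S' \<subseteq> S" "0 \<le> a" "0 \<le> b"
  shows "multipliers S (\<lambda>t \<omega>. a *\<^sub>R p t \<omega> + b *\<^sub>R p' t \<omega>) (\<lambda>t \<omega>. c *\<^sub>R q t \<omega> + d *\<^sub>R q' t \<omega>)"
  unfolding multipliers_def
proof (intro conjI allI ballI impI)
  fix t
  note p = multipliersD[OF assms(1), where t = t] and p' = multipliersD[OF assms(2), where t = t]
  show "(\<lambda>\<omega>. a *\<^sub>R p t \<omega> + b *\<^sub>R p' t \<omega>) \<in> borel_measurable (G t)"
    using p(1) p'(1) by (intro borel_measurable_add borel_measurable_scaleR) auto
  show "integrable M (\<lambda>\<omega>. a *\<^sub>R p t \<omega> + b *\<^sub>R p' t \<omega>)" "integrable M (\<lambda>\<omega>. c *\<^sub>R q t \<omega> + d *\<^sub>R q' t \<omega>)"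
    using p(2,3) p'(2,3) by auto
  fix \<omega> assume \<omega>: "\<omega> \<in> space M"
  show "a *\<^sub>R p t \<omega> + b *\<^sub>R p' t \<omega> \<in> W t"
    using p(4)[OF \<omega>] p'(4)[OF \<omega>] by (intro subspace_add subspace_scale subspace_W)
  show "le_W t 0 (a *\<^sub>R p t \<omega> + b *\<^sub>R p' t \<omega>)"
    using p(5)[OF \<omega>] p'(5)[OF \<omega>] assms(4,5) by (auto simp: le_W_def inner_add_left)
  assume "t \<notin> S"
  then show "a *\<^sub>R p t \<omega> + b *\<^sub>R p' t \<omega> = 0"
    using p(6)[OF _ \<omega>] p'(6)[OF _ \<omega>] assms(3) by auto
qed

text \<open>The approximate multipliers for the error \<open>1 / real (Suc n)\<close> form sets
  closed under midpoints and bounded in L^1, to which the extraction of an almost surely convergent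
  sequence applies. Orthogonality and the gap are stated for \<open>P n\<close> and
  \<open>Q n\<close> only, since mass may be lost in the limit.\<close>

lemma multiplier_sequence:
  assumes f: "integrand f"
    and opt: "\<And>x. x \<in> adapted_programs \<Longrightarrow> (\<And>t. t \<in> S \<Longrightarrow> satisfies_constraint t x) \<Longrightarrow> obj f x \<le> v"
    and xb: "xb \<in> adapted_programs" "\<And>t. t \<in> S \<Longrightarrow> satisfies_constraint t xb" "obj f xb = v"
  obtains P Q p q where "\<And>n. multipliers S (P n) (Q n)" and "\<And>n t. orthogonal_to (G t) (Q n t)"
    and "\<And>n x. x \<in> programs \<Longrightarrow> expectation (\<lambda>\<omega>. lag f (P n) (Q n) \<omega> (x \<omega>)) \<le> v + 1 / real (Suc n)"
    and "multipliers S p q" and "\<And>t. AE \<omega> in M. (\<lambda>n. P n t \<omega>) \<longlonglongrightarrow> p t \<omega>"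
    and "\<And>t. AE \<omega> in M. (\<lambda>n. Q n t \<omega>) \<longlonglongrightarrow> q t \<omega>"
proof -
  \<comment> \<open>All multipliers are packed into one vector-valued function, so that a single
    choice of sequence makes all of them converge together.\<close>
  define pp :: "('a \<Rightarrow> ('d \<times> 'c, 'b) vec) \<Rightarrow> 'b \<Rightarrow> 'a \<Rightarrow> 'd" where "pp h t \<omega> = fst (h \<omega> $ t)" for h t \<omega>
  define qq :: "('a \<Rightarrow> ('d \<times> 'c, 'b) vec) \<Rightarrow> 'b \<Rightarrow> 'a \<Rightarrow> 'c" where "qq h t \<omega> = snd (h \<omega> $ t)" for h t \<omega>
  define C where "C n = {h. multipliers S (pp h) (qq h) \<and> (\<forall>t. orthogonal_to (G t) (qq h t)) \<and>
    (\<forall>t. \<forall>\<omega>\<in>space M. qq h t \<omega> \<in> V t) \<and>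
    (\<forall>x\<in>programs. expectation (\<lambda>\<omega>. lag f (pp h) (qq h) \<omega> (x \<omega>)) \<le> v + 1 / real (Suc n))}" for n
  obtain K where K: "\<forall>S p q. multipliers S p q \<and> (\<forall>t. orthogonal_to (G t) (q t)) \<and>
    (\<forall>t. \<forall>\<omega>\<in>space M. q t \<omega> \<in> V t) \<and>
    (\<forall>x\<in>programs. expectation (\<lambda>\<omega>. lag f p q \<omega> (x \<omega>)) \<le> v + 1) \<longrightarrow>
    (\<Sum>t\<in>UNIV. expectation (\<lambda>\<omega>. norm (p t \<omega>))) + (\<Sum>t\<in>UNIV. expectation (\<lambda>\<omega>. norm (q t \<omega>))) \<le> K"
    by (rule multipliers_L1_bound[OF f, of v])
  have ne: "C n \<noteq> {}" for n
  proof -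
    obtain p q where pq: "multipliers S p q" "\<And>t. orthogonal_to (G t) (q t)" "\<And>t \<omega>. q t \<omega> \<in> V t"
        "\<And>x. x \<in> programs \<Longrightarrow> expectation (\<lambda>\<omega>. lag f p q \<omega> (x \<omega>)) \<le> v + 1 / real (Suc n)"
      by (rule approximate_multipliers[OF f opt xb, of S "1 / real (Suc n)"]) auto
    define h :: "'a \<Rightarrow> ('d \<times> 'c, 'b) vec" where "h \<omega> = (\<chi> t. (p t \<omega>, q t \<omega>))" for \<omega>
    have "pp h = p" "qq h = q"
      by (auto simp: h_def pp_def qq_def fun_eq_iff)
    then have "h \<in> C n"
      using pq by (simp add: C_def)
    then show ?thesis
      by blast
  qed
  have dec: "C (Suc n) \<subseteq> C n" for n
  proof -
    have "1 / real (Suc (Suc n)) \<le> 1 / real (Suc n)"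
      by (intro divide_left_mono) auto
    then show ?thesis
      unfolding C_def by (auto intro: order_trans)
  qed
  have mid: "(\<lambda>\<omega>. (1/2) *\<^sub>R (h \<omega> + k \<omega>)) \<in> C n" if hk: "h \<in> C n" "k \<in> C n" for n h k
  proof -
    let ?m = "\<lambda>\<omega>. (1/2) *\<^sub>R (h \<omega> + k \<omega>)"
    have h: "multipliers S (pp h) (qq h)" "\<And>t. orthogonal_to (G t) (qq h t)"
        "\<And>t \<omega>. \<omega> \<in> space M \<Longrightarrow> qq h t \<omega> \<in> V t"
        "\<And>x. x \<in> programs \<Longrightarrow> expectation (\<lambda>\<omega>. lag f (pp h) (qq h) \<omega> (x \<omega>)) \<le> v + 1 / real (Suc n)"
      using hk(1) by (auto simp: C_def)
    have k: "multipliers S (pp k) (qq k)" "\<And>t. orthogonal_to (G t) (qq k t)"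
        "\<And>t \<omega>. \<omega> \<in> space M \<Longrightarrow> qq k t \<omega> \<in> V t"
        "\<And>x. x \<in> programs \<Longrightarrow> expectation (\<lambda>\<omega>. lag f (pp k) (qq k) \<omega> (x \<omega>)) \<le> v + 1 / real (Suc n)"
      using hk(2) by (auto simp: C_def)
    have pm: "pp ?m = (\<lambda>t \<omega>. (1/2) *\<^sub>R pp h t \<omega> + (1/2) *\<^sub>R pp k t \<omega>)"
      and qm: "qq ?m = (\<lambda>t \<omega>. (1/2) *\<^sub>R qq h t \<omega> + (1/2) *\<^sub>R qq k t \<omega>)"
      by (auto simp: pp_def qq_def fun_eq_iff scaleR_add_right)
    have m: "multipliers S (pp ?m) (qq ?m)"
      unfolding pm qm by (rule multipliers_lin[OF h(1) k(1)]) auto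
    have "expectation (\<lambda>\<omega>. lag f (pp ?m) (qq ?m) \<omega> (x \<omega>)) \<le> v + 1 / real (Suc n)" if x: "x \<in> programs" for x
    proof -
      have "lag f (pp ?m) (qq ?m) \<omega> (x \<omega>) = (1/2) * lag f (pp h) (qq h) \<omega> (x \<omega>) + (1/2) * lag f (pp k) (qq k) \<omega> (x \<omega>)" for \<omega>
        unfolding lag_def pm qm
        by (simp add: inner_add_left sum.distrib sum_divide_distrib[symmetric] field_simps)
      then have "expectation (\<lambda>\<omega>. lag f (pp ?m) (qq ?m) \<omega> (x \<omega>))
          = (1/2) * expectation (\<lambda>\<omega>. lag f (pp h) (qq h) \<omega> (x \<omega>)) + (1/2) * expectation (\<lambda>\<omega>. lag f (pp k) (qq k) \<omega> (x \<omega>))"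
        using integrable_lag[OF f h(1) x] integrable_lag[OF f k(1) x] by simp
      then show ?thesis
        using h(4)[OF x] k(4)[OF x] by simp
    qed
    moreover have "orthogonal_to (G t) (qq ?m t)" for t
      unfolding qm
      by (rule orthogonal_to_lin[OF subalgebra_G multipliersD(3)[OF h(1)] multipliersD(3)[OF k(1)] h(2) k(2)])
    moreover have "qq ?m t \<omega> \<in> V t" if "\<omega> \<in> space M" for t \<omega>
      unfolding qm using h(3)[OF that] k(3)[OF that] by (intro subspace_add subspace_scale subspace_V)
    ultimately show ?thesis
      using m by (simp add: C_def)
  qed
  have comp: "integrable M (pp h t)" "integrable M (qq h t)" if "h \<in> C n" for h n t
    using that multipliersD(2,3) by (auto simp: C_def)
  have le: "norm (h \<omega>) \<le> (\<Sum>t\<in>UNIV. norm (pp h t \<omega>) + norm (qq h t \<omega>))" for h :: "'a \<Rightarrow> ('d \<times> 'c, 'b) vec" and \<omega>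
  proof -
    have "norm (h \<omega>) \<le> (\<Sum>t\<in>UNIV. norm (h \<omega> $ t))"
      by (rule norm_vec_le_sum)
    also have "\<dots> \<le> (\<Sum>t\<in>UNIV. norm (pp h t \<omega>) + norm (qq h t \<omega>))"
      unfolding pp_def qq_def by (intro sum_mono) (metis norm_Pair_le prod.collapse)
    finally show ?thesis .
  qed
  have int: "integrable M h" if h: "h \<in> C 0" for h
  proof (rule Bochner_Integration.integrable_bound)
    show "integrable M (\<lambda>\<omega>. \<Sum>t\<in>UNIV. norm (pp h t \<omega>) + norm (qq h t \<omega>))"
      using comp[OF h] by auto
    show "h \<in> borel_measurable M"
    proof (rule borel_measurable_vecI)
      fix t
      have "(\<lambda>\<omega>. (pp h t \<omega>, qq h t \<omega>)) \<in> borel_measurable M"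
        using comp[OF h, of t] by (intro borel_measurable_Pair) auto
      then show "(\<lambda>\<omega>. h \<omega> $ t) \<in> borel_measurable M"
        by (simp add: pp_def qq_def)
    qed
    show "AE \<omega> in M. norm (h \<omega>) \<le> norm (\<Sum>t\<in>UNIV. norm (pp h t \<omega>) + norm (qq h t \<omega>))"
      using le[of h] by (intro AE_I2) (simp add: abs_of_nonneg sum_nonneg)
  qed
  have bd0: "(\<Sum>t\<in>UNIV. expectation (\<lambda>\<omega>. norm (pp h t \<omega>))) + (\<Sum>t\<in>UNIV. expectation (\<lambda>\<omega>. norm (qq h t \<omega>))) \<le> K"
    if h: "h \<in> C 0" for h
    using h by (intro K[rule_format]) (auto simp: C_def)
  have bd: "expectation (\<lambda>\<omega>. norm (h \<omega>)) \<le> K" if h: "h \<in> C 0" for h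
  proof -
    have "expectation (\<lambda>\<omega>. norm (h \<omega>)) \<le> expectation (\<lambda>\<omega>. \<Sum>t\<in>UNIV. norm (pp h t \<omega>) + norm (qq h t \<omega>))"
      using comp[OF h] int[OF h] le[of h] by (intro integral_mono) auto
    also have "\<dots> = (\<Sum>t\<in>UNIV. expectation (\<lambda>\<omega>. norm (pp h t \<omega>))) + (\<Sum>t\<in>UNIV. expectation (\<lambda>\<omega>. norm (qq h t \<omega>)))"
      using comp[OF h] by (simp add: sum.distrib)
    also have "\<dots> \<le> K"
      by (rule bd0[OF h])
    finally show ?thesis .
  qed
  obtain h where h: "\<And>n. h n \<in> C n" and conv: "AE \<omega> in M. convergent (\<lambda>n. h n \<omega>)"
    by (rule midpoint_closed_AE_convergent[of C K, OF ne dec mid int bd]) auto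
  have h0: "h n \<in> C 0" for n
    using lift_Suc_antimono_le[of C 0 n] dec h[of n] by auto
  have mult: "multipliers S (pp (h n)) (qq (h n))" for n
    using h[of n] by (simp add: C_def)
  \<comment> \<open>The limit lies in the closed cone almost surely; the default 0 makes the sign
    condition hold everywhere and keeps measurability in \<open>G t\<close>.\<close>
  define p where "p t \<omega> = (if lim (\<lambda>n. pp (h n) t \<omega>) \<in> {w \<in> W t. le_W t 0 w} then lim (\<lambda>n. pp (h n) t \<omega>) else 0)" for t \<omega>
  define q where "q t \<omega> = lim (\<lambda>n. qq (h n) t \<omega>)" for t \<omega>
  have climit: "AE \<omega> in M. (\<lambda>n. pp (h n) t \<omega>) \<longlonglongrightarrow> p t \<omega> \<and> (\<lambda>n. qq (h n) t \<omega>) \<longlonglongrightarrow> q t \<omega>" for t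
    using conv AE_space
  proof eventually_elim
    case (elim \<omega>)
    then obtain l where l: "(\<lambda>n. h n \<omega>) \<longlonglongrightarrow> l"
      by (auto simp: convergent_def)
    have lp: "(\<lambda>n. pp (h n) t \<omega>) \<longlonglongrightarrow> fst (l $ t)" and lq: "(\<lambda>n. qq (h n) t \<omega>) \<longlonglongrightarrow> snd (l $ t)"
      unfolding pp_def qq_def by (intro tendsto_intros l)+
    have "fst (l $ t) \<in> {w \<in> W t. le_W t 0 w}"
      using multipliersD(4,5)[OF mult elim(2)]
      by (intro closed_sequentially[OF closed_W_nonneg _ lp]) auto
    then show ?case
      using lp lq limI[OF lp] limI[OF lq] by (simp add: p_def q_def)
  qed
  have pmeas: "p t \<in> borel_measurable (G t)" for t
    unfolding p_def
    by (rule measurable_If_closed[OF closed_W_nonneg borel_measurable_lim_metric[OF multipliersD(1)[OF mult]]])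
  have qmeas: "q t \<in> borel_measurable M" for t
    unfolding q_def using comp(2)[OF h0] by (intro borel_measurable_lim_metric) auto
  have member: "a t \<le> K" if "(\<Sum>t\<in>UNIV. a t) + (\<Sum>t\<in>UNIV. b t) \<le> K" "\<And>t. 0 \<le> a t" "\<And>t. 0 \<le> b t"
    for a b :: "'b \<Rightarrow> real" and t
    using that member_le_sum[of t UNIV a] sum_nonneg[of UNIV b] by simp
  have pint: "integrable M (p t)" for t
  proof (rule Fatou_norm(1)[where f = "\<lambda>n. pp (h n) t" and K = "\<lambda>_. K"])
    show "expectation (\<lambda>\<omega>. norm (pp (h n) t \<omega>)) \<le> K" for n
      by (rule member[OF bd0[OF h0]]) auto
  qed (use comp[OF h0] climit[of t] measurable_G[OF pmeas] in auto)
  have qint: "integrable M (q t)" for t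
  proof (rule Fatou_norm(1)[where f = "\<lambda>n. qq (h n) t" and K = "\<lambda>_. K"])
    show "expectation (\<lambda>\<omega>. norm (qq (h n) t \<omega>)) \<le> K" for n
      by (rule member[OF bd0[OF h0, unfolded add.commute[of "\<Sum>t\<in>UNIV. expectation (\<lambda>\<omega>. norm (pp _ t \<omega>))"]]]) auto
  qed (use comp[OF h0] climit[of t] qmeas in auto)
  show ?thesis
  proof (rule that[of "\<lambda>n. pp (h n)" "\<lambda>n. qq (h n)" p q])
    show "multipliers S p q"
      unfolding multipliers_def
    proof (intro conjI allI ballI impI pmeas pint qint)
      fix t \<omega> assume "\<omega> \<in> space M"
      show "p t \<omega> \<in> W t" "le_W t 0 (p t \<omega>)"
        using subspace_0[OF subspace_W] by (auto simp: p_def le_W_def)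
    next
      fix t \<omega> assume "t \<notin> S" "\<omega> \<in> space M"
      then have "(\<lambda>n. pp (h n) t \<omega>) = (\<lambda>n. 0)"
        using multipliersD(6)[OF mult] by auto
      then show "p t \<omega> = 0"
        by (simp add: p_def)
    qed
    show "AE \<omega> in M. (\<lambda>n. pp (h n) t \<omega>) \<longlonglongrightarrow> p t \<omega>" for t
      using climit[of t] by eventually_elim simp
    show "AE \<omega> in M. (\<lambda>n. qq (h n) t \<omega>) \<longlonglongrightarrow> q t \<omega>" for t
      using climit[of t] by eventually_elim simp
  qed (use h mult in \<open>auto simp: C_def\<close>)
qed

subsection \<open>Mass lost in the limit\<close>

text \<open>Mass of \<open>R n t\<close> can only escape outside of \<open>good R t m\<close>.\<close>

definition good :: "(nat \<Rightarrow> 'b \<Rightarrow> 'a \<Rightarrow> 'e::real_normed_vector) \<Rightarrow> 'b \<Rightarrow> nat \<Rightarrow> 'a set" where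
  "good R t m = {\<omega> \<in> space M. \<forall>n. norm (R n t \<omega>) \<le> real m}"

text \<open>For \<open>R = P\<close> the event belongs to \<open>G t\<close>, so a decision that is
  changed off \<open>good P t m\<close> remains known at \<open>t\<close>.\<close>

lemma good_sets:
  assumes "space H = space M" "\<And>n. R n t \<in> borel_measurable H"
  shows "good R t m \<in> sets H"
proof -
  have [measurable]: "R n t \<in> borel_measurable H" for n
    by (rule assms(2))
  have "{\<omega> \<in> space H. \<forall>n. norm (R n t \<omega>) \<le> real m} \<in> sets H"
    by measurable
  then show ?thesis
    by (simp add: good_def assms(1))
qed

lemma AE_eventually_good:
  assumes "AE \<omega> in M. (\<lambda>n. R n t \<omega>) \<longlonglongrightarrow> r \<omega>"
  shows "AE \<omega> in M. \<forall>\<^sub>F m in sequentially. \<omega> \<in> good R t m"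
  using assms AE_space
proof eventually_elim
  case (elim \<omega>)
  then have "Bseq (\<lambda>n. R n t \<omega>)"
    by (intro convergent_imp_Bseq) (auto simp: convergent_def)
  then obtain K where K: "\<And>n. norm (R n t \<omega>) \<le> K"
    by (auto simp: Bseq_def)
  obtain m0 where "K \<le> real m0"
    using real_arch_simple by blast
  then have "\<omega> \<in> good R t m" if "m0 \<le> m" for m
    using K elim(2) that by (force simp: good_def intro: order_trans)
  then show ?case
    by (auto simp: eventually_sequentially)
qed

section \<open>Limits along a fixed sequence of approximate multipliers\<close>

context
  fixes f S v xb P Q p q
  assumes f: "integrand f"
    and xb: "xb \<in> adapted_programs" "\<And>t. t \<in> S \<Longrightarrow> satisfies_constraint t xb" "obj f xb = v"
    and multn: "\<And>n::nat. multipliers S (P n) (Q n)" and orth: "\<And>n t. orthogonal_to (G t) (Q n t)"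
    and gap: "\<And>n x. x \<in> programs \<Longrightarrow> expectation (\<lambda>\<omega>. lag f (P n) (Q n) \<omega> (x \<omega>)) \<le> v + 1 / real (Suc n)"
    and mult: "multipliers S p q" and Plim: "\<And>t. AE \<omega> in M. (\<lambda>n. P n t \<omega>) \<longlonglongrightarrow> p t \<omega>"
    and Qlim: "\<And>t. AE \<omega> in M. (\<lambda>n. Q n t \<omega>) \<longlonglongrightarrow> q t \<omega>"
begin

lemma xbP: "xb \<in> programs"
  by (rule adapted_programsD(1)[OF xb(1)])

lemma Q_adapted_zero: "x \<in> adapted_programs \<Longrightarrow> expectation (\<lambda>\<omega>. Q n t \<omega> \<bullet> x \<omega> $ t) = 0"
  by (rule orthogonal_toD[OF orth adapted_programsD(2) program_bound[OF adapted_programsD(1)]])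

lemma multiplier_constr_nonneg:
  assumes m: "multipliers S p' q'"
  shows "AE \<omega> in M. 0 \<le> p' t \<omega> \<bullet> constr t xb \<omega>"
proof (cases "t \<in> S")
  case True
  from xb(2)[OF this] show ?thesis
    unfolding satisfies_constraint_iff using AE_space
    by eventually_elim (auto intro: inner_W_nonneg multipliersD[OF m])
next
  case False
  then show ?thesis
    using multipliersD(6)[OF m] by (intro AE_I2) simp
qed

lemma expectation_lag_solution:
  "expectation (\<lambda>\<omega>. lag f (P n) (Q n) \<omega> (xb \<omega>)) = v + (\<Sum>t\<in>UNIV. expectation (\<lambda>\<omega>. P n t \<omega> \<bullet> constr t xb \<omega>))"
  unfolding expectation_lag[OF f multn xbP] by (simp add: Q_adapted_zero[OF xb(1)] xb(3))

lemma expectation_P_constr_nonneg: "0 \<le> expectation (\<lambda>\<omega>. P n t \<omega> \<bullet> constr t xb \<omega>)"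
  by (rule integral_nonneg_AE[OF multiplier_constr_nonneg[OF multn]])

lemma sum_P_constr_le: "(\<Sum>t\<in>UNIV. expectation (\<lambda>\<omega>. P n t \<omega> \<bullet> constr t xb \<omega>)) \<le> 1 / real (Suc n)"
  using gap[OF xbP, of n] by (simp add: expectation_lag_solution)

text \<open>The program that follows \<open>x\<close> on \<open>B\<close> and \<open>xb\<close>
  elsewhere obeys the global bound, while the expected Lagrangian of \<open>xb\<close> is at least
  \<open>v\<close>.\<close>

lemma local_gap:
  assumes x: "x \<in> programs" and B: "B \<in> sets M"
  shows "expectation (\<lambda>\<omega>. indicat_real B \<omega> * (lag f (P n) (Q n) \<omega> (x \<omega>) - lag f (P n) (Q n) \<omega> (xb \<omega>))) \<le> 1 / real (Suc n)"
proof -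
  let ?L = "\<lambda>x \<omega>. lag f (P n) (Q n) \<omega> (x \<omega>)"
  let ?y = "\<lambda>\<omega>. if \<omega> \<in> B then x \<omega> else xb \<omega>"
  have y: "?y \<in> programs"
    by (rule switch_program_whole[OF x xbP B])
  have "indicat_real B \<omega> * (?L x \<omega> - ?L xb \<omega>) = ?L ?y \<omega> - ?L xb \<omega>" for \<omega>
    by (simp add: indicator_def)
  then have "expectation (\<lambda>\<omega>. indicat_real B \<omega> * (?L x \<omega> - ?L xb \<omega>)) = expectation (?L ?y) - expectation (?L xb)"
    using integrable_lag[OF f multn y] integrable_lag[OF f multn xbP] by simp
  also have "expectation (?L xb) \<ge> v"
    unfolding expectation_lag_solution by (simp add: sum_nonneg expectation_P_constr_nonneg)
  then have "expectation (?L ?y) - expectation (?L xb) \<le> 1 / real (Suc n)"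
    using gap[OF y, of n] by simp
  finally show ?thesis .
qed

lemma P_measurable: "P n t \<in> borel_measurable (G t)"
  by (rule multipliersD(1)[OF multn])

lemma Q_measurable: "Q n t \<in> borel_measurable M"
  using multipliersD(3)[OF multn, of n t] by auto

lemma limits: "AE \<omega> in M. \<forall>t. (\<lambda>n. P n t \<omega>) \<longlonglongrightarrow> p t \<omega> \<and> (\<lambda>n. Q n t \<omega>) \<longlonglongrightarrow> q t \<omega>"
proof -
  have "AE \<omega> in M. \<forall>t\<in>UNIV. (\<lambda>n. P n t \<omega>) \<longlonglongrightarrow> p t \<omega> \<and> (\<lambda>n. Q n t \<omega>) \<longlonglongrightarrow> q t \<omega>"
    using Plim Qlim by (intro AE_ball_countable[THEN iffD2] ballI AE_conjI) (auto intro: countable_finite)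
  then show ?thesis
    by simp
qed

text \<open>Since \<open>Q\<close> takes part, this event is only known to lie in \<open>M\<close>.
  Limits are taken under the integral on it; strategies are changed on the events
  \<open>good P t m\<close> instead.\<close>

definition all_good :: "nat \<Rightarrow> 'a set" where
  "all_good m = (\<Inter>t. good P t m \<inter> good Q t m)"

lemma all_good_sets: "all_good m \<in> sets M"
proof -
  have "good P t m \<inter> good Q t m \<in> sets M" for t
    using good_sets[of M P t m] good_sets[of M Q t m] measurable_G[OF P_measurable] Q_measurable by auto
  then show ?thesis
    unfolding all_good_def by (intro sets.finite_INT) auto
qed

lemma all_goodD: "\<omega> \<in> all_good m \<Longrightarrow> norm (P n t \<omega>) \<le> real m" "\<omega> \<in> all_good m \<Longrightarrow> norm (Q n t \<omega>) \<le> real m"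
  by (auto simp: all_good_def good_def)

lemma AE_all_good: "AE \<omega> in M. \<forall>\<^sub>F m in sequentially. \<omega> \<in> all_good m"
proof -
  have "AE \<omega> in M. \<forall>t\<in>UNIV. (\<forall>\<^sub>F m in sequentially. \<omega> \<in> good P t m) \<and> (\<forall>\<^sub>F m in sequentially. \<omega> \<in> good Q t m)"
    using AE_eventually_good[where R = P, OF Plim] AE_eventually_good[where R = Q, OF Qlim]
    by (intro AE_ball_countable[THEN iffD2] ballI AE_conjI) (auto intro: countable_finite)
  then show ?thesis
  proof eventually_elim
    case (elim \<omega>)
    then have "\<forall>\<^sub>F m in sequentially. \<forall>t\<in>UNIV. \<omega> \<in> good P t m \<and> \<omega> \<in> good Q t m"
      by (intro eventually_ball_finite) (auto intro: eventually_conj)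
    then show ?case
      by eventually_elim (simp add: all_good_def)
  qed
qed

text \<open>On \<open>all_good m\<close> dominated convergence applies, so \<open>local_gap\<close>,
  used where the limit gain is positive, leaves a nonnegative function whose integral is at most
  0.\<close>

lemma lag_limit_le:
  assumes x: "x \<in> programs"
  shows "AE \<omega> in M. lag f p q \<omega> (x \<omega>) \<le> lag f p q \<omega> (xb \<omega>)"
proof -
  let ?L = "\<lambda>n \<omega>. lag f (P n) (Q n) \<omega> (x \<omega>) - lag f (P n) (Q n) \<omega> (xb \<omega>)"
  let ?l = "\<lambda>\<omega>. lag f p q \<omega> (x \<omega>) - lag f p q \<omega> (xb \<omega>)"
  have Li: "integrable M (?L n)" for n
    using integrable_lag[OF f multn x] integrable_lag[OF f multn xbP] by simp
  have li: "integrable M ?l"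
    using integrable_lag[OF f mult x] integrable_lag[OF f mult xbP] by simp
  have lm: "?l \<in> borel_measurable M"
    using li by (rule borel_measurable_integrable)
  have "AE \<omega> in M. \<omega> \<in> all_good m \<longrightarrow> ?l \<omega> \<le> 0" for m
  proof -
    define B where "B = all_good m \<inter> {\<omega> \<in> space M. 0 < ?l \<omega>}"
    have B: "B \<in> sets M"
      unfolding B_def using all_good_sets lm by (intro sets.Int borel_measurable_less) auto
    \<comment> \<open>The outer factor 2 stands for the two Lagrangians, the inner one for the sums
      with \<open>P n\<close> and with \<open>Q n\<close>, each of whose terms is at most
      \<open>real m * bound\<close>.\<close>
    define w where "w \<omega> = 2 * (dom f \<omega> + 2 * (real CARD('b) * (real m * bound)))" for \<omega>
    have "(\<lambda>n. expectation (\<lambda>\<omega>. indicat_real B \<omega> * ?L n \<omega>)) \<longlonglongrightarrow> expectation (\<lambda>\<omega>. indicat_real B \<omega> * ?l \<omega>)"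
    proof (rule integral_dominated_convergence[where w = w])
      show "integrable M w"
        unfolding w_def using integrable_dom[OF f] by auto
      show "AE \<omega> in M. (\<lambda>n. indicat_real B \<omega> * ?L n \<omega>) \<longlonglongrightarrow> indicat_real B \<omega> * ?l \<omega>"
        using limits by eventually_elim (unfold lag_def, intro tendsto_intros, auto)
      show "AE \<omega> in M. norm (indicat_real B \<omega> * ?L n \<omega>) \<le> w \<omega>" for n
        using programsD(4)[OF x] programsD(4)[OF xbP] AE_space
      proof eventually_elim
        case (elim \<omega>)
        have "0 \<le> dom f \<omega>"
          using abs_le_dom[OF f elim(3,2)] by linarith
        then have w0: "0 \<le> w \<omega>"
          using bound_pos by (simp add: w_def)
        show ?case
        proof (cases "\<omega> \<in> B")
          case True
          then have "\<omega> \<in> all_good m"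
            by (simp add: B_def)
          note gd = all_goodD[OF this]
          have "(\<Sum>t\<in>UNIV. norm (P n t \<omega>) * bound) \<le> (\<Sum>t\<in>(UNIV::'b set). real m * bound)"
            "(\<Sum>t\<in>UNIV. norm (Q n t \<omega>) * bound) \<le> (\<Sum>t\<in>(UNIV::'b set). real m * bound)"
            using bound_pos by (intro sum_mono mult_right_mono gd; simp)+
          then show ?thesis
            using abs_lag_le[OF f elim(3,1), of "P n" "Q n"] abs_lag_le[OF f elim(3,2), of "P n" "Q n"] True
            by (simp add: w_def)
        qed (use w0 in simp)
      qed
    qed (use Li li B in \<open>auto intro!: borel_measurable_times\<close>)
    then have "expectation (\<lambda>\<omega>. indicat_real B \<omega> * ?l \<omega>) \<le> 0"
      using local_gap[OF x B] by (intro LIMSEQ_le[OF _ LIMSEQ_Suc[OF lim_1_over_n]]) auto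
    moreover have nn: "0 \<le> indicat_real B \<omega> * ?l \<omega>" for \<omega>
      by (auto simp: B_def indicator_def)
    moreover have "integrable M (\<lambda>\<omega>. indicat_real B \<omega> * ?l \<omega>)"
      using integrable_real_mult_indicator[OF B li] by (simp add: mult.commute)
    ultimately have "AE \<omega> in M. indicat_real B \<omega> * ?l \<omega> = 0"
      using integral_nonneg_eq_0_iff_AE[of M "\<lambda>\<omega>. indicat_real B \<omega> * ?l \<omega>"] integral_nonneg_AE[OF AE_I2, of M "\<lambda>\<omega>. indicat_real B \<omega> * ?l \<omega>"]
      by (simp add: antisym)
    then show ?thesis
      using AE_space by eventually_elim (auto simp: B_def indicator_def split: if_splits)
  qed
  then have "AE \<omega> in M. \<forall>m. \<omega> \<in> all_good m \<longrightarrow> ?l \<omega> \<le> 0"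
    by (intro AE_all_countable[THEN iffD2] allI)
  with AE_all_good show ?thesis
    by eventually_elim (auto simp: eventually_sequentially)
qed

text \<open>The expected Lagrangian at \<open>xb\<close> exceeds \<open>v\<close> by exactly the sum
  of the expected products for \<open>P n\<close>. These are nonnegative, so the gap bounds each of
  them by \<open>1 / real (Suc n)\<close>, and Fatou's lemma sends the limit to 0.\<close>

lemma complementarity: "AE \<omega> in M. p t \<omega> \<bullet> constr t xb \<omega> = 0"
proof -
  let ?c = "\<lambda>\<omega>. p t \<omega> \<bullet> constr t xb \<omega>"
  have i: "integrable M ?c"
    by (rule integrable_p_constr[OF mult xbP])
  have "expectation (\<lambda>\<omega>. norm (?c \<omega>)) \<le> 0"
  proof (rule Fatou_norm(2)[where f = "\<lambda>n \<omega>. P n t \<omega> \<bullet> constr t xb \<omega>" and K = "\<lambda>n. 1 / real (Suc n)"])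
    show "integrable M (\<lambda>\<omega>. P n t \<omega> \<bullet> constr t xb \<omega>)" for n
      by (rule integrable_p_constr[OF multn xbP])
    show "(\<lambda>n. 1 / real (Suc n)) \<longlonglongrightarrow> 0"
      by (rule LIMSEQ_Suc[OF lim_1_over_n])
    show "AE \<omega> in M. (\<lambda>n. P n t \<omega> \<bullet> constr t xb \<omega>) \<longlonglongrightarrow> ?c \<omega>"
      using Plim[of t] by eventually_elim (intro tendsto_intros, auto)
    show "?c \<in> borel_measurable M"
      using i by auto
    fix n
    have "expectation (\<lambda>\<omega>. norm (P n t \<omega> \<bullet> constr t xb \<omega>)) = expectation (\<lambda>\<omega>. P n t \<omega> \<bullet> constr t xb \<omega>)"
      using multiplier_constr_nonneg[OF multn, of n t] integrable_p_constr[OF multn xbP, of n t]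
      by (intro integral_cong_AE) auto
    also have "\<dots> \<le> (\<Sum>t\<in>UNIV. expectation (\<lambda>\<omega>. P n t \<omega> \<bullet> constr t xb \<omega>))"
      using expectation_P_constr_nonneg by (intro member_le_sum) auto
    also have "\<dots> \<le> 1 / real (Suc n)"
      by (rule sum_P_constr_le)
    finally show "expectation (\<lambda>\<omega>. norm (P n t \<omega> \<bullet> constr t xb \<omega>)) \<le> 1 / real (Suc n)" .
  qed
  then have "expectation (\<lambda>\<omega>. norm (?c \<omega>)) = 0"
    by (simp add: antisym)
  then show ?thesis
    using integral_nonneg_eq_0_iff_AE[OF integrable_norm[OF i]] by auto
qed

text \<open>The gap inequality is used on the complement of \<open>all_good m\<close>, from which
  mass may escape. There, constraint terms outside \<open>good P j m\<close> are nonnegative by the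
  hypothesis on \<open>x\<close>, and the others are bounded and converge. The terms in
  \<open>Q n\<close> are traded for minus their integral over \<open>all_good m\<close>, as
  \<open>Q n\<close> annihilates adapted programs, and on that event they converge too.\<close>

lemma limit_gap:
  assumes x: "x \<in> adapted_programs"
    and ok: "\<And>j. j \<in> S \<Longrightarrow> AE \<omega> in M. \<omega> \<notin> good P j m \<longrightarrow> le_W j 0 (constr j x \<omega>)"
  shows "0 \<le> expectation (\<lambda>\<omega>. indicat_real (space M - all_good m) \<omega> * (2 * dom f \<omega> + bound * (\<Sum>j\<in>UNIV. norm (p j \<omega>))))
    + expectation (\<lambda>\<omega>. indicat_real (all_good m) \<omega> * (\<Sum>t\<in>UNIV. q t \<omega> \<bullet> (x \<omega> $ t - xb \<omega> $ t)))"
proof -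
  have xP: "x \<in> programs"
    by (rule adapted_programsD(1)[OF x])
  define B where "B = space M - all_good m"
  have B: "B \<in> sets M"
    unfolding B_def using all_good_sets by auto
  define s where "s n \<omega> = (\<Sum>t\<in>UNIV. Q n t \<omega> \<bullet> (x \<omega> $ t - xb \<omega> $ t))" for n \<omega>
  define sl where "sl \<omega> = (\<Sum>t\<in>UNIV. q t \<omega> \<bullet> (x \<omega> $ t - xb \<omega> $ t))" for \<omega>
  define r where "r n j \<omega> = indicat_real (B \<inter> good P j m) \<omega> * norm (P n j \<omega>)" for n j \<omega>
  define rl where "rl j \<omega> = indicat_real (B \<inter> good P j m) \<omega> * norm (p j \<omega>)" for j \<omega>
  have gj: "good P j m \<in> sets M" for j
    by (rule good_sets) (auto intro: measurable_G P_measurable)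
  have si: "integrable M (s n)" for n
    unfolding s_def inner_diff_right using integrable_q_program[OF multn xP] integrable_q_program[OF multn xbP] by simp
  have sli: "integrable M sl"
    unfolding sl_def inner_diff_right using integrable_q_program[OF mult xP] integrable_q_program[OF mult xbP] by simp
  have s0: "expectation (s n) = 0" for n
    unfolding s_def inner_diff_right
    using integrable_q_program[OF multn xP] integrable_q_program[OF multn xbP] Q_adapted_zero[OF x] Q_adapted_zero[OF xb(1)]
    by simp
  have ri: "integrable M (r n j)" for n j
    unfolding r_def using integrable_real_mult_indicator[OF sets.Int[OF B gj] integrable_norm[OF multipliersD(2)[OF multn]]]
    by (simp add: mult.commute)
  have rli: "integrable M (rl j)" for j
    unfolding rl_def using integrable_real_mult_indicator[OF sets.Int[OF B gj] integrable_norm[OF multipliersD(2)[OF mult]]]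
    by (simp add: mult.commute)
  have di: "integrable M (\<lambda>\<omega>. indicat_real B \<omega> * dom f \<omega>)"
    using integrable_real_mult_indicator[OF B integrable_dom[OF f]] by (simp add: mult.commute)
  have gsi: "integrable M (\<lambda>\<omega>. indicat_real (all_good m) \<omega> * s n \<omega>)" for n
    using integrable_real_mult_indicator[OF all_good_sets si] by (simp add: mult.commute)
  have gsli: "integrable M (\<lambda>\<omega>. indicat_real (all_good m) \<omega> * sl \<omega>)"
    using integrable_real_mult_indicator[OF all_good_sets sli] by (simp add: mult.commute)
  have pci: "integrable M (\<lambda>\<omega>. P n j \<omega> \<bullet> constr j xb \<omega>)" for n j
    by (rule integrable_p_constr[OF multn xbP])
  have step: "- (2 * expectation (\<lambda>\<omega>. indicat_real B \<omega> * dom f \<omega>)) - bound * (\<Sum>j\<in>UNIV. expectation (r n j))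
      - expectation (\<lambda>\<omega>. indicat_real (all_good m) \<omega> * s n \<omega>) \<le> 2 * (1 / real (Suc n))" for n
  proof -
    \<comment> \<open>The last two terms are \<open>s n\<close> on \<open>B\<close> and 0 elsewhere,
      written with the full \<open>s n\<close>, whose integral vanishes.\<close>
    let ?lower = "\<lambda>\<omega>. - (2 * (indicat_real B \<omega> * dom f \<omega>)) - bound * (\<Sum>j\<in>UNIV. r n j \<omega>)
      - (\<Sum>j\<in>UNIV. P n j \<omega> \<bullet> constr j xb \<omega>) + s n \<omega> - indicat_real (all_good m) \<omega> * s n \<omega>"
    let ?L = "\<lambda>\<omega>. indicat_real B \<omega> * (lag f (P n) (Q n) \<omega> (x \<omega>) - lag f (P n) (Q n) \<omega> (xb \<omega>))"
    have "AE \<omega> in M. \<forall>j\<in>UNIV. j \<in> S \<longrightarrow> \<omega> \<notin> good P j m \<longrightarrow> le_W j 0 (constr j x \<omega>)"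
      using ok by (intro AE_ball_countable[THEN iffD2]) (auto intro: countable_finite)
    moreover have "AE \<omega> in M. \<forall>j\<in>UNIV. 0 \<le> P n j \<omega> \<bullet> constr j xb \<omega>"
      using multiplier_constr_nonneg[OF multn] by (intro AE_ball_countable[THEN iffD2]) (auto intro: countable_finite)
    ultimately have "AE \<omega> in M. ?lower \<omega> \<le> ?L \<omega>"
      using programsD(4)[OF xP] programsD(4)[OF xbP] AE_space
    proof eventually_elim
      case (elim \<omega>)
      have fd: "\<bar>f \<omega> (x \<omega>)\<bar> \<le> dom f \<omega>" "\<bar>f \<omega> (xb \<omega>)\<bar> \<le> dom f \<omega>"
        using abs_le_dom[OF f elim(5)] elim(3,4) by auto
      show ?case
      proof (cases "\<omega> \<in> B")
        case False
        then have "\<omega> \<in> all_good m"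
          using elim(5) by (simp add: B_def)
        moreover have "0 \<le> (\<Sum>j\<in>UNIV. P n j \<omega> \<bullet> constr j xb \<omega>)"
          using elim(2) by (intro sum_nonneg) auto
        ultimately show ?thesis
          using False by (simp add: r_def)
      next
        case True
        then have ng: "\<omega> \<notin> all_good m"
          by (simp add: B_def)
        have "- (bound * r n j \<omega>) - P n j \<omega> \<bullet> constr j xb \<omega> \<le> P n j \<omega> \<bullet> constr j x \<omega> - P n j \<omega> \<bullet> constr j xb \<omega>" for j
        proof (cases "\<omega> \<in> good P j m")
          case True
          have "norm (P n j \<omega>) * norm (constr j x \<omega>) \<le> norm (P n j \<omega>) * bound"
            using constr_bound[OF xP elim(5)] by (intro mult_left_mono) auto
          then show ?thesis
            using Cauchy_Schwarz_ineq2[of "P n j \<omega>" "constr j x \<omega>"] True \<open>\<omega> \<in> B\<close>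
            by (simp add: r_def mult.commute)
        next
          case False
          have "0 \<le> P n j \<omega> \<bullet> constr j x \<omega>"
          proof (cases "j \<in> S")
            case True
            with elim(1) False have "le_W j 0 (constr j x \<omega>)"
              by blast
            with multipliersD(4,5)[OF multn[of n] elim(5), of j] show ?thesis
              by (intro inner_W_nonneg)
          qed (use multipliersD(6)[OF multn _ elim(5)] in simp)
          then show ?thesis
            using False by (simp add: r_def)
        qed
        then have "(\<Sum>j\<in>UNIV. - (bound * r n j \<omega>) - P n j \<omega> \<bullet> constr j xb \<omega>)
            \<le> (\<Sum>j\<in>UNIV. P n j \<omega> \<bullet> constr j x \<omega> - P n j \<omega> \<bullet> constr j xb \<omega>)"
          by (rule sum_mono)
        then have "- (bound * (\<Sum>j\<in>UNIV. r n j \<omega>)) - (\<Sum>j\<in>UNIV. P n j \<omega> \<bullet> constr j xb \<omega>)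
            \<le> (\<Sum>j\<in>UNIV. P n j \<omega> \<bullet> constr j x \<omega>) - (\<Sum>j\<in>UNIV. P n j \<omega> \<bullet> constr j xb \<omega>)"
          by (simp add: sum_subtractf sum_negf sum_distrib_left)
        moreover have "lag f (P n) (Q n) \<omega> (x \<omega>) - lag f (P n) (Q n) \<omega> (xb \<omega>) = f \<omega> (x \<omega>) - f \<omega> (xb \<omega>)
            + ((\<Sum>j\<in>UNIV. P n j \<omega> \<bullet> constr j x \<omega>) - (\<Sum>j\<in>UNIV. P n j \<omega> \<bullet> constr j xb \<omega>)) + s n \<omega>"
          by (simp add: lag_def s_def constr_def inner_diff_right sum_subtractf)
        ultimately show ?thesis
          using fd True ng by (simp add: abs_le_iff)
      qed
    qed
    then have "expectation ?lower \<le> expectation ?L"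
      using integrable_lag[OF f multn xP, of n] integrable_lag[OF f multn xbP, of n] ri[of n] pci[of n] si[of n] gsi[of n] di B
      by (intro integral_mono_AE) (auto intro!: Bochner_Integration.integrable_sum integrable_real_mult_indicator[unfolded mult.commute[of _ "indicat_real _ _"]])
    also have "\<dots> \<le> 1 / real (Suc n)"
      by (rule local_gap[OF xP B])
    finally have "expectation ?lower \<le> 1 / real (Suc n)" .
    moreover have "expectation ?lower = - (2 * expectation (\<lambda>\<omega>. indicat_real B \<omega> * dom f \<omega>)) - bound * (\<Sum>j\<in>UNIV. expectation (r n j))
      - (\<Sum>j\<in>UNIV. expectation (\<lambda>\<omega>. P n j \<omega> \<bullet> constr j xb \<omega>)) + expectation (s n)
      - expectation (\<lambda>\<omega>. indicat_real (all_good m) \<omega> * s n \<omega>)"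
      using ri[of n] pci[of n] si[of n] gsi[of n] di by simp
    ultimately show ?thesis
      using sum_P_constr_le[of n] s0[of n] by simp
  qed
  have "(\<lambda>n. expectation (\<lambda>\<omega>. indicat_real (all_good m) \<omega> * s n \<omega>))
      \<longlonglongrightarrow> expectation (\<lambda>\<omega>. indicat_real (all_good m) \<omega> * sl \<omega>)"
  proof (rule integral_dominated_convergence[where w = "\<lambda>_. real CARD('b) * (real m * (2 * bound))"])
    show "AE \<omega> in M. (\<lambda>n. indicat_real (all_good m) \<omega> * s n \<omega>) \<longlonglongrightarrow> indicat_real (all_good m) \<omega> * sl \<omega>"
      using limits by eventually_elim (unfold s_def sl_def, intro tendsto_intros, auto)
    show "AE \<omega> in M. norm (indicat_real (all_good m) \<omega> * s n \<omega>) \<le> real CARD('b) * (real m * (2 * bound))" for n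
      using programsD(4)[OF xP] programsD(4)[OF xbP] AE_space
    proof eventually_elim
      case (elim \<omega>)
      show ?case
      proof (cases "\<omega> \<in> all_good m")
        case True
        have "\<bar>Q n t \<omega> \<bullet> (x \<omega> $ t - xb \<omega> $ t)\<bar> \<le> real m * (2 * bound)" for t
        proof -
          have "norm (x \<omega> $ t - xb \<omega> $ t) \<le> 2 * bound"
            using norm_triangle_ineq4[of "x \<omega> $ t" "xb \<omega> $ t"] A_bound[OF elim(3), of "x \<omega> $ t" t]
              A_bound[OF elim(3), of "xb \<omega> $ t" t] elim(1,2) by (simp add: Aprod_def)
          then have "norm (Q n t \<omega>) * norm (x \<omega> $ t - xb \<omega> $ t) \<le> real m * (2 * bound)"
            using all_goodD(2)[OF True] by (intro mult_mono) auto
          then show ?thesis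
            using Cauchy_Schwarz_ineq2[of "Q n t \<omega>" "x \<omega> $ t - xb \<omega> $ t"] by linarith
        qed
        then have "\<bar>s n \<omega>\<bar> \<le> (\<Sum>t\<in>(UNIV::'b set). real m * (2 * bound))"
          unfolding s_def by (intro order_trans[OF sum_abs] sum_mono)
        then show ?thesis
          using True by simp
      qed (use bound_pos in simp)
    qed
  qed (use gsi gsli in auto)
  moreover have "(\<lambda>n. expectation (r n j)) \<longlonglongrightarrow> expectation (rl j)" for j
  proof (rule integral_dominated_convergence[where w = "\<lambda>_. real m"])
    show "AE \<omega> in M. (\<lambda>n. r n j \<omega>) \<longlonglongrightarrow> rl j \<omega>"
      using limits by eventually_elim (unfold r_def rl_def, intro tendsto_intros, auto)
    show "AE \<omega> in M. norm (r n j \<omega>) \<le> real m" for n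
      by (intro AE_I2) (auto simp: r_def good_def indicator_def)
  qed (use ri rli in auto)
  ultimately have "(\<lambda>n. - (2 * expectation (\<lambda>\<omega>. indicat_real B \<omega> * dom f \<omega>)) - bound * (\<Sum>j\<in>UNIV. expectation (r n j))
      - expectation (\<lambda>\<omega>. indicat_real (all_good m) \<omega> * s n \<omega>))
    \<longlonglongrightarrow> - (2 * expectation (\<lambda>\<omega>. indicat_real B \<omega> * dom f \<omega>)) - bound * (\<Sum>j\<in>UNIV. expectation (rl j))
      - expectation (\<lambda>\<omega>. indicat_real (all_good m) \<omega> * sl \<omega>)"
    by (intro tendsto_intros) auto
  moreover have "(\<lambda>n. 2 * (1 / real (Suc n))) \<longlonglongrightarrow> 2 * 0"
    by (intro tendsto_intros LIMSEQ_Suc[OF lim_1_over_n])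
  ultimately have main: "- (2 * expectation (\<lambda>\<omega>. indicat_real B \<omega> * dom f \<omega>)) - bound * (\<Sum>j\<in>UNIV. expectation (rl j))
      - expectation (\<lambda>\<omega>. indicat_real (all_good m) \<omega> * sl \<omega>) \<le> 2 * 0"
    by (rule LIMSEQ_le) (use step in blast)
  define pB where "pB j \<omega> = indicat_real B \<omega> * norm (p j \<omega>)" for j \<omega>
  have pi: "integrable M (pB j)" for j
    unfolding pB_def using integrable_real_mult_indicator[OF B integrable_norm[OF multipliersD(2)[OF mult]]]
    by (simp add: mult.commute)
  have "expectation (rl j) \<le> expectation (pB j)" for j
    using rli[of j] pi[of j] by (intro integral_mono) (auto simp: rl_def pB_def indicator_def)
  then have "bound * (\<Sum>j\<in>UNIV. expectation (rl j)) \<le> bound * (\<Sum>j\<in>UNIV. expectation (pB j))"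
    using bound_pos by (intro mult_left_mono sum_mono) auto
  moreover have "indicat_real B \<omega> * (2 * dom f \<omega> + bound * (\<Sum>j\<in>UNIV. norm (p j \<omega>)))
      = 2 * (indicat_real B \<omega> * dom f \<omega>) + bound * (\<Sum>j\<in>UNIV. pB j \<omega>)" for \<omega>
    unfolding pB_def sum_distrib_left[symmetric] by (simp add: algebra_simps)
  then have "expectation (\<lambda>\<omega>. indicat_real B \<omega> * (2 * dom f \<omega> + bound * (\<Sum>j\<in>UNIV. norm (p j \<omega>))))
      = 2 * expectation (\<lambda>\<omega>. indicat_real B \<omega> * dom f \<omega>) + bound * (\<Sum>j\<in>UNIV. expectation (pB j))"
    using di pi by simp
  ultimately show ?thesis
    using main by (simp add: B_def sl_def)
qed

lemma limit_gap_sequence: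
  assumes x: "x \<in> adapted_programs" and xs: "\<And>m. xs m \<in> adapted_programs"
    and lim: "AE \<omega> in M. (\<lambda>m. xs m \<omega>) \<longlonglongrightarrow> x \<omega>"
    and ok: "\<And>m j. j \<in> S \<Longrightarrow> AE \<omega> in M. \<omega> \<notin> good P j m \<longrightarrow> le_W j 0 (constr j (xs m) \<omega>)"
  shows "0 \<le> expectation (\<lambda>\<omega>. \<Sum>t\<in>UNIV. q t \<omega> \<bullet> (x \<omega> $ t - xb \<omega> $ t))"
proof -
  have xP: "x \<in> programs" and xsP: "\<And>m. xs m \<in> programs"
    using x xs by (auto intro: adapted_programsD)
  define D where "D \<omega> = 2 * dom f \<omega> + bound * (\<Sum>j\<in>UNIV. norm (p j \<omega>))" for \<omega>
  have Di: "integrable M D"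
    unfolding D_def using integrable_dom[OF f] multipliersD(2)[OF mult] by auto
  have si: "integrable M (\<lambda>\<omega>. \<Sum>t\<in>UNIV. q t \<omega> \<bullet> (y \<omega> $ t - xb \<omega> $ t))" if "y \<in> programs" for y
    unfolding inner_diff_right using integrable_q_program[OF mult that] integrable_q_program[OF mult xbP] by simp
  have B: "space M - all_good m \<in> sets M" for m
    using all_good_sets by auto
  have ind: "AE \<omega> in M. (\<lambda>m. indicat_real (all_good m) \<omega>) \<longlonglongrightarrow> 1"
    using AE_all_good
    by eventually_elim (rule tendsto_eventually, auto elim: eventually_mono simp: indicator_def)
  have indc: "AE \<omega> in M. (\<lambda>m. indicat_real (space M - all_good m) \<omega>) \<longlonglongrightarrow> 0"
    using AE_all_good
    by eventually_elim (rule tendsto_eventually, auto elim: eventually_mono simp: indicator_def)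
  have "(\<lambda>m. expectation (\<lambda>\<omega>. indicat_real (space M - all_good m) \<omega> * D \<omega>)) \<longlonglongrightarrow> expectation (\<lambda>\<omega>. 0 * D \<omega>)"
  proof (rule integral_dominated_convergence[where w = "\<lambda>\<omega>. \<bar>D \<omega>\<bar>"])
    show "AE \<omega> in M. (\<lambda>m. indicat_real (space M - all_good m) \<omega> * D \<omega>) \<longlonglongrightarrow> 0 * D \<omega>"
      using indc by eventually_elim (intro tendsto_intros, auto)
    show "AE \<omega> in M. norm (indicat_real (space M - all_good m) \<omega> * D \<omega>) \<le> \<bar>D \<omega>\<bar>" for m
      by (intro AE_I2) (auto simp: indicator_def)
  qed (use Di B in \<open>auto intro!: borel_measurable_times\<close>)
  moreover have "(\<lambda>m. expectation (\<lambda>\<omega>. indicat_real (all_good m) \<omega> * (\<Sum>t\<in>UNIV. q t \<omega> \<bullet> (xs m \<omega> $ t - xb \<omega> $ t))))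
      \<longlonglongrightarrow> expectation (\<lambda>\<omega>. 1 * (\<Sum>t\<in>UNIV. q t \<omega> \<bullet> (x \<omega> $ t - xb \<omega> $ t)))"
  proof (rule integral_dominated_convergence[where w = "\<lambda>\<omega>. \<Sum>t\<in>UNIV. norm (q t \<omega>) * (2 * bound)"])
    show "AE \<omega> in M. (\<lambda>m. indicat_real (all_good m) \<omega> * (\<Sum>t\<in>UNIV. q t \<omega> \<bullet> (xs m \<omega> $ t - xb \<omega> $ t)))
        \<longlonglongrightarrow> 1 * (\<Sum>t\<in>UNIV. q t \<omega> \<bullet> (x \<omega> $ t - xb \<omega> $ t))"
      using ind lim by eventually_elim (intro tendsto_intros, auto)
    show "AE \<omega> in M. norm (indicat_real (all_good m) \<omega> * (\<Sum>t\<in>UNIV. q t \<omega> \<bullet> (xs m \<omega> $ t - xb \<omega> $ t)))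
        \<le> (\<Sum>t\<in>UNIV. norm (q t \<omega>) * (2 * bound))" for m
      using programsD(4)[OF xsP[of m]] programsD(4)[OF xbP] AE_space
    proof eventually_elim
      case (elim \<omega>)
      have "\<bar>q t \<omega> \<bullet> (xs m \<omega> $ t - xb \<omega> $ t)\<bar> \<le> norm (q t \<omega>) * (2 * bound)" for t
      proof -
        have "norm (xs m \<omega> $ t - xb \<omega> $ t) \<le> 2 * bound"
          using norm_triangle_ineq4[of "xs m \<omega> $ t" "xb \<omega> $ t"] A_bound[OF elim(3), of "xs m \<omega> $ t" t]
            A_bound[OF elim(3), of "xb \<omega> $ t" t] elim(1,2) by (simp add: Aprod_def)
        then have "norm (q t \<omega>) * norm (xs m \<omega> $ t - xb \<omega> $ t) \<le> norm (q t \<omega>) * (2 * bound)"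
          by (intro mult_left_mono) auto
        then show ?thesis
          using Cauchy_Schwarz_ineq2[of "q t \<omega>" "xs m \<omega> $ t - xb \<omega> $ t"] by linarith
      qed
      then have "\<bar>\<Sum>t\<in>UNIV. q t \<omega> \<bullet> (xs m \<omega> $ t - xb \<omega> $ t)\<bar> \<le> (\<Sum>t\<in>UNIV. norm (q t \<omega>) * (2 * bound))"
        by (intro order_trans[OF sum_abs] sum_mono)
      moreover have "0 \<le> (\<Sum>t\<in>UNIV. norm (q t \<omega>) * (2 * bound))"
        using bound_pos by (intro sum_nonneg) auto
      ultimately show ?case
        by (simp add: indicator_def)
    qed
  qed (use si[OF xP] si[OF xsP] all_good_sets multipliersD(3)[OF mult] in \<open>auto intro!: borel_measurable_times\<close>)
  ultimately have "(\<lambda>m. expectation (\<lambda>\<omega>. indicat_real (space M - all_good m) \<omega> * D \<omega>)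
      + expectation (\<lambda>\<omega>. indicat_real (all_good m) \<omega> * (\<Sum>t\<in>UNIV. q t \<omega> \<bullet> (xs m \<omega> $ t - xb \<omega> $ t))))
    \<longlonglongrightarrow> expectation (\<lambda>\<omega>. 0 * D \<omega>) + expectation (\<lambda>\<omega>. 1 * (\<Sum>t\<in>UNIV. q t \<omega> \<bullet> (x \<omega> $ t - xb \<omega> $ t)))"
    by (rule tendsto_add)
  then have "0 \<le> expectation (\<lambda>\<omega>. 0 * D \<omega>) + expectation (\<lambda>\<omega>. 1 * (\<Sum>t\<in>UNIV. q t \<omega> \<bullet> (x \<omega> $ t - xb \<omega> $ t)))"
    by (rule LIMSEQ_le_const) (use limit_gap[OF xs ok] in \<open>auto simp: D_def\<close>)
  then show ?thesis
    by simp
qed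

end

subsection \<open>Induction on the set of constraints\<close>

lemma interior_point_exists:
  obtains xi \<theta> where "0 < \<theta>" and "\<And>t \<omega>. \<omega> \<in> space M \<Longrightarrow> cball (xi \<omega> $ t) \<theta> \<inter> V t \<subseteq> A t \<omega>"
    and "\<And>t \<omega>. \<omega> \<in> space M \<Longrightarrow> xi \<omega> $ t \<in> V t"
proof -
  obtain xi \<theta> where xi: "xi \<in> adapted_programs" and \<theta>: "0 < \<theta>"
      "\<And>t \<omega>. \<omega> \<in> space M \<Longrightarrow> cball (xi \<omega> $ t) \<theta> \<inter> V t \<subseteq> A t \<omega>"
    using interior_program by blast
  show ?thesis
    by (rule that[OF \<theta>]) (use programsD(3)[OF adapted_programsD(1)[OF xi]] in auto)
qed

lemma A_sets:
  assumes a: "a \<in> V t"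
  shows "{\<omega> \<in> space M. a \<in> A t \<omega>} \<in> sets (G t)"
proof -
  obtain xi \<theta> where \<theta>: "0 < \<theta>" "\<And>t \<omega>. \<omega> \<in> space M \<Longrightarrow> cball (xi \<omega> $ t) \<theta> \<inter> V t \<subseteq> A t \<omega>"
      "\<And>t \<omega>. \<omega> \<in> space M \<Longrightarrow> xi \<omega> $ t \<in> V t"
    by (rule interior_point_exists) blast
  \<comment> \<open>Nonemptiness matters because the distance to the empty set is 0 by
    convention.\<close>
  have "A t \<omega> \<noteq> {}" if "\<omega> \<in> space M" for \<omega>
    using \<theta>(1,3) \<theta>(2)[OF that, of t] that by (force simp: subset_iff)
  then have "{\<omega> \<in> space M. a \<in> A t \<omega>} = {\<omega> \<in> space (G t). infdist a (A t \<omega>) = 0}"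
    using in_closed_iff_infdist_zero[OF A_closed] by (auto simp: space_G)
  also have "\<dots> \<in> sets (G t)"
    using A_measurable[OF a] by (intro borel_measurable_eq) auto
  finally show ?thesis .
qed

text \<open>These are the objectives that arise in the induction step; the sign turns the cost
  \<open>r\<close> into something to be maximised.\<close>

lemma integrand_linear:
  assumes r: "\<And>t. integrable M (r t)"
  shows "integrand (\<lambda>\<omega> a. - (\<Sum>t\<in>UNIV. r t \<omega> \<bullet> a $ t))"
  unfolding integrand_def
proof (intro conjI ballI allI impI exI)
  have ri: "integrable M (\<lambda>\<omega>. r t \<omega> \<bullet> x \<omega> $ t)" if "x \<in> programs" for x t
    by (rule integrable_inner_AE_bounded(2)[OF r programsD(1)[OF that] program_bound[OF that]])
  then show "(\<lambda>\<omega>. - (\<Sum>t\<in>UNIV. r t \<omega> \<bullet> x \<omega> $ t)) \<in> borel_measurable M" if "x \<in> programs" for x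
    using that by (intro borel_measurable_uminus borel_measurable_sum borel_measurable_integrable)
  have di: "integrable M (\<lambda>\<omega>. \<Sum>t\<in>UNIV. norm (r t \<omega>) * bound)"
    using r by auto
  then show "integrable M (\<lambda>\<omega>. \<Sum>t\<in>UNIV. norm (r t \<omega>) * bound)" .
  have le: "\<bar>- (\<Sum>t\<in>UNIV. r t \<omega> \<bullet> a $ t)\<bar> \<le> (\<Sum>t\<in>UNIV. norm (r t \<omega>) * bound)"
    if "\<omega> \<in> space M" "a \<in> Aprod \<omega>" for \<omega> a
  proof -
    have "\<bar>r t \<omega> \<bullet> a $ t\<bar> \<le> norm (r t \<omega>) * bound" for t
    proof -
      have "norm (a $ t) \<le> bound"
        using A_bound[OF that(1), of "a $ t" t] that(2) by (simp add: Aprod_def)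
      then have "norm (r t \<omega>) * norm (a $ t) \<le> norm (r t \<omega>) * bound"
        by (intro mult_left_mono) auto
      then show ?thesis
        using Cauchy_Schwarz_ineq2[of "r t \<omega>" "a $ t"] by linarith
    qed
    then show ?thesis
      unfolding abs_minus_cancel by (intro order_trans[OF sum_abs] sum_mono)
  qed
  then show "\<bar>- (\<Sum>t\<in>UNIV. r t \<omega> \<bullet> a $ t)\<bar> \<le> (\<Sum>t\<in>UNIV. norm (r t \<omega>) * bound)"
    if "\<omega> \<in> space M" "a \<in> Aprod \<omega>" for \<omega> a
    using that by blast
  show "concave_on (Aprod \<omega>) (\<lambda>a. - (\<Sum>t\<in>UNIV. r t \<omega> \<bullet> a $ t))" if "\<omega> \<in> space M" for \<omega>
    unfolding concave_on_iff using convex_Aprod[OF that]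
    by (simp add: inner_add_right sum.distrib sum_distrib_left)
  fix x and z :: "nat \<Rightarrow> 'a \<Rightarrow> ('c, 'b) vec"
  assume x: "x \<in> programs" and z: "\<forall>k. z k \<in> programs" and lim: "AE \<omega> in M. (\<lambda>k. z k \<omega>) \<longlonglongrightarrow> x \<omega>"
  show "(\<lambda>k. expectation (\<lambda>\<omega>. - (\<Sum>t\<in>UNIV. r t \<omega> \<bullet> z k \<omega> $ t))) \<longlonglongrightarrow> expectation (\<lambda>\<omega>. - (\<Sum>t\<in>UNIV. r t \<omega> \<bullet> x \<omega> $ t))"
  proof (rule integral_dominated_convergence[OF _ _ di])
    show "AE \<omega> in M. (\<lambda>k. - (\<Sum>t\<in>UNIV. r t \<omega> \<bullet> z k \<omega> $ t)) \<longlonglongrightarrow> - (\<Sum>t\<in>UNIV. r t \<omega> \<bullet> x \<omega> $ t)"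
      using lim by eventually_elim (intro tendsto_intros, auto)
    show "AE \<omega> in M. norm (- (\<Sum>t\<in>UNIV. r t \<omega> \<bullet> z k \<omega> $ t)) \<le> (\<Sum>t\<in>UNIV. norm (r t \<omega>) * bound)" for k
      using programsD(4)[OF z[rule_format, of k]] AE_space by eventually_elim (use le in simp)
    show "(\<lambda>\<omega>. - (\<Sum>t\<in>UNIV. r t \<omega> \<bullet> z k \<omega> $ t)) \<in> borel_measurable M" for k
      using ri[OF z[rule_format]] by (intro borel_measurable_uminus borel_measurable_sum borel_measurable_integrable)
    show "(\<lambda>\<omega>. - (\<Sum>t\<in>UNIV. r t \<omega> \<bullet> x \<omega> $ t)) \<in> borel_measurable M"
      using ri[OF x] by (intro borel_measurable_uminus borel_measurable_sum borel_measurable_integrable)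
  qed
qed

text \<open>Since \<open>r t\<close> is measurable in \<open>G t\<close>, so is the event on which a
  fixed point \<open>a\<close> is admissible and cheaper than \<open>xb\<close>; playing
  \<open>a\<close> there keeps the program adapted. Points of a countable dense set then give the
  bound at every admissible point, hence for all programs, adapted or not.\<close>

lemma adapted_linear_minimum:
  assumes r: "\<And>t. integrable M (r t)" "\<And>t. r t \<in> borel_measurable (G t)" and xb: "xb \<in> adapted_programs"
    and min: "\<And>x. x \<in> adapted_programs \<Longrightarrow> 0 \<le> expectation (\<lambda>\<omega>. \<Sum>t\<in>UNIV. r t \<omega> \<bullet> (x \<omega> $ t - xb \<omega> $ t))"
    and x: "x \<in> programs"
  shows "AE \<omega> in M. \<forall>t. r t \<omega> \<bullet> xb \<omega> $ t \<le> r t \<omega> \<bullet> x \<omega> $ t"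
proof -
  have xbP: "xb \<in> programs"
    by (rule adapted_programsD(1)[OF xb])
  obtain xi \<theta> where \<theta>: "0 < \<theta>" "\<And>t \<omega>. \<omega> \<in> space M \<Longrightarrow> cball (xi \<omega> $ t) \<theta> \<inter> V t \<subseteq> A t \<omega>"
      "\<And>t \<omega>. \<omega> \<in> space M \<Longrightarrow> xi \<omega> $ t \<in> V t"
    by (rule interior_point_exists) blast
  have point: "AE \<omega> in M. a \<in> A t \<omega> \<longrightarrow> 0 \<le> r t \<omega> \<bullet> (a - xb \<omega> $ t)" if a: "a \<in> V t" for a t
  proof -
    define B where "B = {\<omega> \<in> space M. a \<in> A t \<omega>} \<inter> {\<omega> \<in> space M. r t \<omega> \<bullet> (a - xb \<omega> $ t) < 0}"
    have "(\<lambda>\<omega>. r t \<omega> \<bullet> (a - xb \<omega> $ t)) \<in> borel_measurable (G t)"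
      using r(2) adapted_programsD(2)[OF xb, of t] by (intro borel_measurable_inner borel_measurable_diff) auto
    then have "{\<omega> \<in> space (G t). r t \<omega> \<bullet> (a - xb \<omega> $ t) < 0} \<in> sets (G t)"
      by (intro borel_measurable_less) auto
    then have B: "B \<in> sets (G t)"
      unfolding B_def space_G by (intro sets.Int A_sets[OF a])
    define y where "y \<omega> = (\<chi> j. if j = t \<and> \<omega> \<in> B then a else xb \<omega> $ j)" for \<omega>
    have ymeas: "(\<lambda>\<omega>. y \<omega> $ j) \<in> borel_measurable (G j)" for j
    proof (cases "j = t")
      case True
      then show ?thesis
        using B adapted_programsD(2)[OF xb, of t] by (auto simp: y_def space_G intro!: measurable_If_set)
    qed (use adapted_programsD(2)[OF xb, of j] in \<open>simp add: y_def\<close>)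
    have "y \<in> programs"
    proof (rule programsI)
      show "y \<omega> $ j \<in> V j" if "\<omega> \<in> space M" for \<omega> j
        using that a programsD(3)[OF xbP] by (auto simp: y_def)
      show "AE \<omega> in M. y \<omega> \<in> Aprod \<omega>"
        using programsD(4)[OF xbP] by eventually_elim (auto simp: Aprod_def y_def B_def)
    qed (rule measurable_G[OF ymeas])
    then have "y \<in> adapted_programs"
      using ymeas by (simp add: adapted_programs_def)
    from min[OF this] have "0 \<le> expectation (\<lambda>\<omega>. \<Sum>j\<in>UNIV. r j \<omega> \<bullet> (y \<omega> $ j - xb \<omega> $ j))" .
    moreover have "(\<Sum>j\<in>UNIV. r j \<omega> \<bullet> (y \<omega> $ j - xb \<omega> $ j)) = indicat_real B \<omega> * (r t \<omega> \<bullet> (a - xb \<omega> $ t))" for \<omega>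
    proof -
      have "(\<Sum>j\<in>UNIV. r j \<omega> \<bullet> (y \<omega> $ j - xb \<omega> $ j)) = (\<Sum>j\<in>UNIV. if j = t then r t \<omega> \<bullet> (y \<omega> $ t - xb \<omega> $ t) else 0)"
        by (intro sum.cong) (auto simp: y_def)
      then show ?thesis
        by (simp add: y_def indicator_def)
    qed
    ultimately have ge: "0 \<le> expectation (\<lambda>\<omega>. indicat_real B \<omega> * (r t \<omega> \<bullet> (a - xb \<omega> $ t)))"
      by simp
    have "integrable M (\<lambda>\<omega>. r t \<omega> \<bullet> (a - xb \<omega> $ t))"
      unfolding inner_diff_right
      using integrable_inner_AE_bounded(2)[OF r(1) programsD(1)[OF xbP] program_bound[OF xbP], of t t] r(1)[of t]
      by simp
    from integrable_real_mult_indicator[OF sets_G[OF B] this]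
    have i: "integrable M (\<lambda>\<omega>. - (indicat_real B \<omega> * (r t \<omega> \<bullet> (a - xb \<omega> $ t))))"
      by (simp add: mult.commute)
    have nn: "0 \<le> - (indicat_real B \<omega> * (r t \<omega> \<bullet> (a - xb \<omega> $ t)))" for \<omega>
      by (auto simp: B_def indicator_def)
    have "0 \<le> expectation (\<lambda>\<omega>. - (indicat_real B \<omega> * (r t \<omega> \<bullet> (a - xb \<omega> $ t))))"
      by (intro integral_nonneg_AE AE_I2 nn)
    with ge have "expectation (\<lambda>\<omega>. - (indicat_real B \<omega> * (r t \<omega> \<bullet> (a - xb \<omega> $ t)))) = 0"
      by simp
    then have "AE \<omega> in M. - (indicat_real B \<omega> * (r t \<omega> \<bullet> (a - xb \<omega> $ t))) = 0"
      using integral_nonneg_eq_0_iff_AE[OF i AE_I2[OF nn]] by blast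
    then show ?thesis
      using AE_space by eventually_elim (auto simp: B_def indicator_def not_less split: if_splits)
  qed
  have "AE \<omega> in M. r t \<omega> \<bullet> xb \<omega> $ t \<le> r t \<omega> \<bullet> x \<omega> $ t" for t
  proof -
    obtain D where D: "countable D" "D \<subseteq> V t" "V t \<subseteq> closure D"
      by (rule countable_dense_subset)
    have "AE \<omega> in M. \<forall>a\<in>D. a \<in> A t \<omega> \<longrightarrow> 0 \<le> r t \<omega> \<bullet> (a - xb \<omega> $ t)"
      using D(1,2) point by (intro AE_ball_countable[THEN iffD2]) auto
    then show ?thesis
      using programsD(4)[OF x] AE_space
    proof eventually_elim
      case (elim \<omega>)
      have xA: "x \<omega> $ t \<in> A t \<omega>"
        using elim(2) by (simp add: Aprod_def)
      have "- (r t \<omega> \<bullet> x \<omega> $ t) \<le> - (r t \<omega> \<bullet> xb \<omega> $ t)"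
      proof (rule concave_bounded_by_dense[where l = "\<lambda>a. - (r t \<omega> \<bullet> a)" and K = "norm (r t \<omega>) * bound",
            OF _ subspace_V A_subset[OF elim(3)] D(3,2) \<theta>(1) \<theta>(2)[OF elim(3)] \<theta>(3)[OF elim(3)] _ _ xA])
        show "concave_on (A t \<omega>) (\<lambda>a. - (r t \<omega> \<bullet> a))"
          unfolding concave_on_iff using A_convex[OF elim(3)] by (simp add: inner_add_right)
        show "- (norm (r t \<omega>) * bound) \<le> - (r t \<omega> \<bullet> a)" if "a \<in> A t \<omega>" for a
        proof -
          have "norm (r t \<omega>) * norm a \<le> norm (r t \<omega>) * bound"
            using A_bound[OF elim(3) that] by (intro mult_left_mono) auto
          then show ?thesis
            using Cauchy_Schwarz_ineq2[of "r t \<omega>" a] by linarith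
        qed
        show "- (r t \<omega> \<bullet> d) \<le> - (r t \<omega> \<bullet> xb \<omega> $ t)" if "d \<in> D" "d \<in> A t \<omega>" for d
          using elim(1) that by (auto simp: inner_diff_right)
      qed
      then show ?case
        by simp
    qed
  qed
  then have "AE \<omega> in M. \<forall>t\<in>UNIV. r t \<omega> \<bullet> xb \<omega> $ t \<le> r t \<omega> \<bullet> x \<omega> $ t"
    by (intro AE_ball_countable[THEN iffD2]) (auto intro: countable_finite)
  then show ?thesis
    by simp
qed

text \<open>The objective is arbitrary in the induction because the step replaces it by a linear
  one, while \<open>xb\<close> stays fixed. That \<open>S\<close> is closed under predecessors makes
  a program that meets the remaining constraints feasible before a maximal \<open>t\<close>.\<close>

lemma multipliers_exist:
  fixes S :: "'b set"
  assumes "\<And>s t. t \<in> S \<Longrightarrow> s < t \<Longrightarrow> s \<in> S" and "integrand f"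
    and "xb \<in> adapted_programs" and "\<And>t. t \<in> S \<Longrightarrow> satisfies_constraint t xb"
    and "\<And>x. x \<in> adapted_programs \<Longrightarrow> (\<And>t. t \<in> S \<Longrightarrow> satisfies_constraint t x) \<Longrightarrow> obj f x \<le> obj f xb"
  shows "\<exists>p q. multipliers S p q \<and> (\<forall>t. orthogonal_to (G t) (q t)) \<and>
    (\<forall>x\<in>programs. AE \<omega> in M. lag f p q \<omega> (x \<omega>) \<le> lag f p q \<omega> (xb \<omega>)) \<and>
    (\<forall>t. AE \<omega> in M. p t \<omega> \<bullet> constr t xb \<omega> = 0)"
  using finite[of S] assms
proof (induction S arbitrary: f rule: finite_psubset_induct)
  case (psubset S)
  note down = psubset.prems(1) and f = psubset.prems(2) and xb = psubset.prems(3,4) and opt = psubset.prems(5)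
  obtain P Q p q where multn: "\<And>n. multipliers S (P n) (Q n)" and orth: "\<And>n t. orthogonal_to (G t) (Q n t)"
    and gap: "\<And>n x. x \<in> programs \<Longrightarrow> expectation (\<lambda>\<omega>. lag f (P n) (Q n) \<omega> (x \<omega>)) \<le> obj f xb + 1 / real (Suc n)"
    and mult: "multipliers S p q" and Plim: "\<And>t. AE \<omega> in M. (\<lambda>n. P n t \<omega>) \<longlonglongrightarrow> p t \<omega>"
    and Qlim: "\<And>t. AE \<omega> in M. (\<lambda>n. Q n t \<omega>) \<longlonglongrightarrow> q t \<omega>"
    by (rule multiplier_sequence[OF f opt xb refl]) (assumption | blast)+
  note seq = f xb refl multn orth gap mult Plim Qlim
  have lag_le: "AE \<omega> in M. lag f p q \<omega> (x \<omega>) \<le> lag f p q \<omega> (xb \<omega>)" if "x \<in> programs" for x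
    by (rule lag_limit_le[OF seq that])
  have compl: "AE \<omega> in M. p t \<omega> \<bullet> constr t xb \<omega> = 0" for t
    by (rule complementarity[OF seq])
  define r where "r t = vec_cond_exp M (G t) (q t)" for t
  note qi = multipliersD(3)[OF mult]
  have ri: "integrable M (r t)" and rm: "r t \<in> borel_measurable (G t)" for t
    unfolding r_def by (rule integrable_vec_cond_exp[OF subalgebra_G qi], rule vec_cond_exp_measurable[OF subalgebra_G])
  have qr: "orthogonal_to (G t) (\<lambda>\<omega>. q t \<omega> - r t \<omega>)" for t
    unfolding r_def by (rule orthogonal_to_diff_vec_cond_exp[OF subalgebra_G qi])
  \<comment> \<open>Adapted programs see only the conditional expectation \<open>r\<close> of
    \<open>q\<close>.\<close>
  have Er: "expectation (\<lambda>\<omega>. \<Sum>t\<in>UNIV. q t \<omega> \<bullet> (x \<omega> $ t - xb \<omega> $ t))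
      = expectation (\<lambda>\<omega>. \<Sum>t\<in>UNIV. r t \<omega> \<bullet> (x \<omega> $ t - xb \<omega> $ t))" if x: "x \<in> adapted_programs" for x
  proof -
    have z: "expectation (\<lambda>\<omega>. q t \<omega> \<bullet> y \<omega> $ t) = expectation (\<lambda>\<omega>. r t \<omega> \<bullet> y \<omega> $ t)"
      and i: "integrable M (\<lambda>\<omega>. q t \<omega> \<bullet> y \<omega> $ t)" "integrable M (\<lambda>\<omega>. r t \<omega> \<bullet> y \<omega> $ t)"
      if "y \<in> adapted_programs" for y t
    proof -
      have y: "y \<in> programs"
        by (rule adapted_programsD(1)[OF that])
      show i: "integrable M (\<lambda>\<omega>. q t \<omega> \<bullet> y \<omega> $ t)" "integrable M (\<lambda>\<omega>. r t \<omega> \<bullet> y \<omega> $ t)"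
        by (rule integrable_inner_AE_bounded(2)[OF qi programsD(1)[OF y] program_bound[OF y]],
            rule integrable_inner_AE_bounded(2)[OF ri programsD(1)[OF y] program_bound[OF y]])
      show "expectation (\<lambda>\<omega>. q t \<omega> \<bullet> y \<omega> $ t) = expectation (\<lambda>\<omega>. r t \<omega> \<bullet> y \<omega> $ t)"
        using orthogonal_toD[OF qr adapted_programsD(2)[OF that] program_bound[OF y], of t] i
        by (simp add: inner_diff_left)
    qed
    show ?thesis
      unfolding inner_diff_right using z[OF x] z[OF xb(1)] i[OF x] i[OF xb(1)] by simp
  qed
  show ?case
  proof (cases "S = {}")
    case True
    \<comment> \<open>Without constraints nothing has to be corrected, and the constant sequence
      serves.\<close>
    have nn: "0 \<le> expectation (\<lambda>\<omega>. \<Sum>t\<in>UNIV. r t \<omega> \<bullet> (x \<omega> $ t - xb \<omega> $ t))" if "x \<in> adapted_programs" for x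
      unfolding Er[OF that, symmetric]
      by (rule limit_gap_sequence[OF seq that, of "\<lambda>_. x"]) (use that True in auto)
    have min: "AE \<omega> in M. \<forall>t. r t \<omega> \<bullet> xb \<omega> $ t \<le> r t \<omega> \<bullet> x \<omega> $ t" if "x \<in> programs" for x
      by (rule adapted_linear_minimum[OF ri rm xb(1) _ that], rule nn)
    have lag_eq: "lag f p (\<lambda>t \<omega>. q t \<omega> - r t \<omega>) \<omega> a = lag f p q \<omega> a - (\<Sum>t\<in>UNIV. r t \<omega> \<bullet> a $ t)" for \<omega> a
      by (simp add: lag_def inner_diff_left sum_subtractf)
    show ?thesis
    proof (intro exI conjI ballI allI)
      show "multipliers S p (\<lambda>t \<omega>. q t \<omega> - r t \<omega>)"
        using mult ri by (simp add: multipliers_def)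
      show "orthogonal_to (G t) (\<lambda>\<omega>. q t \<omega> - r t \<omega>)" for t
        by (rule qr)
      show "AE \<omega> in M. p t \<omega> \<bullet> constr t xb \<omega> = 0" for t
        by (rule compl)
      fix x assume x: "x \<in> programs"
      show "AE \<omega> in M. lag f p (\<lambda>t \<omega>. q t \<omega> - r t \<omega>) \<omega> (x \<omega>) \<le> lag f p (\<lambda>t \<omega>. q t \<omega> - r t \<omega>) \<omega> (xb \<omega>)"
        using lag_le[OF x] min[OF x] unfolding lag_eq
        by eventually_elim (intro diff_mono sum_mono, auto)
    qed
  next
    case False
    obtain t where t: "t \<in> S" "\<And>s. s \<in> S \<Longrightarrow> t \<le> s \<Longrightarrow> s = t"
      using finite_has_maximal[OF psubset.hyps False] by metis
    define S' where "S' = S - {t}"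
    have S': "S' \<subset> S"
      using t(1) by (auto simp: S'_def)
    define f' where "f' \<omega> a = - (\<Sum>t\<in>UNIV. r t \<omega> \<bullet> a $ t)" for \<omega> and a :: "('c, 'b) vec"
    have f': "integrand f'"
      unfolding f'_def[abs_def] by (rule integrand_linear[OF ri])
    have opt': "obj f' x \<le> obj f' xb"
      if x: "x \<in> adapted_programs" and xS: "\<And>s. s \<in> S' \<Longrightarrow> satisfies_constraint s x" for x
    proof -
      have "feasible_before t x"
        unfolding feasible_before_def using x xS down[OF t(1)] by (auto simp: S'_def)
      from feasible_correction[OF this] obtain y where y: "y \<in> adapted_programs"
        "\<And>j \<omega>. j \<noteq> t \<Longrightarrow> \<omega> \<in> space M \<Longrightarrow> y \<omega> $ j = x \<omega> $ j" "satisfies_constraint t y"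
        by blast
      \<comment> \<open>The corrected decision is used only where some \<open>P n t\<close> exceeds
        \<open>m\<close>; almost every point is eventually outside that event, so the correction
        disappears in the limit.\<close>
      define xs where "xs m \<omega> = (\<chi> j. if \<omega> \<in> (if j = t then good P t m else space M) then x \<omega> $ j else y \<omega> $ j)" for m \<omega>
      have gt: "good P t m \<in> sets (G t)" for m
        by (rule good_sets) (auto simp: space_G intro: multipliersD(1)[OF multn])
      have xs: "xs m \<in> adapted_programs" for m
        unfolding xs_def[abs_def]
        by (rule switch_adapted[OF x y(1)]) (use gt sets.top[of "G _"] in \<open>auto simp: space_G\<close>)
      have lim: "AE \<omega> in M. (\<lambda>m. xs m \<omega>) \<longlonglongrightarrow> x \<omega>"
        using AE_eventually_good[where R = P, OF Plim[of t]] AE_space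
      proof eventually_elim
        case (elim \<omega>)
        have "\<forall>\<^sub>F m in sequentially. xs m \<omega> = x \<omega>"
          using elim(1) by eventually_elim (use elim(2) in \<open>simp add: xs_def vec_eq_iff\<close>)
        then show ?case
          by (rule tendsto_eventually)
      qed
      have ok: "AE \<omega> in M. \<omega> \<notin> good P j m \<longrightarrow> le_W j 0 (constr j (xs m) \<omega>)" if j: "j \<in> S" for j m
      proof (cases "j = t")
        case True
        show ?thesis
          using y(3)[unfolded satisfies_constraint_iff] AE_space
        proof eventually_elim
          case (elim \<omega>)
          have "past t (xs m \<omega>) = past t (y \<omega>)" if "\<omega> \<notin> good P t m"
            using that y(2)[OF _ elim(2)] elim(2) by (intro past_cong) (auto simp: xs_def)
          then show ?case
            using elim(1) True by (auto simp: constr_def)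
        qed
      next
        case False
        then have "j \<in> S'"
          using j by (simp add: S'_def)
        from xS[OF this, unfolded satisfies_constraint_iff] AE_space show ?thesis
        proof eventually_elim
          case (elim \<omega>)
          \<comment> \<open>By maximality \<open>t\<close> does not precede \<open>j\<close>, so the
            change of decision at \<open>t\<close> leaves this constraint untouched.\<close>
          have "i \<noteq> t" if "i \<le> j" for i
            using t(2)[OF j] that False by auto
          then have "past j (xs m \<omega>) = past j (x \<omega>)"
            using elim(2) by (intro past_cong) (auto simp: xs_def)
          then show ?case
            using elim(1) by (simp add: constr_def)
        qed
      qed
      have "0 \<le> expectation (\<lambda>\<omega>. \<Sum>t\<in>UNIV. r t \<omega> \<bullet> (x \<omega> $ t - xb \<omega> $ t))"
        unfolding Er[OF x, symmetric] by (rule limit_gap_sequence[OF seq x xs lim ok])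
      also have "\<dots> = expectation (\<lambda>\<omega>. f' \<omega> (xb \<omega>) - f' \<omega> (x \<omega>))"
        by (simp add: f'_def inner_diff_right sum_subtractf)
      also have "\<dots> = obj f' xb - obj f' x"
        unfolding obj_def
        using integrable_integrand[OF f' adapted_programsD(1)[OF x]] integrable_integrand[OF f' adapted_programsD(1)[OF xb(1)]]
        by simp
      finally show ?thesis
        by simp
    qed
    have down': "\<And>s u. u \<in> S' \<Longrightarrow> s < u \<Longrightarrow> s \<in> S'"
      using down t(2) by (auto simp: S'_def)
    have "\<exists>p q. multipliers S' p q \<and> (\<forall>t. orthogonal_to (G t) (q t)) \<and>
        (\<forall>x\<in>programs. AE \<omega> in M. lag f' p q \<omega> (x \<omega>) \<le> lag f' p q \<omega> (xb \<omega>)) \<and>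
        (\<forall>t. AE \<omega> in M. p t \<omega> \<bullet> constr t xb \<omega> = 0)"
    proof (rule psubset.IH[OF S'])
      show "s \<in> S'" if "u \<in> S'" "s < u" for s u
        by (rule down'[OF that])
      show "satisfies_constraint s xb" if "s \<in> S'" for s
        using xb(2)[of s] that by (simp add: S'_def)
      show "obj f' x \<le> obj f' xb" if "x \<in> adapted_programs" "\<And>s. s \<in> S' \<Longrightarrow> satisfies_constraint s x" for x
        by (rule opt'[OF that])
    qed (rule f' xb(1))+
    then obtain p' q' where mult': "multipliers S' p' q'" and orth': "\<And>t. orthogonal_to (G t) (q' t)"
      and lag': "\<And>x. x \<in> programs \<Longrightarrow> AE \<omega> in M. lag f' p' q' \<omega> (x \<omega>) \<le> lag f' p' q' \<omega> (xb \<omega>)"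
      and compl': "\<And>t. AE \<omega> in M. p' t \<omega> \<bullet> constr t xb \<omega> = 0"
      by blast
    define pn where "pn t \<omega> = p t \<omega> + p' t \<omega>" for t \<omega>
    \<comment> \<open>Only the orthogonal part of \<open>q t\<close> is kept; the removed cost
      \<open>r\<close> is exactly what \<open>f'\<close> charges, so the two Lagrangians add
      up.\<close>
    define qn where "qn t \<omega> = (q t \<omega> - r t \<omega>) + q' t \<omega>" for t \<omega>
    have lag_eq: "lag f pn qn \<omega> a = lag f p q \<omega> a + lag f' p' q' \<omega> a" for \<omega> a
      by (simp add: lag_def pn_def qn_def f'_def inner_add_left inner_diff_left sum.distrib sum_subtractf)
    show ?thesis
    proof (intro exI conjI ballI allI)
      have "multipliers S p (\<lambda>t \<omega>. q t \<omega> - r t \<omega>)"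
        using mult ri by (simp add: multipliers_def)
      from multipliers_lin[OF this mult', of 1 1 1 1] S' show "multipliers S pn qn"
        by (simp add: pn_def[abs_def] qn_def[abs_def] psubset_imp_subset)
      show "orthogonal_to (G t) (qn t)" for t
        using orthogonal_to_lin[OF subalgebra_G _ multipliersD(3)[OF mult'] qr orth', of t 1 1] qi ri
        by (simp add: qn_def[abs_def])
      show "AE \<omega> in M. pn t \<omega> \<bullet> constr t xb \<omega> = 0" for t
        using compl[of t] compl'[of t] by eventually_elim (simp add: pn_def inner_add_left)
      fix x assume x: "x \<in> programs"
      show "AE \<omega> in M. lag f pn qn \<omega> (x \<omega>) \<le> lag f pn qn \<omega> (xb \<omega>)"
        using lag_le[OF x] lag'[OF x] unfolding lag_eq by eventually_elim simp
    qed
  qed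
qed

text \<open>The exceptional null sets of the individual programs are reduced to a single one by
  testing countably many constants, each played where it is admissible. Concavity and the interior
  ball then extend the bound from the dense set to all of \<open>Aprod \<omega>\<close>.\<close>

lemma pointwise_maximum:
  assumes f: "integrand f" and mult: "multipliers S p q" and xb: "xb \<in> programs"
    and le: "\<And>x. x \<in> programs \<Longrightarrow> AE \<omega> in M. lag f p q \<omega> (x \<omega>) \<le> lag f p q \<omega> (xb \<omega>)"
  shows "AE \<omega> in M. \<forall>a\<in>Aprod \<omega>. lag f p q \<omega> a \<le> lag f p q \<omega> (xb \<omega>)"
proof -
  obtain xi \<theta> where \<theta>: "0 < \<theta>" "\<And>t \<omega>. \<omega> \<in> space M \<Longrightarrow> cball (xi \<omega> $ t) \<theta> \<inter> V t \<subseteq> A t \<omega>"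
      "\<And>t \<omega>. \<omega> \<in> space M \<Longrightarrow> xi \<omega> $ t \<in> V t"
    by (rule interior_point_exists) blast
  obtain D where D: "countable D" "D \<subseteq> Vprod" "Vprod \<subseteq> closure D"
    by (rule countable_dense_subset)
  have "AE \<omega> in M. d \<in> Aprod \<omega> \<longrightarrow> lag f p q \<omega> d \<le> lag f p q \<omega> (xb \<omega>)" if d: "d \<in> D" for d
  proof -
    have dV: "d $ t \<in> V t" for t
      using d D(2) by (auto simp: Vprod_def)
    define B where "B = {\<omega> \<in> space M. d \<in> Aprod \<omega>}"
    have "B = (\<Inter>t. {\<omega> \<in> space M. d $ t \<in> A t \<omega>})"
      by (auto simp: B_def Aprod_def)
    then have B: "B \<in> sets M"
      using sets_G[OF A_sets[OF dV]] by (auto intro!: sets.finite_INT)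
    define x where "x \<omega> = (if \<omega> \<in> B then d else xb \<omega>)" for \<omega>
    have "x \<in> programs"
    proof (rule programsI)
      show "(\<lambda>\<omega>. x \<omega> $ t) \<in> borel_measurable M" for t
        using B programsD(1)[OF xb, of t] by (auto simp: x_def if_distrib[of "\<lambda>v. v $ t"] intro!: measurable_If_set)
      show "x \<omega> $ t \<in> V t" if "\<omega> \<in> space M" for \<omega> t
        using dV programsD(3)[OF xb that] by (simp add: x_def)
      show "AE \<omega> in M. x \<omega> \<in> Aprod \<omega>"
        using programsD(4)[OF xb] by eventually_elim (auto simp: x_def B_def)
    qed
    from le[OF this] AE_space show ?thesis
      by eventually_elim (auto simp: x_def B_def split: if_splits)
  qed
  then have "AE \<omega> in M. \<forall>d\<in>D. d \<in> Aprod \<omega> \<longrightarrow> lag f p q \<omega> d \<le> lag f p q \<omega> (xb \<omega>)"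
    using D(1) by (intro AE_ball_countable[THEN iffD2]) auto
  then show ?thesis
    using AE_space
  proof eventually_elim
    case (elim \<omega>)
    have ball: "cball (xi \<omega>) \<theta> \<inter> Vprod \<subseteq> Aprod \<omega>"
    proof
      fix a assume a: "a \<in> cball (xi \<omega>) \<theta> \<inter> Vprod"
      have "dist (xi \<omega> $ t) (a $ t) \<le> \<theta>" for t
        using dist_vec_nth_le[of "xi \<omega>" t a] a by simp
      then show "a \<in> Aprod \<omega>"
        using a \<theta>(2)[OF elim(2)] by (auto simp: Aprod_def Vprod_def subset_iff)
    qed
    show ?case
    proof
      fix a assume a: "a \<in> Aprod \<omega>"
      show "lag f p q \<omega> a \<le> lag f p q \<omega> (xb \<omega>)"
      proof (rule concave_bounded_by_dense[OF concave_lag[OF f mult elim(2)] subspace_Vprod Aprod_subset[OF elim(2)] D(3,2) \<theta>(1) ball _ _ _ a])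
        show "xi \<omega> \<in> Vprod"
          using \<theta>(3)[OF elim(2)] by (simp add: Vprod_def)
        show "- (dom f \<omega> + (\<Sum>t\<in>UNIV. norm (p t \<omega>) * bound) + (\<Sum>t\<in>UNIV. norm (q t \<omega>) * bound)) \<le> lag f p q \<omega> a"
          if "a \<in> Aprod \<omega>" for a
          using abs_lag_le[OF f elim(2) that, of p q] by linarith
        show "lag f p q \<omega> d \<le> lag f p q \<omega> (xb \<omega>)" if "d \<in> D" "d \<in> Aprod \<omega>" for d
          using elim(1) that by blast
      qed
    qed
  qed
qed

end

subsection \<open>Integral objectives\<close>

context integral_objective
begin

definition extended_f :: "'a \<Rightarrow> ('v, 't) vec \<Rightarrow> real" where
  "extended_f \<omega> a = (if a \<in> Aprod \<omega> then f \<omega> a else 0)"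

lemma obj_extended_f: "x \<in> programs \<Longrightarrow> obj extended_f x = F x"
  by (simp add: obj_def extended_f_def F_eq)

lemma integrand_extended_f: "integrand extended_f"
  unfolding integrand_def
proof (intro conjI ballI allI impI)
  fix x assume x: "x \<in> programs"
  have "x \<in> measurable M (restrict_space borel Vprod)"
    using programsD(2,5)[OF x] by (intro measurable_restrict_space2) auto
  then have "(\<lambda>\<omega>. (\<omega>, x \<omega>)) \<in> measurable M (M \<Otimes>\<^sub>M restrict_space borel Vprod)"
    by simp
  from measurable_compose[OF this f_measurable]
  have "(\<lambda>\<omega>. if x \<omega> \<in> Aprod \<omega> then ereal (f \<omega> (x \<omega>)) else \<infinity>) \<in> borel_measurable M"
    by simp
  \<comment> \<open>\<open>real_of_ereal\<close> sends infinity to 0, which is the value of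
    \<open>extended_f\<close> off \<open>Aprod\<close>.\<close>
  then have "(\<lambda>\<omega>. real_of_ereal (if x \<omega> \<in> Aprod \<omega> then ereal (f \<omega> (x \<omega>)) else \<infinity>)) \<in> borel_measurable M"
    by measurable
  moreover have "(\<lambda>\<omega>. real_of_ereal (if x \<omega> \<in> Aprod \<omega> then ereal (f \<omega> (x \<omega>)) else \<infinity>)) = (\<lambda>\<omega>. extended_f \<omega> (x \<omega>))"
    by (auto simp: extended_f_def)
  ultimately show "(\<lambda>\<omega>. extended_f \<omega> (x \<omega>)) \<in> borel_measurable M"
    by simp
next
  fix \<omega> assume \<omega>: "\<omega> \<in> space M"
  show "concave_on (Aprod \<omega>) (extended_f \<omega>)"
    using f_concave[OF \<omega>] convex_Aprod[OF \<omega>] convexD[OF convex_Aprod[OF \<omega>]]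
    by (simp add: concave_on_iff extended_f_def)
next
  show "\<exists>d. integrable M d \<and> (\<forall>\<omega>\<in>space M. \<forall>a\<in>Aprod \<omega>. \<bar>extended_f \<omega> a\<bar> \<le> d \<omega>)"
    using f_bounded by (simp add: extended_f_def)
next
  fix x and z :: "nat \<Rightarrow> 'a \<Rightarrow> ('v, 't) vec"
  assume "x \<in> programs" "\<forall>k. z k \<in> programs" "AE \<omega> in M. (\<lambda>k. z k \<omega>) \<longlonglongrightarrow> x \<omega>"
  then show "(\<lambda>k. expectation (\<lambda>\<omega>. extended_f \<omega> (z k \<omega>))) \<longlonglongrightarrow> expectation (\<lambda>\<omega>. extended_f \<omega> (x \<omega>))"
    using F_continuous[of x z] obj_extended_f by (simp add: obj_def)
qed

text \<open>The induction does not keep \<open>q\<close> in \<open>V t\<close>. Projecting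
  afterwards changes neither the Lagrangian on \<open>Vprod\<close>, as the projection is symmetric,
  nor the orthogonality.\<close>

lemma solution_multipliers:
  assumes xb: "solution xb"
  obtains p q where "multipliers UNIV p q" and "\<And>t. orthogonal_to (G t) (q t)" and "\<And>t \<omega>. q t \<omega> \<in> V t"
    and "AE \<omega> in M. \<forall>a\<in>Aprod \<omega>. lag extended_f p q \<omega> a \<le> lag extended_f p q \<omega> (xb \<omega>)"
    and "\<And>t. AE \<omega> in M. p t \<omega> \<bullet> constr t xb \<omega> = 0"
proof -
  have xbA: "xb \<in> adapted_programs" and sat: "\<And>t. satisfies_constraint t xb"
    and best: "\<And>y. feasible y \<Longrightarrow> F y \<le> F xb"
    using xb by (auto simp: solution_def feasible_def)
  have xbP: "xb \<in> programs"
    by (rule adapted_programsD(1)[OF xbA])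
  have opt: "obj extended_f x \<le> obj extended_f xb"
    if "x \<in> adapted_programs" "\<And>t. t \<in> UNIV \<Longrightarrow> satisfies_constraint t x" for x
    using best[of x] that xbP by (simp add: obj_extended_f feasible_def adapted_programsD(1))
  have "\<exists>p q. multipliers UNIV p q \<and> (\<forall>t. orthogonal_to (G t) (q t)) \<and>
      (\<forall>x\<in>programs. AE \<omega> in M. lag extended_f p q \<omega> (x \<omega>) \<le> lag extended_f p q \<omega> (xb \<omega>)) \<and>
      (\<forall>t. AE \<omega> in M. p t \<omega> \<bullet> constr t xb \<omega> = 0)"
    by (rule multipliers_exist[OF UNIV_I integrand_extended_f xbA sat], rule opt)
  then obtain p q where mult: "multipliers UNIV p q" and orth: "\<And>t. orthogonal_to (G t) (q t)"
    and le: "\<And>x. x \<in> programs \<Longrightarrow> AE \<omega> in M. lag extended_f p q \<omega> (x \<omega>) \<le> lag extended_f p q \<omega> (xb \<omega>)"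
    and compl: "\<And>t. AE \<omega> in M. p t \<omega> \<bullet> constr t xb \<omega> = 0"
    by blast
  have "\<exists>P. bounded_linear P \<and> (\<forall>v. P v \<in> V t) \<and> (\<forall>v\<in>V t. P v = v) \<and> (\<forall>v w. P v \<bullet> w = v \<bullet> P w)" for t
    by (rule linear_retraction_exists[OF subspace_V, of t]) blast
  then obtain P where P: "\<And>t. bounded_linear (P t)" "\<And>t v. P t v \<in> V t" "\<And>t v. v \<in> V t \<Longrightarrow> P t v = v"
      "\<And>t v w. P t v \<bullet> w = v \<bullet> P t w"
    by metis
  define q' where "q' t \<omega> = P t (q t \<omega>)" for t \<omega>
  have mult': "multipliers UNIV p q'"
    using mult integrable_bounded_linear[OF P(1) multipliersD(3)[OF mult]]
    by (simp add: multipliers_def q'_def[abs_def])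
  have eq: "lag extended_f p q' \<omega> a = lag extended_f p q \<omega> a" if "a \<in> Vprod" for \<omega> a
    using that P(3) by (simp add: lag_def q'_def P(4) Vprod_def)
  show ?thesis
  proof (rule that[OF mult'])
    show "orthogonal_to (G t) (q' t)" for t
      unfolding q'_def[abs_def] by (rule orthogonal_to_retraction[OF P(1) P(4) orth])
    show "q' t \<omega> \<in> V t" for t \<omega>
      by (simp add: q'_def P(2))
    show "AE \<omega> in M. \<forall>a\<in>Aprod \<omega>. lag extended_f p q' \<omega> a \<le> lag extended_f p q' \<omega> (xb \<omega>)"
    proof (rule pointwise_maximum[OF integrand_extended_f mult' xbP])
      fix x assume x: "x \<in> programs"
      show "AE \<omega> in M. lag extended_f p q' \<omega> (x \<omega>) \<le> lag extended_f p q' \<omega> (xb \<omega>)"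
        using le[OF x] AE_space by eventually_elim (simp add: eq programsD(2)[OF x] programsD(2)[OF xbP])
    qed
  qed (rule compl)
qed

text \<open>The conditional expectation of a program is bounded and measurable in
  \<open>G t\<close>, so an orthogonal \<open>q t\<close> annihilates it.\<close>

lemma Lagrangian_eq:
  assumes mult: "multipliers UNIV p q" and orth: "\<And>t. orthogonal_to (G t) (q t)" and x: "x \<in> programs"
  shows "Lagrangian p q x = expectation (\<lambda>\<omega>. lag extended_f p q \<omega> (x \<omega>))"
proof -
  have "expectation (\<lambda>\<omega>. q t \<omega> \<bullet> (x \<omega> $ t - vec_cond_exp M (G t) (\<lambda>\<omega>'. x \<omega>' $ t) \<omega>))
      = expectation (\<lambda>\<omega>. q t \<omega> \<bullet> x \<omega> $ t)" for t
  proof -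
    let ?e = "vec_cond_exp M (G t) (\<lambda>\<omega>'. x \<omega>' $ t)"
    have e: "AE \<omega> in M. norm (?e \<omega>) \<le> real DIM('v) * bound"
      by (rule norm_vec_cond_exp_bounded[OF subalgebra_G programsD(1)[OF x] program_bound[OF x]])
    have em: "?e \<in> borel_measurable (G t)"
      by (rule vec_cond_exp_measurable[OF subalgebra_G])
    show ?thesis
      using orthogonal_toD[OF orth em e] integrable_q_program[OF mult x, of t]
        integrable_inner_AE_bounded(2)[OF multipliersD(3)[OF mult] measurable_G[OF em] e, of t]
      by (simp add: inner_diff_right)
  qed
  then show ?thesis
    unfolding Lagrangian_def expectation_lag[OF integrand_extended_f mult x]
    by (simp add: obj_extended_f[OF x] constr_def)
qed

text \<open>The multipliers are built from one solution \<open>xb\<close> but serve all of them: any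
  solution \<open>x\<close> has the same value, its expected Lagrangian is that value plus
  nonnegative complementarity terms, and the maximum at \<open>xb\<close> forces these terms to
  vanish. Then the Lagrangians at \<open>x\<close> and \<open>xb\<close> have equal integrals and
  are ordered pointwise, hence agree almost surely.\<close>

lemma Lagrange_multipliers_exist:
  "\<exists>p q. Lagrange_multipliers p q \<and>
    (\<forall>xbar. solution xbar \<longrightarrow>
      (AE \<omega> in M. xbar \<omega> \<in> Aprod \<omega> \<and>
        (\<forall>a\<in>Aprod \<omega>. reduced_Lagrangian p q \<omega> a \<le> reduced_Lagrangian p q \<omega> (xbar \<omega>))) \<and>
      (\<forall>t. AE \<omega> in M. p t \<omega> \<bullet> g t \<omega> (past t (xbar \<omega>)) = 0))"
proof (cases "\<exists>xb. solution xb")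
  \<comment> \<open>Without a solution the conditions that refer to solutions are void, and zero
    multipliers serve.\<close>
  case False
  then show ?thesis
    using subspace_0[OF subspace_W] subspace_0[OF subspace_V]
    by (intro exI[of _ "\<lambda>_ _. 0"]) (auto simp: Lagrange_multipliers_def le_W_def)
next
  case True
  then obtain xb where xb: "solution xb"
    by blast
  obtain p q where mult: "multipliers UNIV p q" and orth: "\<And>t. orthogonal_to (G t) (q t)" and qV: "\<And>t \<omega>. q t \<omega> \<in> V t"
    and max: "AE \<omega> in M. \<forall>a\<in>Aprod \<omega>. lag extended_f p q \<omega> a \<le> lag extended_f p q \<omega> (xb \<omega>)"
    and compl: "\<And>t. AE \<omega> in M. p t \<omega> \<bullet> constr t xb \<omega> = 0"
    by (rule solution_multipliers[OF xb]) blast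
  note lint = integrable_lag[OF integrand_extended_f mult]
  have sol: "x \<in> adapted_programs" "x \<in> programs" "\<And>t. satisfies_constraint t x" "F x = F xb" if "solution x" for x
    using that xb by (auto simp: solution_def feasible_def adapted_programsD(1) intro: antisym)
  note xbP = sol(2)[OF xb]
  have elag: "expectation (\<lambda>\<omega>. lag extended_f p q \<omega> (x \<omega>)) = F x + (\<Sum>t\<in>UNIV. expectation (\<lambda>\<omega>. p t \<omega> \<bullet> constr t x \<omega>))"
    if "x \<in> adapted_programs" for x
    unfolding expectation_lag[OF integrand_extended_f mult adapted_programsD(1)[OF that]]
    using orthogonal_toD[OF orth adapted_programsD(2)[OF that] program_bound[OF adapted_programsD(1)[OF that]]]
    by (simp add: obj_extended_f[OF adapted_programsD(1)[OF that]])
  have le: "expectation (\<lambda>\<omega>. lag extended_f p q \<omega> (x \<omega>)) \<le> F xb" if x: "x \<in> programs" for x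
  proof -
    have "expectation (\<lambda>\<omega>. lag extended_f p q \<omega> (x \<omega>)) \<le> expectation (\<lambda>\<omega>. lag extended_f p q \<omega> (xb \<omega>))"
      using lint[OF x] lint[OF xbP]
    proof (rule integral_mono_AE)
      show "AE \<omega> in M. lag extended_f p q \<omega> (x \<omega>) \<le> lag extended_f p q \<omega> (xb \<omega>)"
        using max programsD(4)[OF x] by eventually_elim blast
    qed
    also have "expectation (\<lambda>\<omega>. p t \<omega> \<bullet> constr t xb \<omega>) = 0" for t
      using compl[of t] by (rule integral_eq_zero_AE)
    then have "expectation (\<lambda>\<omega>. lag extended_f p q \<omega> (xb \<omega>)) = F xb"
      by (simp add: elag[OF sol(1)[OF xb]])
    finally show ?thesis .
  qed
  have key: "expectation (\<lambda>\<omega>. lag extended_f p q \<omega> (x \<omega>)) = F xb"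
    "AE \<omega> in M. p t \<omega> \<bullet> constr t x \<omega> = 0" "expectation (\<lambda>\<omega>. p t \<omega> \<bullet> constr t x \<omega>) = 0"
    if s: "solution x" for x t
  proof -
    have nn: "AE \<omega> in M. 0 \<le> p t \<omega> \<bullet> constr t x \<omega>" for t
      using sol(3)[OF s, unfolded satisfies_constraint_iff, of t] AE_space
      by eventually_elim (auto intro: inner_W_nonneg multipliersD[OF mult])
    have en: "0 \<le> expectation (\<lambda>\<omega>. p t \<omega> \<bullet> constr t x \<omega>)" for t
      by (rule integral_nonneg_AE[OF nn])
    then have "0 \<le> (\<Sum>t\<in>UNIV. expectation (\<lambda>\<omega>. p t \<omega> \<bullet> constr t x \<omega>))"
      by (simp add: sum_nonneg)
    then have sum: "(\<Sum>t\<in>UNIV. expectation (\<lambda>\<omega>. p t \<omega> \<bullet> constr t x \<omega>)) = 0"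
      using le[OF sol(2)[OF s]] elag[OF sol(1)[OF s]] sol(4)[OF s] by linarith
    then show "expectation (\<lambda>\<omega>. lag extended_f p q \<omega> (x \<omega>)) = F xb"
      by (simp add: elag[OF sol(1)[OF s]] sol(4)[OF s])
    show z: "expectation (\<lambda>\<omega>. p t \<omega> \<bullet> constr t x \<omega>) = 0"
      using sum_nonneg_eq_0_iff[of UNIV "\<lambda>t. expectation (\<lambda>\<omega>. p t \<omega> \<bullet> constr t x \<omega>)"] en sum by simp
    show "AE \<omega> in M. p t \<omega> \<bullet> constr t x \<omega> = 0"
      using integral_nonneg_eq_0_iff_AE[OF integrable_p_constr[OF mult sol(2)[OF s]] nn] z by simp
  qed
  have "Lagrange_multipliers p q"
    unfolding Lagrange_multipliers_def
  proof (intro conjI allI ballI impI)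
    fix x xbar t assume x: "x \<in> programs" and s: "solution xbar"
    show "Lagrangian p q x \<le> Lagrangian p q xbar"
      using le[OF x] key(1)[OF s] by (simp add: Lagrangian_eq[OF mult orth] x sol(2)[OF s])
    show "expectation (\<lambda>\<omega>. p t \<omega> \<bullet> g t \<omega> (past t (xbar \<omega>))) = 0"
      using key(3)[OF s, of t] by (simp add: constr_def)
  qed (use multipliersD[OF mult] qV in auto)
  moreover have "AE \<omega> in M. x \<omega> \<in> Aprod \<omega> \<and>
      (\<forall>a\<in>Aprod \<omega>. reduced_Lagrangian p q \<omega> a \<le> reduced_Lagrangian p q \<omega> (x \<omega>))" if s: "solution x" for x
  proof -
    have d: "AE \<omega> in M. 0 \<le> lag extended_f p q \<omega> (xb \<omega>) - lag extended_f p q \<omega> (x \<omega>)"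
      using max programsD(4)[OF sol(2)[OF s]] by eventually_elim simp
    have "AE \<omega> in M. lag extended_f p q \<omega> (xb \<omega>) - lag extended_f p q \<omega> (x \<omega>) = 0"
      using integral_nonneg_eq_0_iff_AE[OF Bochner_Integration.integrable_diff[OF lint[OF xbP] lint[OF sol(2)[OF s]]] d]
        key(1)[OF xb] key(1)[OF s] lint[OF xbP] lint[OF sol(2)[OF s]] by simp
    \<comment> \<open>Thus subtracting the conditional expectation changes \<open>q\<close> only on
      a null set, and the reduced Lagrangian coincides with \<open>lag\<close> on
      \<open>Aprod\<close>.\<close>
    moreover have "AE \<omega> in M. \<forall>t\<in>UNIV. vec_cond_exp M (G t) (q t) \<omega> = 0"
      using orthogonal_to_vec_cond_exp[OF subalgebra_G multipliersD(3)[OF mult] orth]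
      by (intro AE_ball_countable[THEN iffD2]) (auto intro: countable_finite)
    ultimately show ?thesis
      using max programsD(4)[OF sol(2)[OF s]]
    proof eventually_elim
      case (elim \<omega>)
      have "reduced_Lagrangian p q \<omega> a = lag extended_f p q \<omega> a" if "a \<in> Aprod \<omega>" for a
        using elim(2) that by (simp add: reduced_Lagrangian_def lag_def extended_f_def sum.distrib)
      then show ?case
        using elim by simp
    qed
  qed
  ultimately show ?thesis
    using key(2) unfolding constr_def by blast
qed

end

theorem theorem2:
  fixes M :: "'a measure"
    and N :: nat
    and time :: "'t::{finite,order} \<Rightarrow> nat"
    and G :: "'t \<Rightarrow> 'a measure"
    and V :: "'t \<Rightarrow> 'v::euclidean_space set"
    and J :: "'t \<Rightarrow> 'w::euclidean_space set"
    and A :: "'t \<Rightarrow> 'a \<Rightarrow> 'v set"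
    and g :: "'t \<Rightarrow> 'a \<Rightarrow> ('v, 't) vec \<Rightarrow> 'w"
    and F :: "('a \<Rightarrow> ('v, 't) vec) \<Rightarrow> real"
    and f :: "'a \<Rightarrow> ('v, 't) vec \<Rightarrow> real"
  assumes "integral_objective M N time G V J A g F f"
  shows "\<exists>p q. decision_model.Lagrange_multipliers M G V J A g F p q \<and>
    (\<forall>xbar. decision_model.solution M G V J A g F xbar \<longrightarrow>
      (AE \<omega> in M. xbar \<omega> \<in> decision_model.Aprod A \<omega> \<and>
        (\<forall>a\<in>decision_model.Aprod A \<omega>.
           integral_objective.reduced_Lagrangian M G g f p q \<omega> a
             \<le> integral_objective.reduced_Lagrangian M G g f p q \<omega> (xbar \<omega>))) \<and>
      (\<forall>t. AE \<omega> in M. p t \<omega> \<bullet> g t \<omega> (decision_model.past t (xbar \<omega>)) = 0))"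
  by (rule integral_objective.Lagrange_multipliers_exist[OF assms])

end
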